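(* Let $d,x$ be integers strictly larger than $2$, and for a polynomial $P\in\mathbb Z[t]$ put $$E_P(x):=\#\{n\in \mathbb Z\cap[1,x]:\ P(n)\ \text{square-free}\}-\mathfrak S_P\, x,\qquad \mathfrak S_P:=\prod_{\ell\ \text{prime}}\left(1-\frac{\#\{t\in\mathbb Z/\ell^2\mathbb Z:\ P(t)=0\}}{\ell^2}\right).$$ Let $$\gamma_0:=-4\frac{\zeta(-1/2)}{\zeta(2)^2}\prod_{\ell\ \text{prime}}\left(1-\frac{2-\ell^{-1/2}+\ell^{-1}}{(\ell+1)^2}\right).$$ \begin{enumerate} \item For any $\alpha<\frac{1}{d+3}$ there exists $\delta>0$ such that whenever $H$ satisfies $x\le H^{\alpha}$ we have $$(2H)^{-d-1}\sum_{\substack{P\in\mathbb Z[t]\\ \deg(P)=d,\ |P|\le H}}|E_P(x)|^2=\gamma_0x^{1/2}+O(x^{1/2-\delta}),$$ with an implied constant depending only on $\alpha$ and $\delta$. \item For any $\epsilon>0$ and $0<\beta<\frac{1}{d+28/9}$ and all $H$ satisfying $x\le H^{\beta}$ we have $$(2H)^{-d-1}\sum_{\substack{P\in\mathbb Z[t]\\ \deg(P)=d,\ |P|\le H}}|E_P(x)|^2=\gamma_0x^{1/2}+O(x^{4/9+\epsilon}),$$ where the implied constant depends only on $\epsilon$ and $\beta$. \end{enumerate}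
   Context: For $P\in\mathbb Z[t]$, $|P|$ denotes the maximum modulus of the coefficients of $P$. An integer $m$ is square-free if $m\neq 0$ and no square of a prime divides $m$. $\zeta$ is the Riemann zeta function (with its analytic continuation, so $\zeta(-1/2)$ is its value there); products over $\ell$ run over all primes. $O(\cdot)$ is the usual Landau notation. *)

theory Defs
  imports
    "HOL-Complex_Analysis.Complex_Analysis"
    "HOL-Computational_Algebra.Computational_Algebra"
    "HOL-Number_Theory.Cong"
begin

(* The Riemann zeta function as the holomorphic continuation of the Dirichlet series to
   the plane without 1.  The value at 1 is unspecified. *)
definition zeta :: "complex \<Rightarrow> complex" where
  "zeta = (SOME f. f holomorphic_on (- {1}) \<and>
     (\<forall>s. Re s > 1 \<longrightarrow> (\<lambda>n. of_nat (Suc n) powr (- s)) sums f s))"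

lemma zeta_unique:
  assumes hol: "f holomorphic_on (- {1})"
    and series: "\<And>s. Re s > 1 \<Longrightarrow> (\<lambda>n. of_nat (Suc n) powr (- s)) sums f s"
    and s: "s \<noteq> 1"
  shows "zeta s = f s"
proof -
  have z: "zeta holomorphic_on (- {1}) \<and>
     (\<forall>s. Re s > 1 \<longrightarrow> (\<lambda>n. of_nat (Suc n) powr (- s)) sums zeta s)"
    unfolding zeta_def by (rule someI[of _ f]) (use hol series in auto)
  show ?thesis
  proof (rule analytic_continuation_open[where f = zeta and g = f
        and s = "{z. Re z > 1}" and s' = "- {1}"])
    show "open {z. Re z > 1}" by (rule open_halfspace_Re_gt)
    show "{z. Re z > 1} \<noteq> {}" by (auto intro!: exI[of _ 2])
    show "connected (- {1::complex})" by (rule connected_punctured_universe) simp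
    show "zeta z = f z" if "z \<in> {z. Re z > 1}" for z
      using that z series[of z] by (auto dest: sums_unique2)
  qed (use z hol s in auto)
qed

(* Limit of the partial products over the primes up to N.  Unlike prodinf, this gives 0
   when the partial products tend to 0, which happens for the singular series
   of a polynomial that is not separable. *)
definition prime_prod :: "(nat \<Rightarrow> real) \<Rightarrow> real" where
  "prime_prod f = lim (\<lambda>N. \<Prod>p | prime p \<and> p \<le> N. f p)"

lemma prime_prod_LIMSEQ:
  assumes "\<And>p. prime p \<Longrightarrow> 0 \<le> f p \<and> f p \<le> 1"
  shows "(\<lambda>N. \<Prod>p | prime p \<and> p \<le> N. f p) \<longlonglongrightarrow> prime_prod f"
proof -
  let ?g = "\<lambda>N. \<Prod>p | prime p \<and> p \<le> N. f p"
  have nonneg: "?g N \<ge> 0" for N using assms by (auto intro!: prod_nonneg)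
  have "?g M \<le> ?g N" if "N \<le> M" for M N
  proof -
    have "{p. prime p \<and> p \<le> M} =
        {p. prime p \<and> p \<le> N} \<union> {p. prime p \<and> p \<le> M \<and> \<not> p \<le> N}"
      using that by auto
    then have "?g M = ?g N * (\<Prod>p | prime p \<and> p \<le> M \<and> \<not> p \<le> N. f p)"
      by (simp only:) (rule prod.union_disjoint, auto)
    also have "\<dots> \<le> ?g N * 1"
      using assms nonneg by (intro mult_left_mono prod_le_1) auto
    finally show ?thesis by simp
  qed
  then have "decseq ?g" by (auto simp: decseq_def)
  then obtain L where "?g \<longlonglongrightarrow> L" using decseq_convergent[of ?g 0] nonneg by blast
  then have "convergent ?g" by (rule convergentI)
  then show ?thesis unfolding prime_prod_def by (simp add: convergent_LIMSEQ_iff)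
qed

definition height :: "int poly \<Rightarrow> int" where
  "height P = Max ((\<lambda>i. \<bar>coeff P i\<bar>) ` {..degree P})"

definition roots_mod :: "int poly \<Rightarrow> nat \<Rightarrow> int set" where
  "roots_mod P m = {t \<in> {0..<int m}. [poly P t = 0] (mod int m)}"

definition singular_series :: "int poly \<Rightarrow> real" where
  "singular_series P = prime_prod (\<lambda>l. 1 - real (card (roots_mod P (l\<^sup>2))) / real (l\<^sup>2))"

(* squarefree (0::int) is False, in line with the convention that square-free integers are nonzero. *)
definition sqfree_error :: "int poly \<Rightarrow> nat \<Rightarrow> real" where
  "sqfree_error P x =
     real (card {n \<in> {1..int x}. squarefree (poly P n)}) - singular_series P * real x"

lemma squarefree_int_iff:
  "squarefree (m::int) \<longleftrightarrow> m \<noteq> 0 \<and> \<not> (\<exists>p. prime p \<and> p\<^sup>2 dvd m)"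
  by (cases "m = 0") (auto simp: squarefree_factorial_semiring)

lemma singular_series_LIMSEQ:
  "(\<lambda>N. \<Prod>l | prime l \<and> l \<le> N. 1 - real (card (roots_mod P (l\<^sup>2))) / real (l\<^sup>2))
     \<longlonglongrightarrow> singular_series P"
  unfolding singular_series_def
proof (rule prime_prod_LIMSEQ)
  fix l :: nat assume "prime l"
  have "card (roots_mod P (l\<^sup>2)) \<le> card {0..<int (l\<^sup>2)}"
    unfolding roots_mod_def by (rule card_mono) auto
  then have "real (card (roots_mod P (l\<^sup>2))) \<le> real (l\<^sup>2)"
    by (simp del: of_nat_power)
  moreover have "real (l\<^sup>2) > 0" using \<open>prime l\<close> by (simp add: prime_gt_0_nat)
  ultimately show "0 \<le> 1 - real (card (roots_mod P (l\<^sup>2))) / real (l\<^sup>2) \<and>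
      1 - real (card (roots_mod P (l\<^sup>2))) / real (l\<^sup>2) \<le> 1"
    by (simp add: divide_le_eq_1 del: of_nat_power)
qed

(* zeta (-1/2) and zeta 2 are real numbers, so taking real parts loses nothing. *)
definition gamma0 :: real where
  "gamma0 = - 4 * (Re (zeta (- 1 / 2)) / (Re (zeta 2))\<^sup>2) *
     prime_prod (\<lambda>l. 1 - (2 - real l powr (- 1 / 2) + real l powr (- 1)) / (real l + 1)\<^sup>2)"

definition second_moment :: "nat \<Rightarrow> nat \<Rightarrow> real \<Rightarrow> real" where
  "second_moment d x H =
     (2 * H) powi (- int d - 1) *
       (\<Sum>P | degree P = d \<and> real_of_int (height P) \<le> H. \<bar>sqfree_error P x\<bar>\<^sup>2)"

end

theory Submission
  imports Defs "HOL-Number_Theory.Totient"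
begin

text \<open>
  The Moebius expansions of the square-free indicator and of the singular series are truncated at
  \<open>L = H\<^sup>1\<^sup>/\<^sup>3\<close>. The discarded parts are small on average over the box of polynomials: multiples of
  large squares are counted by means of the two lowest coefficients, and the tail of the singular
  series is bounded by Rankin's trick, using that the primes at which \<open>P\<close> has more than \<open>d\<close> roots
  modulo \<open>p\<^sup>2\<close> divide a weak substitute for the discriminant. For \<open>t \<noteq> u\<close> the pair \<open>(P(t), P(u))\<close> is
  equidistributed modulo \<open>(a\<^sup>2, b\<^sup>2)\<close> up to the condition imposed by \<open>gcd(t - u, a\<^sup>2, b\<^sup>2)\<close>. Hence the
  mean square of the truncated error is a sum over \<open>a, b\<close> and \<open>e\<close> dividing \<open>gcd(a, b)\<^sup>2\<close> of
  multiples of \<open>\<psi>(x/e)\<close> with \<open>\<psi>(y) = {y} (1 - {y})\<close>, the variance of the number of points of an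
  interval of length \<open>y\<close> in a residue class. Summed over all \<open>a, b\<close> it becomes an Euler product of
  dilation operators applied to \<open>\<psi>\<close>. These operators commute with \<open>f \<mapsto> f - f(\<cdot>/p\<^sup>2)\<close>, whose product
  recovers \<open>\<psi>\<close> from \<open>g(y) = \<Sum>b. \<psi>(y/b\<^sup>2)\<close>; on \<open>g(y) = c \<surd>y + O(y\<^sup>4\<^sup>/\<^sup>9)\<close> they act by multiplying
  \<open>\<surd>y\<close> by the local factors of \<open>\<gamma>\<^sub>0\<close> up to a convergent product of error factors. Comparing the sum
  with its integral gives \<open>c\<close> as a sum of trapezoid rule defects of the square root, which equals
  \<open>-4 \<zeta>(-1/2)\<close>.
\<close>

section \<open>Sets of primes\<close>

text \<open>The local operators cannot be multiplied out on \<open>psi\<close> directly. At each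
  prime the operator scales \<open>sqrt y\<close> by about \<open>1 + 1 / p\<close> and an error
  \<open>y^(4/9)\<close> by about \<open>1 + p^(-8/9)\<close>, and both products diverge.
  Composition with \<open>f(y) - f(y / p^2)\<close> turns these factors into
  \<open>1 + O(p^(-2))\<close> and \<open>1 + O(p^(-16/9))\<close>, so the whole computation is done
  on the sum over squares and returned to \<open>psi\<close> at the end. The cut
  \<open>L = H^(1/3)\<close> balances two losses: equidistribution of the pairs costs
  \<open>x^2 L^2 / H\<close>, while squares beyond the cut cost about \<open>x^2 / L\<close>. Both
  become \<open>x^2 H^(-1/3)\<close>, which is bounded because \<open>d >= 3\<close> gives
  \<open>x^6 <= H\<close>. Both claims of the theorem come from a single error
  \<open>O(x^(4/9))\<close> under \<open>x^(d + 3) <= H\<close>. The delicate term is the one from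
  large square divisors: it fits only because averaging over two coefficients instead of one saves a
  factor \<open>n\<close> at the argument \<open>n\<close>.\<close>

definition primes_upto :: "nat \<Rightarrow> nat set" where
  "primes_upto n = {p. prime p \<and> p \<le> n}"

lemma finite_primes_upto [simp]: "finite (primes_upto n)"
  unfolding primes_upto_def by (rule finite_subset[of _ "{..n}"]) auto

lemma prime_primes_upto: "p \<in> primes_upto n \<Longrightarrow> prime p"
  by (simp add: primes_upto_def)

lemma primes_upto_0 [simp]: "primes_upto 0 = {}"
  by (auto simp: primes_upto_def)

lemma primes_upto_Suc:
  "primes_upto (Suc n) = (if prime (Suc n) then insert (Suc n) (primes_upto n) else primes_upto n)"
  by (auto simp: primes_upto_def le_Suc_eq)

lemma prime_factors_prod_primes:
  fixes A :: "nat set"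
  assumes "finite A" "\<And>p. p \<in> A \<Longrightarrow> prime p"
  shows "prime_factors (\<Prod>A) = A"
  using assms
proof (induction A rule: finite_induct)
  case (insert p A)
  have "\<Prod>A \<noteq> 0" using insert.prems by (metis (no_types, lifting) insertCI insert.hyps(1) not_prime_0 prod_zero_iff)
  moreover have "prime p" using insert.prems by blast
  ultimately have "prime_factors (p * \<Prod>A) = prime_factors p \<union> prime_factors (\<Prod>A)"
    by (intro prime_factors_product) auto
  then show ?case using insert \<open>prime p\<close> by (simp add: prime_prime_factors)
qed simp

text \<open>A squarefree integer is encoded throughout by its finite set of primes, with
  \<open>(- 1) ^ card A\<close> as its Moebius function. Since \<open>prime_factors\<close> recovers
  the set from the product, sets can be counted as integers.\<close>

lemma inj_on_prod_primes:
  fixes \<A> :: "nat set set"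
  assumes "\<And>A. A \<in> \<A> \<Longrightarrow> finite A \<and> (\<forall>p\<in>A. prime p)"
  shows "inj_on Prod \<A>"
proof (rule inj_on_inverseI[where g = prime_factors])
  show "prime_factors (\<Prod>A) = A" if "A \<in> \<A>" for A
    using assms[OF that] by (intro prime_factors_prod_primes) auto
qed

lemma coprime_prod_primes:
  fixes A :: "nat set"
  assumes "finite A" "\<And>q. q \<in> A \<Longrightarrow> prime q" "prime p" "p \<notin> A"
  shows "coprime p (\<Prod>A)"
  by (rule prod_coprime_right) (use assms primes_coprime in metis)

lemma prod_primes_pos:
  fixes A :: "nat set"
  assumes "\<And>p. p \<in> A \<Longrightarrow> prime p"
  shows "\<Prod>A > 0"
  using assms by (auto intro!: prod_pos simp: prime_gt_0_nat)

lemma prod_primes_square_dvd_iff: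
  fixes A :: "nat set" and v :: int
  assumes "finite A" "\<And>p. p \<in> A \<Longrightarrow> prime p"
  shows "int ((\<Prod>A)\<^sup>2) dvd v \<longleftrightarrow> (\<forall>p\<in>A. int (p\<^sup>2) dvd v)"
  using assms
proof (induction A rule: finite_induct)
  case (insert p A)
  have "coprime p (\<Prod>A)" using insert by (intro coprime_prod_primes) auto
  then have "coprime (int (p\<^sup>2)) (int ((\<Prod>A)\<^sup>2))" by (simp only: coprime_int_iff) simp
  moreover have "int ((\<Prod>(insert p A))\<^sup>2) = int (p\<^sup>2) * int ((\<Prod>A)\<^sup>2)"
    using insert by (simp add: power_mult_distrib)
  ultimately have "int ((\<Prod>(insert p A))\<^sup>2) dvd v \<longleftrightarrow> int (p\<^sup>2) dvd v \<and> int ((\<Prod>A)\<^sup>2) dvd v"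
    by (metis divides_mult dvd_mult_left dvd_mult_right)
  then show ?case using insert by simp
qed simp

lemma sum_Pow_minus_one:
  assumes "finite B"
  shows "(\<Sum>A\<in>Pow B. (- 1 :: real) ^ card A) = (if B = {} then 1 else 0)"
proof -
  have "(\<Sum>A\<in>Pow B. (- 1 :: real) ^ card A) = (\<Sum>A\<in>Pow B. (\<Prod>p\<in>A. - 1) * (\<Prod>p\<in>B - A. 1))"
    by simp
  also have "\<dots> = (\<Prod>p\<in>B. - 1 + 1)" by (rule prod_add[symmetric]) fact
  finally show ?thesis using assms by (auto simp: card_gt_0_iff)
qed

lemma sum_Pow_prod:
  fixes f :: "'a \<Rightarrow> 'b :: comm_ring_1"
  assumes "finite S"
  shows "(\<Sum>A\<in>Pow S. \<Prod>p\<in>A. f p) = (\<Prod>p\<in>S. 1 + f p)"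
  using prod_add[OF assms, of f "\<lambda>_. 1"] by (simp add: add.commute)

text \<open>Rankin's trick: on the range of summation the product of \<open>A\<close> divided by
  \<open>L\<close> exceeds 1, so its power \<open>s\<close> may be inserted; after that the
  condition is dropped and the sum over all subsets factors over the primes.\<close>

lemma rankin_bound:
  fixes f :: "nat \<Rightarrow> real"
  assumes S: "finite S" "0 \<notin> S" and f: "\<And>p. p \<in> S \<Longrightarrow> f p \<ge> 0" and L: "L > 0" and s: "s \<ge> 0"
  shows "(\<Sum>A | A \<subseteq> S \<and> L < real (\<Prod>A). \<Prod>p\<in>A. f p)
    \<le> L powr (- s) * (\<Prod>p\<in>S. 1 + f p * real p powr s)"
proof -
  have fin: "finite A" if "A \<subseteq> S" for A using S finite_subset that by blast
  have "(\<Sum>A | A \<subseteq> S \<and> L < real (\<Prod>A). \<Prod>p\<in>A. f p)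
    \<le> (\<Sum>A | A \<subseteq> S \<and> L < real (\<Prod>A). L powr (- s) * (\<Prod>p\<in>A. f p * real p powr s))"
  proof (rule sum_mono, clarify)
    fix A assume A: "A \<subseteq> S" "L < real (\<Prod>A)"
    have nn: "(\<Prod>p\<in>A. f p) \<ge> 0" using A f by (intro prod_nonneg) auto
    have "1 = L powr (- s) * L powr s" using L by (simp add: powr_minus)
    also have "\<dots> \<le> L powr (- s) * real (\<Prod>A) powr s"
      using A L s by (intro mult_left_mono powr_mono2) auto
    also have "real (\<Prod>A) powr s = (\<Prod>p\<in>A. real p powr s)"
      by (simp add: prod_powr_distrib)
    finally have "(\<Prod>p\<in>A. f p) * 1 \<le> (\<Prod>p\<in>A. f p) * (L powr (- s) * (\<Prod>p\<in>A. real p powr s))"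
      using nn by (rule mult_left_mono)
    then show "(\<Prod>p\<in>A. f p) \<le> L powr (- s) * (\<Prod>p\<in>A. f p * real p powr s)"
      by (simp add: prod.distrib mult_ac)
  qed
  also have "\<dots> = L powr (- s) * (\<Sum>A | A \<subseteq> S \<and> L < real (\<Prod>A). \<Prod>p\<in>A. f p * real p powr s)"
    by (simp add: sum_distrib_left)
  also have "\<dots> \<le> L powr (- s) * (\<Sum>A\<in>Pow S. \<Prod>p\<in>A. f p * real p powr s)"
    using f S by (intro mult_left_mono sum_mono2) (auto intro!: prod_nonneg)
  also have "(\<Sum>A\<in>Pow S. \<Prod>p\<in>A. f p * real p powr s) = (\<Prod>p\<in>S. 1 + f p * real p powr s)"
    by (rule sum_Pow_prod) fact
  finally show ?thesis .
qed

text \<open>By \<open>1 + t <= exp t\<close> the product is at most the exponential of a partial sum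
  of a convergent series, which gives one constant for all finite sets.\<close>

lemma prod_one_plus_bounded:
  fixes c s :: real
  assumes c: "c \<ge> 0" and s: "s > 1"
  obtains K where "K \<ge> 1"
    "\<And>S :: nat set. finite S \<Longrightarrow> 0 \<notin> S \<Longrightarrow> (\<Prod>p\<in>S. 1 + c * real p powr (- s)) \<le> K"
proof
  define Z where "Z = (\<Sum>n. real n powr (- s))"
  have sm: "summable (\<lambda>n. real n powr (- s))" using s by (subst summable_real_powr_iff) simp
  have "Z \<ge> 0" unfolding Z_def by (rule suminf_nonneg[OF sm]) simp
  then show "exp (c * Z) \<ge> 1" using c by simp
  fix S :: "nat set" assume S: "finite S" "0 \<notin> S"
  have "(\<Prod>p\<in>S. 1 + c * real p powr (- s)) \<le> (\<Prod>p\<in>S. exp (c * real p powr (- s)))"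
    using c by (intro prod_mono conjI exp_ge_add_one_self add_nonneg_nonneg mult_nonneg_nonneg) auto
  also have "\<dots> = exp (c * (\<Sum>p\<in>S. real p powr (- s)))"
    by (simp add: exp_sum S sum_distrib_left)
  also have "\<dots> \<le> exp (c * Z)"
    unfolding Z_def using c S by (auto intro!: mult_left_mono sum_le_suminf sm)
  finally show "(\<Prod>p\<in>S. 1 + c * real p powr (- s)) \<le> exp (c * Z)" .
qed

text \<open>A prime above \<open>K powr (1 / e)\<close> pays for its own factor \<open>K\<close>,
  because then \<open>K <= p powr e\<close>; the at most \<open>B\<close> smaller primes cost a
  constant. The case \<open>K = 2\<close> bounds the number of Moebius terms of a polynomial value,
  the case \<open>K = 1 + d\<close> the influence of the primes dividing the eliminant.\<close>

lemma power_card_prime_factors_bound: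
  fixes K e :: real
  assumes K: "K \<ge> 1" and e: "e > 0"
  obtains C where "C \<ge> 1" "\<And>m :: nat. m > 0 \<Longrightarrow> K ^ card (prime_factors m) \<le> C * real m powr e"
proof
  define B where "B = nat \<lceil>K powr (1 / e)\<rceil>"
  have B: "K \<le> real p powr e" if "p > B" for p
  proof -
    have "K powr (1 / e) \<le> real p" using that unfolding B_def by linarith
    then have "(K powr (1 / e)) powr e \<le> real p powr e" using e by (intro powr_mono2) auto
    then show ?thesis using e K by (simp add: powr_powr)
  qed
  show "K ^ B \<ge> 1" using K by simp
  fix m :: nat assume m: "m > 0"
  let ?P = "prime_factors m"
  let ?s = "{p\<in>?P. p \<le> B}" and ?l = "{p\<in>?P. p > B}"
  have "?P = ?s \<union> ?l" by auto
  then have "card ?P = card ?s + card ?l"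
    by (metis (no_types, lifting) card_Un_disjoint finite_Un finite_set_mset disjoint_iff mem_Collect_eq not_le)
  then have "K ^ card ?P = K ^ card ?s * K ^ card ?l" by (simp add: power_add)
  also have "\<dots> \<le> K ^ B * (\<Prod>p\<in>?l. real p powr e)"
  proof (rule mult_mono)
    have "?s \<subseteq> {1..B}" by (auto simp: Suc_le_eq prime_gt_0_nat in_prime_factors_iff)
    then have "card ?s \<le> B" using card_mono[of "{1..B}" ?s] by simp
    then show "K ^ card ?s \<le> K ^ B" using K by (rule power_increasing)
    have "K ^ card ?l = (\<Prod>p\<in>?l. K)" by simp
    also have "\<dots> \<le> (\<Prod>p\<in>?l. real p powr e)" using B K by (intro prod_mono) auto
    finally show "K ^ card ?l \<le> (\<Prod>p\<in>?l. real p powr e)" .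
  qed (use K in auto)
  also have "(\<Prod>p\<in>?l. real p powr e) = real (\<Prod>?l) powr e"
    by (simp add: prod_powr_distrib)
  also have "\<dots> \<le> real m powr e"
  proof -
    have "\<Prod>?l dvd m"
    proof -
      have "\<Prod>?l dvd \<Prod>?P" by (rule prod_dvd_prod_subset) auto
      also have "\<Prod>?P dvd m" 
      proof -
        have "(\<Prod>p\<in>?P. p) dvd (\<Prod>p\<in>?P. p ^ multiplicity p m)"
          by (rule prod_dvd_prod) (auto simp: prime_factors_multiplicity intro!: dvd_power)
        also have "\<dots> = m" using m by (simp add: prod_prime_factors)
        finally show ?thesis by simp
      qed
      finally show ?thesis .
    qed
    then have "\<Prod>?l \<le> m" using m by (rule dvd_imp_le)
    then show ?thesis using e by (intro powr_mono2) (auto simp flip: of_nat_prod)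
  qed
  finally show "K ^ card ?P \<le> K ^ B * real m powr e" using K by (simp add: mult_left_mono)
qed

section \<open>The kernel \<open>{y} (1 - {y})\<close> summed over square dilations\<close>

definition psi :: "real \<Rightarrow> real" where
  "psi y = frac y * (1 - frac y)"

lemma psi_nonneg: "psi y \<ge> 0"
  unfolding psi_def using frac_lt_1[of y] by (intro mult_nonneg_nonneg) auto

lemma psi_le_frac: "psi y \<le> frac y" "psi y \<le> 1 - frac y"
  unfolding psi_def using frac_lt_1[of y] frac_ge_0[of y]
  by (auto simp: mult_left_le mult_left_le_one_le)

lemma psi_le_1: "psi y \<le> 1"
  using psi_le_frac(1)[of y] frac_lt_1[of y] by linarith

lemma psi_le_self:
  assumes "y \<ge> 0"
  shows "psi y \<le> y"
proof -
  have "frac y \<le> y" using assms by (simp add: frac_def)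
  then show ?thesis using psi_le_frac(1)[of y] by linarith
qed

text \<open>Within one unit interval the difference factors, with a second factor of modulus at most
  1. If an integer separates the points, each value is at most the distance to an integer lying
  between them, since \<open>psi\<close> vanishes there.\<close>

lemma psi_lipschitz_aux:
  assumes "v \<le> w"
  shows "\<bar>psi v - psi w\<bar> \<le> w - v"
proof (cases "\<lfloor>v\<rfloor> = \<lfloor>w\<rfloor>")
  case True
  have bounds: "- 1 \<le> 1 - frac v - frac w" "1 - frac v - frac w \<le> 1"
    using frac_lt_1[of v] frac_ge_0[of v] frac_lt_1[of w] frac_ge_0[of w] by linarith+
  have "psi v - psi w = (frac v - frac w) * (1 - frac v - frac w)"
    unfolding psi_def by (simp add: algebra_simps)
  then have "\<bar>psi v - psi w\<bar> = \<bar>frac v - frac w\<bar> * \<bar>1 - frac v - frac w\<bar>"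
    by (simp add: abs_mult)
  also have "\<dots> \<le> \<bar>frac v - frac w\<bar> * 1"
    using bounds by (intro mult_left_mono) (auto simp: abs_le_iff)
  also have "\<dots> = w - v" using True assms by (simp add: frac_def)
  finally show ?thesis .
next
  case False
  then have "\<lfloor>v\<rfloor> + 1 \<le> \<lfloor>w\<rfloor>" using assms floor_mono[OF assms] by linarith
  then have "real_of_int \<lfloor>v\<rfloor> + 1 \<le> real_of_int \<lfloor>w\<rfloor>" by linarith
  then have "1 - frac v + frac w \<le> w - v" by (simp add: frac_def)
  then show ?thesis
    using psi_le_frac[of v] psi_le_frac[of w] psi_nonneg[of v] psi_nonneg[of w]
      frac_lt_1[of v] frac_ge_0[of v] frac_lt_1[of w] frac_ge_0[of w] by linarith
qed

lemma psi_lipschitz: "\<bar>psi v - psi w\<bar> \<le> \<bar>v - w\<bar>"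
  using psi_lipschitz_aux[of v w] psi_lipschitz_aux[of w v] by linarith

lemma continuous_psi: "continuous_on UNIV psi"
proof (rule continuous_onI)
  fix x e :: real assume "e > 0"
  then show "\<exists>d>0. \<forall>x'\<in>UNIV. dist x' x < d \<longrightarrow> dist (psi x') (psi x) \<le> e"
    using psi_lipschitz[of _ x] by (intro exI[of _ e]) (auto simp: dist_real_def intro: order_trans[OF _ less_imp_le])
qed

text \<open>At the right end the floor jumps but both sides are 0. Including this end allows closed
  intervals of integration.\<close>

lemma psi_on_unit_interval:
  assumes "real n \<le> v" "v \<le> real n + 1"
  shows "psi v = (v - n) * (n + 1 - v)"
proof (cases "v = real n + 1")
  case True
  then have "v \<in> \<int>" by auto
  then show ?thesis using True by (simp add: psi_def frac_eq_0_iff[THEN iffD2])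
next
  case False
  then have "\<lfloor>v\<rfloor> = int n" using assms by (intro floor_unique) auto
  then show ?thesis by (simp add: psi_def frac_def algebra_simps)
qed

section \<open>The integral of the kernel over inverse squares\<close>

definition psi_integral :: "real \<Rightarrow> real \<Rightarrow> real" where
  "psi_integral s t = integral {s..t} (\<lambda>u. psi (1 / u\<^sup>2))"

lemma psi_integrable:
  assumes "s > 0"
  shows "(\<lambda>u. psi (y / u\<^sup>2)) integrable_on {s..t}"
proof (rule integrable_continuous_real)
  have "continuous_on {s..t} (\<lambda>u. y / u\<^sup>2)" using assms by (intro continuous_intros) auto
  then show "continuous_on {s..t} (\<lambda>u. psi (y / u\<^sup>2))"
    by (rule continuous_on_compose2[OF continuous_psi]) auto
qed

lemma psi_integral_combine:
  assumes "0 < r" "r \<le> s" "s \<le> t"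
  shows "psi_integral r s + psi_integral s t = psi_integral r t"
  unfolding psi_integral_def using assms
  by (intro Henstock_Kurzweil_Integration.integral_combine psi_integrable) auto

lemma psi_integral_nonneg:
  assumes "0 < s"
  shows "psi_integral s t \<ge> 0"
  unfolding psi_integral_def
  by (intro Henstock_Kurzweil_Integration.integral_nonneg psi_integrable assms psi_nonneg)

lemma psi_integral_le_length:
  assumes "0 < s" "s \<le> t"
  shows "psi_integral s t \<le> t - s"
proof -
  have "psi_integral s t \<le> integral {s..t} (\<lambda>u. 1)"
    unfolding psi_integral_def
    by (intro integral_le psi_integrable assms psi_le_1) auto
  then show ?thesis using assms by simp
qed

lemma has_integral_inverse_square:
  assumes "0 < s" "s \<le> t"
  shows "((\<lambda>u. 1 / u\<^sup>2) has_integral 1 / s - 1 / t) {s..t :: real}"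
proof -
  have "((\<lambda>u. 1 / u\<^sup>2) has_integral (- (1 / t)) - (- (1 / s))) {s..t}"
  proof (rule fundamental_theorem_of_calculus)
    show "((\<lambda>u. - (1 / u)) has_vector_derivative 1 / x\<^sup>2) (at x within {s..t})"
      if "x \<in> {s..t}" for x
      unfolding has_real_derivative_iff_has_vector_derivative[symmetric]
      using that assms by (auto intro!: derivative_eq_intros simp: power2_eq_square)
  qed fact
  then show ?thesis by simp
qed

lemma psi_integral_le_inverse:
  assumes "0 < s" "s \<le> t"
  shows "psi_integral s t \<le> 1 / s - 1 / t"
proof -
  have "psi_integral s t \<le> integral {s..t} (\<lambda>u. 1 / u\<^sup>2)"
    unfolding psi_integral_def
    using has_integral_inverse_square[OF assms] assms
    by (intro integral_le psi_integrable psi_le_self) (auto intro: has_integral_integrable)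
  then show ?thesis using has_integral_inverse_square[OF assms] by (simp add: integral_unique)
qed

lemma psi_integral_scale:
  assumes "0 < y" "0 < s" "s \<le> t"
  shows "integral {s..t} (\<lambda>u. psi (y / u\<^sup>2)) = sqrt y * psi_integral (s / sqrt y) (t / sqrt y)"
proof -
  have pos: "sqrt y > 0" using assms by simp
  have "((\<lambda>u. psi (1 / u\<^sup>2)) has_integral psi_integral (s / sqrt y) (t / sqrt y))
      (cbox (s / sqrt y) (t / sqrt y))"
    unfolding psi_integral_def using psi_integrable[of "s / sqrt y" 1 "t / sqrt y"] assms
    by (simp add: integrable_integral)
  from has_integral_affinity[OF this, of "1 / sqrt y" 0]
  have "((\<lambda>u. psi (1 / (u / sqrt y)\<^sup>2)) has_integral sqrt y * psi_integral (s / sqrt y) (t / sqrt y))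
     ((\<lambda>x. sqrt y * x) ` {s / sqrt y..t / sqrt y})"
    using pos by (simp add: scaleR_conv_of_real divide_simps)
  moreover have "(\<lambda>x. sqrt y * x) ` {s / sqrt y..t / sqrt y} = {s..t}"
    using pos assms by (subst image_mult_atLeastAtMost) auto
  moreover have "1 / (u / sqrt y)\<^sup>2 = y / u\<^sup>2" for u
    using assms by (simp add: power_divide)
  ultimately show ?thesis by (simp add: integral_unique)
qed

text \<open>
  Substituting \<open>v = 1 / u\<^sup>2\<close>, the integral of \<open>\<psi>(1 / u\<^sup>2)\<close> over a piece on which \<open>1 / u\<^sup>2\<close> runs
  between consecutive integers turns into \<open>-4\<close> times the error of the trapezoid rule for the square root.
\<close>

definition trapezoid_defect :: "nat \<Rightarrow> real" where
  "trapezoid_defect k =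
     (sqrt k + sqrt (k + 1)) / 2 - 2 / 3 * ((k + 1) * sqrt (k + 1) - k * sqrt k)"

text \<open>Here the integrand is \<open>(1 / u^2 - n) * (n + 1 - 1 / u^2) = - 1 / u^4 + (2 * n + 1)
  / u^2 - n * (n + 1)\<close>, which is integrated term by term.\<close>

lemma has_integral_psi_piece:
  assumes s: "0 < s" "s \<le> t" and n: "\<And>u. u \<in> {s..t} \<Longrightarrow> real n \<le> 1 / u\<^sup>2 \<and> 1 / u\<^sup>2 \<le> real n + 1"
  shows "psi_integral s t =
    (1 / (3 * t ^ 3) - (2 * real n + 1) / t - real n * (real n + 1) * t) -
    (1 / (3 * s ^ 3) - (2 * real n + 1) / s - real n * (real n + 1) * s)"
proof -
  let ?F = "\<lambda>t::real. 1 / (3 * t ^ 3) - (2 * real n + 1) / t - real n * (real n + 1) * t"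
  have "((\<lambda>u. psi (1 / u\<^sup>2)) has_integral ?F t - ?F s) {s..t}"
  proof (rule fundamental_theorem_of_calculus)
    show "(?F has_vector_derivative psi (1 / x\<^sup>2)) (at x within {s..t})" if x: "x \<in> {s..t}" for x
    proof -
      have x0: "x > 0" using x s by auto
      have "(?F has_real_derivative (1 / x\<^sup>2 - real n) * (real n + 1 - 1 / x\<^sup>2)) (at x within {s..t})"
        using x0 by (auto intro!: derivative_eq_intros simp: field_simps power2_eq_square power3_eq_cube)
          (simp_all add: eval_nat_numeral algebra_simps)?
      then show ?thesis using psi_on_unit_interval[of n "1 / x\<^sup>2"] n[OF x]
        by (simp only: has_real_derivative_iff_has_vector_derivative)
    qed
  qed (use s in auto)
  then show ?thesis by (simp add: psi_integral_def integral_unique)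
qed

lemma psi_integral_piece:
  assumes "k \<ge> 1"
  shows "psi_integral (1 / sqrt (real k + 1)) (1 / sqrt k) = - 4 * trapezoid_defect k"
proof -
  have k: "real k > 0" using assms by simp
  have 1: "real k \<le> 1 / u\<^sup>2 \<and> 1 / u\<^sup>2 \<le> real k + 1"
    if u: "u \<in> {1 / sqrt (real k + 1)..1 / sqrt k}" for u
  proof -
    have "u > 0" using u k by (auto intro: less_le_trans[rotated])
    have "(1 / sqrt (real k + 1))\<^sup>2 \<le> u\<^sup>2" "u\<^sup>2 \<le> (1 / sqrt k)\<^sup>2"
      using u \<open>u > 0\<close> by (auto intro!: power_mono)
    then show ?thesis using \<open>u > 0\<close> k by (simp add: power_divide field_simps)
  qed
  have le: "1 / sqrt (real k + 1) \<le> 1 / sqrt k" using k by (simp add: frac_le)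
  \<comment> \<open>The endpoints are \<open>1 / b\<close> and \<open>1 / a\<close> with
    \<open>a^2 = k\<close> and \<open>b^2 = k + 1\<close>, so the evaluation becomes a polynomial
    identity in \<open>a\<close> and \<open>b\<close>.\<close>
  define a b where "a = sqrt k" and "b = sqrt (real k + 1)"
  have ab: "a > 0" "b > 0" "real k = a\<^sup>2" "b\<^sup>2 = a\<^sup>2 + 1" unfolding a_def b_def using k by auto
  have "psi_integral (1 / b) (1 / a) = (1 / (3 * (1 / a) ^ 3) - (2 * real k + 1) / (1 / a) - real k * (real k + 1) * (1 / a)) -
    (1 / (3 * (1 / b) ^ 3) - (2 * real k + 1) / (1 / b) - real k * (real k + 1) * (1 / b))"
    unfolding a_def b_def by (rule has_integral_psi_piece) (use 1 le k in auto)
  also have "\<dots> = (a ^ 3 / 3 - (2 * a\<^sup>2 + 1) * a - a * b\<^sup>2) -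
     (b ^ 3 / 3 - (2 * a\<^sup>2 + 1) * b - a\<^sup>2 * b)"
  proof -
    have "real k + 1 = b\<^sup>2" using ab by simp
    then show ?thesis using ab(1,2)
      by (simp only: ab(3)) (simp add: power_divide power2_eq_square)
  qed
  also have "\<dots> = (a ^ 3 / 3 - (2 * a\<^sup>2 + 1) * a - a * (a\<^sup>2 + 1)) -
     (b\<^sup>2 * b / 3 - (b\<^sup>2 + (b\<^sup>2 - 1)) * b - (b\<^sup>2 - 1) * b)"
    using ab(4) by (simp add: power3_eq_cube power2_eq_square algebra_simps)
  also have "\<dots> = - 4 * ((a + b) / 2 - 2 / 3 * (b\<^sup>2 * b - a\<^sup>2 * a))"
    by (simp add: field_simps power2_eq_square power3_eq_cube)
  also have "\<dots> = - 4 * trapezoid_defect k"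
    by (simp add: trapezoid_defect_def a_def b_def add.commute)
  finally show ?thesis by (simp add: a_def b_def)
qed

lemma psi_integral_telescope:
  "psi_integral (1 / sqrt (real n + 1)) 1 = (\<Sum>k<n. - 4 * trapezoid_defect (Suc k))"
proof (induction n)
  case 0
  have "psi_integral 1 1 = 0" by (simp add: psi_integral_def)
  then show ?case by simp
next
  case (Suc n)
  have "psi_integral (1 / sqrt (real (Suc n) + 1)) 1 =
      psi_integral (1 / sqrt (real (Suc n) + 1)) (1 / sqrt (real (Suc n))) + psi_integral (1 / sqrt (real (Suc n))) 1"
    by (rule psi_integral_combine[symmetric]) (auto simp: frac_le)
  then show ?case using Suc psi_integral_piece[of "Suc n"] by (simp add: add.commute)
qed

text \<open>For \<open>u >= 1\<close> the argument \<open>1 / u^2\<close> stays in the unit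
  interval, so this is the piece \<open>n = 0\<close>. Its limit is the summand \<open>2 / 3\<close>
  of the constant \<open>c\<close> below.\<close>

lemma psi_integral_from_1:
  assumes "t \<ge> 1"
  shows "psi_integral 1 t = 2 / 3 + 1 / (3 * t ^ 3) - 1 / t"
proof -
  have "0 \<le> 1 / u\<^sup>2 \<and> 1 / u\<^sup>2 \<le> 1" if "u \<in> {1..t}" for u :: real
    using that by (simp add: divide_le_eq_1 power_le_one_iff)
  from has_integral_psi_piece[of 1 t 0] this assms show ?thesis by simp
qed

text \<open>The constant \<open>c\<close> is the integral over the whole half-line. The part below
  \<open>s\<close> is at most \<open>s\<close> because \<open>psi\<close> is at most 1, and the part
  beyond \<open>t\<close> is at most \<open>1 / t\<close> because \<open>psi v <= v\<close>.\<close>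

lemma psi_integral_approx:
  assumes sums: "(\<lambda>k. trapezoid_defect (Suc k)) sums S" and c: "c = 2 / 3 - 4 * S"
    and s: "0 < s" "s \<le> t"
  shows "psi_integral s t \<le> c" "c \<le> psi_integral s t + s + 1 / t"
proof -
  have lim: "(\<lambda>n. psi_integral (1 / sqrt (real n + 1)) (real n + 1)) \<longlonglongrightarrow> c"
  proof -
    have "(\<lambda>n. \<Sum>k<n. - 4 * trapezoid_defect (Suc k)) \<longlonglongrightarrow> - 4 * S"
      using sums_mult[OF sums, of "- 4"] by (simp add: sums_def)
    moreover have "(\<lambda>n. 1 / (3 * (real n + 1) ^ 3) - 1 / (real n + 1)) \<longlonglongrightarrow> 0"
      by real_asymp
    ultimately have "(\<lambda>n. (\<Sum>k<n. - 4 * trapezoid_defect (Suc k)) +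
        (2 / 3 + (1 / (3 * (real n + 1) ^ 3) - 1 / (real n + 1)))) \<longlonglongrightarrow> - 4 * S + (2 / 3 + 0)"
      by (intro tendsto_intros)
    moreover have "psi_integral (1 / sqrt (real n + 1)) (real n + 1) = (\<Sum>k<n. - 4 * trapezoid_defect (Suc k)) +
        (2 / 3 + (1 / (3 * (real n + 1) ^ 3) - 1 / (real n + 1)))" for n
    proof -
      have "psi_integral (1 / sqrt (real n + 1)) (real n + 1) =
          psi_integral (1 / sqrt (real n + 1)) 1 + psi_integral 1 (real n + 1)"
        by (rule psi_integral_combine[symmetric]) auto
      then show ?thesis by (simp add: psi_integral_telescope psi_integral_from_1)
    qed
    ultimately show ?thesis using c by simp
  qed
  have ev: "eventually (\<lambda>n. 1 / sqrt (real n + 1) < s \<and> t < real n + 1) sequentially"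
  proof (intro eventually_conj)
    show "eventually (\<lambda>n. 1 / sqrt (real n + 1) < s) sequentially"
      by (rule order_tendstoD(2)[of _ 0]) (use s in real_asymp, fact)
    show "eventually (\<lambda>n. t < real n + 1) sequentially" by real_asymp
  qed
  have *: "psi_integral (1 / sqrt (real n + 1)) (real n + 1) =
      psi_integral (1 / sqrt (real n + 1)) s + psi_integral s t + psi_integral t (real n + 1)"
    if "1 / sqrt (real n + 1) < s \<and> t < real n + 1" for n
    using that s by (simp add: psi_integral_combine)
  have pos: "1 / sqrt (real n + 1) > 0" for n by simp
  show "psi_integral s t \<le> c"
    by (rule tendsto_lowerbound[OF lim eventually_mono[OF ev]])
      (use * psi_integral_nonneg[OF pos] psi_integral_nonneg[of t] s in \<open>auto simp: add_increasing add_increasing2\<close>)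
  show "c \<le> psi_integral s t + s + 1 / t"
  proof (rule tendsto_upperbound[OF lim eventually_mono[OF ev]])
    fix n assume n: "1 / sqrt (real n + 1) < s \<and> t < real n + 1"
    have "psi_integral (1 / sqrt (real n + 1)) s \<le> s - 1 / sqrt (real n + 1)"
      using n by (intro psi_integral_le_length) auto
    moreover have "psi_integral t (real n + 1) \<le> 1 / t - 1 / (real n + 1)"
      using n s by (intro psi_integral_le_inverse) auto
    moreover have "1 / (real n + 1) > 0" by simp
    ultimately show "psi_integral (1 / sqrt (real n + 1)) (real n + 1) \<le> psi_integral s t + s + 1 / t"
      using *[OF n] pos[of n] by linarith
  qed simp
qed

section \<open>The sum over square dilations compared with its integral\<close>

definition psi_square_sum :: "real \<Rightarrow> real" where
  "psi_square_sum y = (\<Sum>b. psi (y / (real (Suc b))\<^sup>2))"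

lemma summable_inverse_squares: "summable (\<lambda>b. 1 / (real (Suc b))\<^sup>2)"
  using inverse_squares_sums by (auto simp: sums_iff)

lemma sums_psi_square_sum:
  assumes "y \<ge> 0"
  shows "(\<lambda>b. psi (y / (real (Suc b))\<^sup>2)) sums psi_square_sum y"
  unfolding psi_square_sum_def
proof (rule summable_sums, rule summable_comparison_test')
  show "summable (\<lambda>b. y * (1 / (real (Suc b))\<^sup>2))"
    by (intro summable_mult summable_inverse_squares)
  show "norm (psi (y / (real (Suc b))\<^sup>2)) \<le> y * (1 / (real (Suc b))\<^sup>2)" for b
    using psi_le_self[of "y / (real (Suc b))\<^sup>2"] psi_nonneg assms by simp
qed

text \<open>On \<open>{N..N + 1}\<close> the Lipschitz bound keeps the integrand within
  \<open>y / N^2 - y / (N + 1)^2\<close> of its value at \<open>N\<close>, and these errors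
  telescope.\<close>

lemma psi_sum_vs_integral:
  assumes y: "y > 0" and B: "1 \<le> B" "B \<le> N"
  shows "\<bar>(\<Sum>b\<in>{B..<N}. psi (y / (real b)\<^sup>2)) - sqrt y * psi_integral (B / sqrt y) (N / sqrt y)\<bar>
    \<le> y / (real B)\<^sup>2 - y / (real N)\<^sup>2"
  using B(2)
proof (induction N rule: dec_induct)
  case base
  show ?case by (simp add: psi_integral_def)
next
  case (step N)
  have N: "real N > 0" using step B by linarith
  let ?I = "integral {real N..real N + 1} (\<lambda>u. psi (y / u\<^sup>2))"
  let ?p = "psi (y / (real N)\<^sup>2)" and ?e = "y / (real N)\<^sup>2 - y / (real N + 1)\<^sup>2"
  have near: "\<bar>psi (y / u\<^sup>2) - ?p\<bar> \<le> ?e" if u: "u \<in> {real N..real N + 1}" for u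
  proof -
    have "(real N)\<^sup>2 \<le> u\<^sup>2" "u\<^sup>2 \<le> (real N + 1)\<^sup>2" "u > 0" using u N by (auto intro!: power_mono)
    then have "y / u\<^sup>2 \<le> y / (real N)\<^sup>2" "y / (real N + 1)\<^sup>2 \<le> y / u\<^sup>2"
      using N y by (auto intro!: divide_left_mono)
    then show ?thesis using psi_lipschitz[of "y / u\<^sup>2" "y / (real N)\<^sup>2"] by linarith
  qed
  have near': "psi (y / u\<^sup>2) \<le> ?p + ?e" "?p - ?e \<le> psi (y / u\<^sup>2)"
    if "u \<in> {real N..real N + 1}" for u
    using near[OF that] by linarith+
  have int: "(\<lambda>u. psi (y / u\<^sup>2)) integrable_on {real N..real N + 1}"
    using N by (rule psi_integrable)
  have "?I \<le> integral {real N..real N + 1} (\<lambda>u. ?p + ?e)"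
    by (rule integral_le[OF int]) (use near'(1) in auto)
  moreover have "integral {real N..real N + 1} (\<lambda>u. ?p - ?e) \<le> ?I"
    by (rule integral_le[OF _ int]) (use near'(2) in auto)
  ultimately have "\<bar>?I - ?p\<bar> \<le> ?e" by (simp add: abs_le_iff)
  moreover have "?I = sqrt y * psi_integral (N / sqrt y) ((real N + 1) / sqrt y)"
    by (rule psi_integral_scale) (use y N in auto)
  moreover have "psi_integral (B / sqrt y) ((real N + 1) / sqrt y) =
      psi_integral (B / sqrt y) (N / sqrt y) + psi_integral (N / sqrt y) ((real N + 1) / sqrt y)"
    by (rule psi_integral_combine[symmetric])
      (use y B step in \<open>auto intro!: divide_right_mono divide_pos_pos\<close>)
  moreover have "(\<Sum>b\<in>{B..<Suc N}. psi (y / (real b)\<^sup>2)) = (\<Sum>b\<in>{B..<N}. psi (y / (real b)\<^sup>2)) + ?p"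
    using step by simp
  ultimately show ?case using step.IH by (simp add: algebra_simps)
qed

text \<open>Terms with \<open>b < B\<close> are bounded by 1 each, and the part of the integral
  below \<open>B\<close> costs at most \<open>B\<close>. From \<open>B\<close> on, sum and integral
  differ by the telescoped Lipschitz error \<open>y / B^2\<close>. The remaining
  \<open>y / (N + 1)\<close> comes from the end of the integral and vanishes in the limit.\<close>

lemma psi_square_sum_approx_param:
  assumes sums: "(\<lambda>k. trapezoid_defect (Suc k)) sums S" and c: "c = 2 / 3 - 4 * S"
    and y: "y > 0" and B: "1 \<le> B"
  shows "\<bar>psi_square_sum y - c * sqrt y\<bar> \<le> 2 * real B + y / (real B)\<^sup>2"
proof (rule LIMSEQ_le)
  let ?s = "\<lambda>N. \<Sum>b<N. psi (y / (real (Suc b))\<^sup>2)"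
  show "(\<lambda>N. \<bar>?s N - c * sqrt y\<bar>) \<longlonglongrightarrow> \<bar>psi_square_sum y - c * sqrt y\<bar>"
    using sums_psi_square_sum[of y] y by (intro tendsto_intros) (simp add: sums_def)
  have "(\<lambda>N. 2 * real B + y / (real B)\<^sup>2 + y / (real N + 1)) \<longlonglongrightarrow> 2 * real B + y / (real B)\<^sup>2 + 0"
    by (intro tendsto_add tendsto_const) real_asymp
  then show "(\<lambda>N. 2 * real B + y / (real B)\<^sup>2 + y / (real N + 1)) \<longlonglongrightarrow> 2 * real B + y / (real B)\<^sup>2" by simp
  show "\<exists>N0. \<forall>N\<ge>N0. \<bar>?s N - c * sqrt y\<bar> \<le> 2 * real B + y / (real B)\<^sup>2 + y / (real N + 1)"
  proof (intro exI[of _ B] allI impI)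
    fix N assume N: "N \<ge> B"
    let ?f = "\<lambda>b. psi (y / (real b)\<^sup>2)"
    let ?J = "psi_integral (B / sqrt y) (Suc N / sqrt y)"
    have "?s N = (\<Sum>b\<in>{1..<Suc N}. ?f b)"
      using sum.shift_bounds_Suc_ivl[of ?f 0 N] by (simp add: lessThan_atLeast0)
    also have "\<dots> = (\<Sum>b\<in>{1..<B}. ?f b) + (\<Sum>b\<in>{B..<Suc N}. ?f b)"
      using B N by (intro sum.atLeastLessThan_concat[symmetric]) auto
    finally have 1: "?s N = (\<Sum>b\<in>{1..<B}. ?f b) + (\<Sum>b\<in>{B..<Suc N}. ?f b)" .
    have 2: "(\<Sum>b\<in>{1..<B}. ?f b) \<ge> 0" by (intro sum_nonneg psi_nonneg)
    have "(\<Sum>b\<in>{1..<B}. ?f b) \<le> (\<Sum>b\<in>{1..<B}. 1)" by (intro sum_mono psi_le_1)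
    then have 3: "(\<Sum>b\<in>{1..<B}. ?f b) \<le> real B" by simp
    have 4: "\<bar>(\<Sum>b\<in>{B..<Suc N}. ?f b) - sqrt y * ?J\<bar> \<le> y / (real B)\<^sup>2 - y / (real (Suc N))\<^sup>2"
      using psi_sum_vs_integral[OF y B, of "Suc N"] N by simp
    have sB: "0 < B / sqrt y" "B / sqrt y \<le> Suc N / sqrt y"
      using y B N by (auto intro!: divide_right_mono divide_pos_pos)
    have "sqrt y * ?J \<le> sqrt y * c"
      using psi_integral_approx(1)[OF sums c sB] y by (intro mult_left_mono) auto
    moreover have "sqrt y * c \<le> sqrt y * (?J + B / sqrt y + 1 / (Suc N / sqrt y))"
      using psi_integral_approx(2)[OF sums c sB] y by (intro mult_left_mono) auto
    moreover have "sqrt y * (?J + B / sqrt y + 1 / (Suc N / sqrt y)) = sqrt y * ?J + real B + y / (real N + 1)"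
      using y by (simp add: distrib_left add.commute)
    moreover have "y / (real (Suc N))\<^sup>2 \<ge> 0" using y by simp
    moreover have "y / (real N + 1) \<ge> 0" using y by simp
    ultimately show "\<bar>?s N - c * sqrt y\<bar> \<le> 2 * real B + y / (real B)\<^sup>2 + y / (real N + 1)"
      using 1 2 3 4 by (simp only: mult.commute[of c])
  qed
qed

lemma psi_square_sum_approx:
  assumes sums: "(\<lambda>k. trapezoid_defect (Suc k)) sums S" and c: "c = 2 / 3 - 4 * S"
  obtains C where "C \<ge> 0"
    "\<And>y. y > 0 \<Longrightarrow> \<bar>psi_square_sum y - c * sqrt y\<bar> \<le> C * y powr (4 / 9)"
proof
  define Z where "Z = (\<Sum>b. 1 / (real (Suc b))\<^sup>2)"
  have Z: "Z \<ge> 0" unfolding Z_def by (rule suminf_nonneg[OF summable_inverse_squares]) simp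
  show "Z + \<bar>c\<bar> + 5 \<ge> 0" using Z by simp
  fix y :: real assume y: "y > 0"
  show "\<bar>psi_square_sum y - c * sqrt y\<bar> \<le> (Z + \<bar>c\<bar> + 5) * y powr (4 / 9)"
  proof (cases "y \<ge> 1")
    case True
    \<comment> \<open>A value of about \<open>y^(1/3)\<close> balances \<open>2 * B\<close> against
      \<open>y / B^2\<close> and yields the error \<open>O(y^(1/3))\<close>; the exponent
      \<open>4 / 9\<close> of the final result is all that is kept.\<close>
    define B where "B = nat \<lceil>y powr (1 / 3)\<rceil>"
    have y1: "y powr (1 / 3) \<ge> 1" using True by (simp add: ge_one_powr_ge_zero)
    have B: "real B \<ge> y powr (1 / 3)" "real B \<le> y powr (1 / 3) + 1"
      unfolding B_def using y1 by simp_all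
    then have B1: "B \<ge> 1" using y1 by linarith
    have "y powr (2 / 3) = (y powr (1 / 3))\<^sup>2" using y by (simp add: powr_power)
    also have "\<dots> \<le> (real B)\<^sup>2" using B y1 by (intro power_mono) auto
    finally have "y / (real B)\<^sup>2 \<le> y / y powr (2 / 3)" using y B1 by (intro divide_left_mono) auto
    also have "\<dots> = y powr 1 / y powr (2 / 3)" using y by simp
    also have "\<dots> = y powr (1 / 3)" by (subst powr_diff[symmetric]) simp
    finally have "2 * real B + y / (real B)\<^sup>2 \<le> 5 * y powr (1 / 3)" using B y1 by linarith
    also have "\<dots> \<le> (Z + \<bar>c\<bar> + 5) * y powr (4 / 9)"
      using True Z by (intro mult_mono powr_mono) auto
    finally show ?thesis using psi_square_sum_approx_param[OF sums c y B1] by linarith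
  next
    case False
    \<comment> \<open>Small \<open>y\<close> cannot be ignored, since the Euler products evaluate
      functions at arbitrarily small dilates. Here sum and main term are both negligible: they are
      at most multiples of \<open>y\<close> and \<open>sqrt y\<close>.\<close>
    have "psi_square_sum y \<le> y * Z" unfolding Z_def psi_square_sum_def
    proof (subst suminf_mult[symmetric, OF summable_inverse_squares], rule suminf_le)
      show "psi (y / (real (Suc b))\<^sup>2) \<le> y * (1 / (real (Suc b))\<^sup>2)" for b
        using psi_le_self[of "y / (real (Suc b))\<^sup>2"] y by simp
      show "summable (\<lambda>b. psi (y / (real (Suc b))\<^sup>2))"
        using sums_psi_square_sum[of y] y by (auto simp: sums_iff)
      show "summable (\<lambda>b. y * (1 / (real (Suc b))\<^sup>2))"
        by (rule summable_mult[OF summable_inverse_squares])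
    qed
    moreover have "psi_square_sum y \<ge> 0" unfolding psi_square_sum_def
      using sums_psi_square_sum[of y] y by (intro suminf_nonneg psi_nonneg) (auto simp: sums_iff)
    ultimately have "\<bar>psi_square_sum y - c * sqrt y\<bar> \<le> Z * y + \<bar>c\<bar> * sqrt y"
      using y abs_mult[of c "sqrt y"] by (simp add: abs_le_iff mult.commute) linarith
    also have "\<dots> \<le> Z * y powr (4 / 9) + \<bar>c\<bar> * y powr (4 / 9)"
    proof (intro add_mono mult_left_mono)
      show "y \<le> y powr (4 / 9)" using powr_mono'[of "4/9" 1 y] y False by simp
      show "sqrt y \<le> y powr (4 / 9)"
        using powr_mono'[of "4/9" "1/2" y] y False by (simp add: powr_half_sqrt)
    qed (use Z in auto)
    also have "\<dots> \<le> (Z + \<bar>c\<bar> + 5) * y powr (4 / 9)" by (simp add: algebra_simps)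
    finally show ?thesis .
  qed
qed

section \<open>The value \<open>\<zeta>(-1/2)\<close>\<close>

text \<open>Weierstrass' test on closed discs. A disc around \<open>x\<close> whose radius is half
  the distance to the boundary line keeps the exponent strictly above 1, and the continuous factor
  \<open>M\<close> is bounded on it.\<close>

lemma holomorphic_on_dirichlet_bounded_series:
  fixes f :: "nat \<Rightarrow> complex \<Rightarrow> complex"
  assumes hol: "\<And>n. f n holomorphic_on {s. Re s > a}"
    and M: "continuous_on UNIV M"
    and bound: "\<And>n s. Re s > a \<Longrightarrow> norm (f n s) \<le> M s * real (Suc n) powr (- (Re s + b))"
    and ab: "a + b \<ge> 1"
  shows "(\<lambda>s. \<Sum>n. f n s) holomorphic_on {s. Re s > a}"
    and "\<And>s. Re s > a \<Longrightarrow> summable (\<lambda>n. f n s)"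
proof -
  have smr: "summable (\<lambda>n. real (Suc n) powr (- t))" if "t > 1" for t
    using that by (subst summable_Suc_iff) (simp add: summable_real_powr_iff)
  show "summable (\<lambda>n. f n s)" if s: "Re s > a" for s
  proof (rule summable_comparison_test')
    show "summable (\<lambda>n. M s * real (Suc n) powr (- (Re s + b)))"
      using s ab by (intro summable_mult smr) auto
  qed (rule bound[OF s])
  show "(\<lambda>s. \<Sum>n. f n s) holomorphic_on {s. Re s > a}"
  proof (rule holomorphic_uniform_sequence[where f = "\<lambda>n s. \<Sum>i<n. f i s"])
    show "open {s. Re s > a}" by (rule open_halfspace_Re_gt)
    show "(\<lambda>s. \<Sum>i<n. f i s) holomorphic_on {s. Re s > a}" for n
      by (intro holomorphic_on_sum hol)
    fix x assume x: "x \<in> {s. Re s > a}"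
    define d where "d = (Re x - a) / 2"
    have d: "d > 0" using x by (simp add: d_def)
    have Re: "Re s \<ge> a + d" if "s \<in> cball x d" for s
    proof -
      have "Re x - Re s \<le> d" using that abs_Re_le_cmod[of "x - s"] by (simp add: dist_norm)
      moreover have "a + d = Re x - d" by (simp add: d_def field_simps)
      ultimately show ?thesis by linarith
    qed
    have "bounded (M ` cball x d)"
      by (intro compact_imp_bounded compact_continuous_image continuous_on_subset[OF M]) auto
    then obtain B where B: "B > 0" "\<And>s. s \<in> cball x d \<Longrightarrow> norm (M s) \<le> B"
      by (auto simp: bounded_pos)
    have "uniform_limit (cball x d) (\<lambda>n s. \<Sum>i<n. f i s) (\<lambda>s. \<Sum>n. f n s) sequentially"
    proof (rule Weierstrass_m_test)
      show "summable (\<lambda>n. B * real (Suc n) powr (- (a + d + b)))"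
        using d ab by (intro summable_mult smr) auto
      fix n s assume s: "s \<in> cball x d"
      have "norm (f n s) \<le> M s * real (Suc n) powr (- (Re s + b))"
        using Re[OF s] d by (intro bound) auto
      also have "\<dots> \<le> B * real (Suc n) powr (- (a + d + b))"
        using B(2)[OF s] B(1) Re[OF s] by (intro mult_mono powr_mono) auto
      finally show "norm (f n s) \<le> B * real (Suc n) powr (- (a + d + b))" .
    qed
    moreover have "cball x d \<subseteq> {s. Re s > a}" using Re d by force
    ultimately show "\<exists>d>0. cball x d \<subseteq> {s. Re s > a} \<and>
        uniform_limit (cball x d) (\<lambda>n s. \<Sum>i<n. f i s) (\<lambda>s. \<Sum>n. f n s) sequentially"
      using d by blast
  qed
qed

text \<open>The coefficient of \<open>u powr (1 - s - k)\<close> in the \<open>k\<close>-th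
  derivative of \<open>u powr (1 - s)\<close>.\<close>

definition falling :: "complex \<Rightarrow> nat \<Rightarrow> complex" where
  "falling s k = (\<Prod>j<k. 1 - s - of_nat j)"

lemma falling_simps [simp]:
  "falling s 0 = 1" "falling s (Suc k) = falling s k * (1 - s - of_nat k)"
  by (simp_all add: falling_def)

lemma holomorphic_falling [holomorphic_intros]: "(\<lambda>s. falling s k) holomorphic_on A"
  unfolding falling_def by (intro holomorphic_intros)

lemma continuous_falling: "continuous_on A (\<lambda>s. falling s k)"
  by (rule holomorphic_on_imp_continuous_on[OF holomorphic_falling])

text \<open>The remainder of order \<open>K\<close> in the Taylor expansion of
  \<open>u powr (1 - s)\<close> from \<open>u = n\<close> to \<open>u = n + 1\<close>, where the
  step length is 1.\<close>

definition taylor_remainder :: "nat \<Rightarrow> nat \<Rightarrow> complex \<Rightarrow> complex" where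
  "taylor_remainder K n s = of_nat (n + 1) powr (1 - s) -
     (\<Sum>k\<le>K. falling s k * of_nat n powr (1 - s - of_nat k) / fact k)"

lemma holomorphic_taylor_remainder [holomorphic_intros]:
  "n \<ge> 1 \<Longrightarrow> taylor_remainder K n holomorphic_on A"
  unfolding taylor_remainder_def by (intro holomorphic_intros) auto

text \<open>On the segment from \<open>n\<close> to \<open>n + 1\<close> the next derivative is
  largest at \<open>n\<close>, because its exponent has real part \<open>- (Re s + K) <= 0\<close>.
  The decay in \<open>n\<close> makes the series of remainders converge for
  \<open>Re s > 1 - K\<close>, one unit further left for each additional Taylor term.\<close>

lemma taylor_remainder_bound:
  assumes n: "n \<ge> 1" and s: "Re s + K \<ge> 0"
  shows "norm (taylor_remainder K n s) \<le> norm (falling s (Suc K)) / fact K * real n powr (- (Re s + K))"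
proof -
  let ?f = "\<lambda>i u. falling s i * u powr (1 - s - of_nat i)"
  let ?S = "closed_segment (of_nat n) (of_nat (n + 1) :: complex)"
  have real_pt: "\<exists>v. u = of_real v \<and> real n \<le> v" if "u \<in> ?S" for u
  proof -
    have "of_nat n = (of_real (real n) :: complex)" "of_nat (n + 1) = (of_real (real (n + 1)) :: complex)"
      by simp_all
    then have "u \<in> of_real ` closed_segment (real n) (real (n + 1))"
      using that closed_segment_of_real by metis
    then show ?thesis by (auto simp: closed_segment_eq_real_ivl)
  qed
  have "norm (?f 0 (of_nat (n + 1)) - (\<Sum>i\<le>K. ?f i (of_nat n) * (of_nat (n + 1) - of_nat n) ^ i / fact i))
     \<le> (norm (falling s (Suc K)) * real n powr (- (Re s + K))) * norm (of_nat (n + 1) - of_nat n :: complex) ^ Suc K / fact K"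
  proof (rule complex_Taylor)
    show "convex ?S" by simp
    fix u assume u: "u \<in> ?S"
    then obtain v where v: "u = of_real v" "real n \<le> v" using real_pt by blast
    have v0: "v > 0" using v n by linarith
    show "(?f i has_field_derivative ?f (Suc i) u) (at u within ?S)" for i
      using v0 v by (auto intro!: derivative_eq_intros has_field_derivative_at_within[OF has_field_derivative_powr]
          simp: algebra_simps complex_nonpos_Reals_iff)
    have "norm (?f (Suc K) u) = norm (falling s (Suc K)) * v powr (- (Re s + K))"
      using v v0 by (simp add: norm_mult norm_powr_real_powr del: falling_simps)
    also have "\<dots> \<le> norm (falling s (Suc K)) * real n powr (- (Re s + K))"
      using v s n by (intro mult_left_mono powr_mono2') auto
    finally show "norm (?f (Suc K) u) \<le> norm (falling s (Suc K)) * real n powr (- (Re s + K))" .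
  qed auto
  then show ?thesis by (simp add: taylor_remainder_def del: falling_simps(2))
qed

lemma taylor_remainder_series:
  shows "\<And>s. Re s > 1 - real K \<Longrightarrow> summable (\<lambda>n. taylor_remainder K (Suc n) s)"
    and "(\<lambda>s. \<Sum>n. taylor_remainder K (Suc n) s) holomorphic_on {s. Re s > 1 - real K}"
proof -
  have M: "continuous_on UNIV (\<lambda>s. norm (falling s (Suc K)) / fact K)"
    by (intro continuous_intros continuous_falling) auto
  have bd: "norm (taylor_remainder K (Suc n) s) \<le> norm (falling s (Suc K)) / fact K * real (Suc n) powr (- (Re s + K))"
    if "Re s > 1 - real K" for n s
    using that by (intro taylor_remainder_bound) auto
  show "summable (\<lambda>n. taylor_remainder K (Suc n) s)" if "Re s > 1 - real K" for s
    using holomorphic_on_dirichlet_bounded_series(2)[OF holomorphic_taylor_remainder M bd _ that] by simp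
  show "(\<lambda>s. \<Sum>n. taylor_remainder K (Suc n) s) holomorphic_on {s. Re s > 1 - real K}"
    by (rule holomorphic_on_dirichlet_bounded_series(1)[OF holomorphic_taylor_remainder M bd]) auto
qed

lemma norm_of_nat_powr: "norm ((of_nat (Suc n) :: complex) powr z) = real (Suc n) powr Re z"
  using norm_powr_real_powr[of "of_nat (Suc n)" z] by simp

section \<open>Continuation of \<open>(s - 1) * zeta s\<close> to the plane\<close>

definition zeta_series :: "complex \<Rightarrow> complex" where
  "zeta_series s = (\<Sum>n. of_nat (Suc n) powr (- s))"

lemma zeta_series_sums:
  assumes "Re s > 1"
  shows "(\<lambda>n. of_nat (Suc n) powr (- s)) sums zeta_series s"
    and "zeta_series holomorphic_on {s. Re s > 1}"
proof -
  have eq: "zeta_series = (\<lambda>s. \<Sum>n. of_nat (Suc n) powr (- s))" by (simp add: zeta_series_def fun_eq_iff)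
  have hol: "(\<lambda>s. of_nat (Suc n) powr (- s)) holomorphic_on {s. Re s > 1}" for n
    by (intro holomorphic_intros)
  have bd: "norm ((of_nat (Suc n) :: complex) powr (- s)) \<le> 1 * real (Suc n) powr (- (Re s + 0))" for n s
    by (simp only: norm_of_nat_powr) simp
  show "zeta_series holomorphic_on {s. Re s > 1}" unfolding eq
    by (rule holomorphic_on_dirichlet_bounded_series(1)[OF hol _ bd]) auto
  show "(\<lambda>n. of_nat (Suc n) powr (- s)) sums zeta_series s" unfolding zeta_series_def
    using holomorphic_on_dirichlet_bounded_series(2)[OF hol _ bd _ assms] by (simp add: summable_sums)
qed

lemma telescope_sums:
  assumes "Re s > 1"
  shows "(\<lambda>n. of_nat (Suc n + 1) powr (1 - s) - of_nat (Suc n) powr (1 - s)) sums (- 1 :: complex)"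
proof -
  have "(\<lambda>n. of_nat (Suc n) powr (1 - s) :: complex) \<longlonglongrightarrow> 0"
  proof (rule tendsto_norm_zero_cancel)
    have "(\<lambda>n. real (Suc n) powr (1 - Re s)) \<longlonglongrightarrow> 0"
      using assms by real_asymp
    then show "(\<lambda>n. norm (of_nat (Suc n) powr (1 - s) :: complex)) \<longlonglongrightarrow> 0"
      by (simp only: norm_of_nat_powr) simp
  qed
  from telescope_sums[OF this] show ?thesis by simp
qed

text \<open>Summing the Taylor expansion of \<open>(n + 1) powr (1 - s)\<close> over
  \<open>n\<close>, the differences telescope to \<open>- 1\<close>, the \<open>k\<close>-th Taylor
  term produces the zeta series at \<open>s + k - 1\<close>, and the term \<open>k = 1\<close> is
  solved for. Splitting one factor off \<open>falling s k\<close> lets every other zeta value occur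
  as \<open>(w - 1) * zeta_series w\<close> with \<open>w = s + k - 1\<close>, the combination that
  continues without a pole.\<close>

lemma zeta_series_recursion:
  assumes s: "Re s > 1" and K: "K \<ge> 1"
  shows "(s - 1) * zeta_series s = 1 - (\<Sum>k\<in>{2..K}. falling s (k - 1) / fact k * ((s + of_nat k - 2) * zeta_series (s + of_nat k - 1)))
     + (\<Sum>n. taylor_remainder K (Suc n) s)"
proof -
  have z: "(\<lambda>n. falling s k * of_nat (Suc n) powr (1 - s - of_nat k) / fact k) sums
      (falling s k / fact k * zeta_series (s + of_nat k - 1))" if "k \<ge> 1" for k
  proof -
    have "real k \<ge> 1" using that by simp
    then have "Re (s + of_nat k - 1) > 1" using s by simp
    from sums_mult[OF zeta_series_sums(1)[OF this], of "falling s k / fact k"] show ?thesis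
      by (simp add: algebra_simps)
  qed
  have "(\<lambda>n. taylor_remainder K (Suc n) s + (\<Sum>k\<in>{1..K}. falling s k * of_nat (Suc n) powr (1 - s - of_nat k) / fact k))
    sums ((\<Sum>n. taylor_remainder K (Suc n) s) + (\<Sum>k\<in>{1..K}. falling s k / fact k * zeta_series (s + of_nat k - 1)))"
    using s K by (intro sums_add sums_sum z summable_sums taylor_remainder_series(1)) auto
  moreover have "taylor_remainder K (Suc n) s + (\<Sum>k\<in>{1..K}. falling s k * of_nat (Suc n) powr (1 - s - of_nat k) / fact k)
      = of_nat (Suc n + 1) powr (1 - s) - of_nat (Suc n) powr (1 - s)" for n
  proof -
    have "{..K} = insert 0 {1..K}" by auto
    then show ?thesis by (simp add: taylor_remainder_def)
  qed
  ultimately have 1: "(\<Sum>n. taylor_remainder K (Suc n) s) + (\<Sum>k\<in>{1..K}. falling s k / fact k * zeta_series (s + of_nat k - 1)) = - 1"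
    using telescope_sums[OF s] sums_unique2 by (simp only:) blast
  have "{1..K} = insert 1 {2..K}" using K by auto
  then have 2: "(\<Sum>k\<in>{1..K}. falling s k / fact k * zeta_series (s + of_nat k - 1)) =
      (1 - s) * zeta_series s + (\<Sum>k\<in>{2..K}. falling s k / fact k * zeta_series (s + of_nat k - 1))"
    by (simp add: falling_def)
  have 3: "(\<Sum>k\<in>{2..K}. falling s k / fact k * zeta_series (s + of_nat k - 1)) =
     - (\<Sum>k\<in>{2..K}. falling s (k - 1) / fact k * ((s + of_nat k - 2) * zeta_series (s + of_nat k - 1)))"
    unfolding sum_negf[symmetric]
  proof (rule sum.cong[OF refl])
    fix k assume "k \<in> {2..K}"
    then obtain j where j: "k = Suc j" by (cases k) auto
    have "falling s k = - (falling s (k - 1) * (s + of_nat k - 2))"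
      unfolding j by (simp add: algebra_simps)
    then show "falling s k / fact k * zeta_series (s + of_nat k - 1) =
        - (falling s (k - 1) / fact k * ((s + of_nat k - 2) * zeta_series (s + of_nat k - 1)))"
      by simp
  qed
  have "T + A = - 1 \<Longrightarrow> A = (1 - s) * Z + B \<Longrightarrow> B = - C \<Longrightarrow> (s - 1) * Z = 1 - C + T"
    for T A B C Z :: complex
    by algebra
  from this[OF 1 2 3] show ?thesis .
qed

text \<open>All terms on the right of the recursion with \<open>k >= 2\<close> are taken at
  arguments moved right by at least 1, so a continuation to one half-plane provides a continuation
  one unit further left.\<close>

lemma zeta_halfplane_continuation:
  "\<exists>E. E holomorphic_on {s. Re s > 1 - real m} \<and> (\<forall>s. Re s > 1 \<longrightarrow> E s = (s - 1) * zeta_series s)"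
proof (induction m)
  case 0
  show ?case using zeta_series_sums(2)[of 2]
    by (intro exI[of _ "\<lambda>s. (s - 1) * zeta_series s"]) (auto intro!: holomorphic_intros)
next
  case (Suc m)
  then obtain E where E: "E holomorphic_on {s. Re s > 1 - real m}"
    "\<And>s. Re s > 1 \<Longrightarrow> E s = (s - 1) * zeta_series s" by blast
  let ?K = "Suc m"
  let ?E = "\<lambda>s. 1 - (\<Sum>k\<in>{2..?K}. falling s (k - 1) / fact k * E (s + of_nat k - 1))
     + (\<Sum>n. taylor_remainder ?K (Suc n) s)"
  show ?case
  proof (intro exI[of _ ?E] conjI allI impI)
    have "(\<lambda>s. E (s + of_nat k - 1)) holomorphic_on {s. Re s > 1 - real (Suc m)}" if "k \<ge> 2" for k
    proof -
      have "real k \<ge> 2" using that by simp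
      then have "(\<lambda>s. s + of_nat k - 1) ` {s. Re s > 1 - real (Suc m)} \<subseteq> {s. Re s > 1 - real m}"
        by auto
      moreover have "(\<lambda>s. s + of_nat k - 1) holomorphic_on {s. Re s > 1 - real (Suc m)}"
        by (intro holomorphic_intros)
      ultimately show ?thesis
        using holomorphic_on_compose_gen[OF _ E(1), of "\<lambda>s. s + of_nat k - 1"] by (simp add: o_def)
    qed
    moreover have "(\<lambda>s. \<Sum>n. taylor_remainder ?K (Suc n) s) holomorphic_on {s. Re s > 1 - real (Suc m)}"
      by (rule taylor_remainder_series(2))
    ultimately show "?E holomorphic_on {s. Re s > 1 - real (Suc m)}"
      by (intro holomorphic_intros) auto
    fix s assume s: "Re s > 1"
    have "E (s + of_nat k - 1) = (s + of_nat k - 2) * zeta_series (s + of_nat k - 1)" if "k \<in> {2..?K}" for k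
    proof -
      have "real k \<ge> 2" using that by simp
      then show ?thesis using E(2)[of "s + of_nat k - 1"] s by simp
    qed
    then show "?E s = (s - 1) * zeta_series s"
      using zeta_series_recursion[OF s, of ?K] by simp
  qed
qed

lemma connected_halfplane: "connected {s. Re s > a}"
  by (intro convex_connected convex_halfspace_Re_gt)

lemma holomorphic_eq_on_halfplane:
  assumes "f holomorphic_on {s. Re s > a}" "g holomorphic_on {s. Re s > a}"
    and "\<And>s. Re s > b \<Longrightarrow> f s = g s" and "Re s > a" and "a \<le> b"
  shows "f s = g s"
proof (rule analytic_continuation_open[where f = f and g = g and s = "{s. Re s > b}" and s' = "{s. Re s > a}"])
  show "open {s. Re s > b}" "open {s. Re s > a}" by (rule open_halfspace_Re_gt)+
  show "{s. Re s > b} \<noteq> {}" by (auto intro!: exI[of _ "of_real (b + 1)"])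
  show "connected {s. Re s > a}" by (rule connected_halfplane)
qed (use assms in auto)

lemma zeta_entire:
  obtains E where "E holomorphic_on UNIV" "\<And>s. Re s > 1 \<Longrightarrow> E s = (s - 1) * zeta_series s"
proof -
  from zeta_halfplane_continuation obtain E where E: "\<And>m. E m holomorphic_on {s. Re s > 1 - real m}"
    "\<And>m s. Re s > 1 \<Longrightarrow> E m s = (s - 1) * zeta_series s" by metis
  \<comment> \<open>The index is large enough for the half-plane of \<open>E m\<close> to contain
    \<open>s\<close>. By the identity theorem any other admissible index gives the same value, so
    \<open>F\<close> is holomorphic on each half-plane.\<close>
  define F where "F s = E (nat \<lceil>2 - Re s\<rceil>) s" for s
  have F: "F s = E M s" if s: "Re s > 1 - real M" for s M
  proof -
    define m where "m = nat \<lceil>2 - Re s\<rceil>"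
    have m: "Re s > 1 - real m" unfolding m_def by linarith
    define k where "k = min m M"
    have sub: "{s. Re s > 1 - real k} \<subseteq> {s. Re s > 1 - real m}" "{s. Re s > 1 - real k} \<subseteq> {s. Re s > 1 - real M}"
      unfolding k_def by auto
    have "E m s = E M s"
    proof (rule holomorphic_eq_on_halfplane[of "E m" "1 - real k" "E M" 1])
      show "E m holomorphic_on {s. Re s > 1 - real k}" "E M holomorphic_on {s. Re s > 1 - real k}"
        using E(1) sub holomorphic_on_subset by blast+
      show "Re s > 1 - real k" using s m by (auto simp: k_def min_def)
    qed (use E(2) in auto)
    then show ?thesis by (simp add: F_def m_def)
  qed
  have "F holomorphic_on {s. Re s > 1 - real M}" for M
    using E(1)[of M] F by (subst holomorphic_cong[OF refl]) auto
  then have "F holomorphic_on (\<Union>M. {s. Re s > 1 - real M})"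
    by (intro holomorphic_on_UN_open open_halfspace_Re_gt) auto
  moreover have "(\<Union>M. {s. Re s > 1 - real M}) = UNIV"
  proof -
    have "\<exists>M. Re s > 1 - real M" for s using reals_Archimedean2[of "1 - Re s"] by (auto simp: algebra_simps)
    then show ?thesis by auto
  qed
  ultimately show ?thesis using that[of F] F[of 0] E(2)[of _ 0] by auto
qed

lemma zeta_eq_entire:
  assumes E: "E holomorphic_on UNIV" "\<And>s. Re s > 1 \<Longrightarrow> E s = (s - 1) * zeta_series s" and s: "s \<noteq> 1"
  shows "zeta s = E s / (s - 1)"
proof (rule zeta_unique[OF _ _ s])
  show "(\<lambda>s. E s / (s - 1)) holomorphic_on - {1}"
    by (intro holomorphic_intros holomorphic_on_subset[OF E(1)]) auto
  show "(\<lambda>n. of_nat (Suc n) powr - s) sums (E s / (s - 1))" if "Re s > 1" for s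
  proof -
    have "s \<noteq> 1" using that by auto
    then show ?thesis using zeta_series_sums(1)[OF that] E(2)[OF that] by simp
  qed
qed

lemma Re_zeta_2: "Re (zeta 2) = (\<Sum>b. 1 / (real (Suc b))\<^sup>2)"
proof -
  obtain E where E: "E holomorphic_on UNIV" "\<And>s. Re s > 1 \<Longrightarrow> E s = (s - 1) * zeta_series s"
    using zeta_entire by blast
  have "zeta 2 = zeta_series 2" using zeta_eq_entire[OF E, of 2] E(2)[of 2] by simp
  moreover have "(\<lambda>n. of_nat (Suc n) powr (- 2) :: complex) sums zeta_series 2"
    by (rule zeta_series_sums(1)) simp
  ultimately have "(\<lambda>n. Re (of_nat (Suc n) powr (- 2))) sums Re (zeta 2)"
    using sums_Re by metis
  moreover have "Re (of_nat (Suc n) powr (- 2)) = 1 / (real (Suc n))\<^sup>2" for n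
  proof -
    have "(of_nat (Suc n) :: complex) powr (- 2) = of_real (real (Suc n)) powr of_real (- 2)" by simp
    also have "\<dots> = of_real (real (Suc n) powr (- 2))" by (rule powr_of_real) simp
    finally show ?thesis by (simp only: Re_complex_of_real) (simp add: powr_minus_divide powr_numeral)
  qed
  ultimately show ?thesis by (simp add: sums_unique)
qed

text \<open>In the trapezoid rule the Taylor terms through second order cancel, leaving only
  remainders of size \<open>n powr (- (Re s + 2))\<close>. Hence the series converges for
  \<open>Re s > - 1\<close>, and in particular at \<open>- 1 / 2\<close>.\<close>

lemma trapezoid_term_eq:
  assumes "n \<ge> 1"
  shows "(s - 1) / 2 * (of_nat n powr (- s) + of_nat (n + 1) powr (- s)) + of_nat (n + 1) powr (1 - s) - of_nat n powr (1 - s)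
    = (s - 1) / 2 * taylor_remainder 1 n (s + 1) + taylor_remainder 2 n s"
proof -
  have e: "1 - (s + 1) = - s" "1 - s - 1 = - s" "- s - 1 = 1 - s - 2" by simp_all
  have f: "falling s 2 = - ((1 - s) * s)" by (simp add: numeral_2_eq_2)
  have r1: "taylor_remainder 1 n (s + 1) = of_nat (n + 1) powr (- s) - (of_nat n powr (- s) - s * of_nat n powr (1 - s - 2))"
    by (simp add: taylor_remainder_def e)
  have r2: "taylor_remainder 2 n s = of_nat (n + 1) powr (1 - s) -
     (of_nat n powr (1 - s) + (1 - s) * of_nat n powr (- s) - (1 - s) * s * of_nat n powr (1 - s - 2) / 2)"
    by (simp add: taylor_remainder_def numeral_2_eq_2 atMost_Suc e) (simp add: f fact_numeral algebra_simps)?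
  show ?thesis unfolding r1 r2 by (simp add: field_simps)
qed

text \<open>The trapezoid terms sum to an expression for \<open>(s - 1) * zeta s\<close> when
  \<open>Re s > 1\<close>, and their series is holomorphic for \<open>Re s > - 1\<close>. At
  \<open>s = - 1 / 2\<close> each term is \<open>- 3 / 2\<close> times a defect of the trapezoid
  rule for the square root.\<close>

lemma zeta_minus_half:
  obtains S where "(\<lambda>k. trapezoid_defect (Suc k)) sums S" "Re (zeta (- 1 / 2)) = S - 1 / 6"
proof -
  obtain E where E: "E holomorphic_on UNIV" "\<And>s. Re s > 1 \<Longrightarrow> E s = (s - 1) * zeta_series s"
    using zeta_entire by blast
  let ?t = "\<lambda>n s. (s - 1) / 2 * (of_nat (Suc n) powr (- s) + of_nat (Suc n + 1) powr (- s)) +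
    of_nat (Suc n + 1) powr (1 - s) - of_nat (Suc n) powr (1 - s) :: complex"
  define r where "r n s = (s - 1) / 2 * taylor_remainder 1 (Suc n) (s + 1) + taylor_remainder 2 (Suc n) s" for n s
  have rt: "r n s = ?t n s" for n s unfolding r_def by (rule trapezoid_term_eq[symmetric]) simp
  have sm: "summable (\<lambda>n. taylor_remainder 1 (Suc n) (s + 1))" "summable (\<lambda>n. taylor_remainder 2 (Suc n) s)"
    if "Re s > - 1" for s
    using that by (intro taylor_remainder_series(1); simp)+
  have smr: "summable (\<lambda>n. r n s)" if "Re s > - 1" for s
    unfolding r_def using sm[OF that] by (intro summable_add summable_mult)
  \<comment> \<open>For \<open>Re s > 1\<close> the terms add up to
    \<open>(s - 1) / 2 * (2 * zeta s - 1) - 1\<close>; the two summands in front of the series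
    compensate the constants.\<close>
  define G where "G s = 1 + (s - 1) / 2 + (\<Sum>n. r n s)" for s
  have "E (- 1 / 2) = G (- 1 / 2)"
  proof (rule holomorphic_eq_on_halfplane[of E "- 1" G 1])
    show "E holomorphic_on {s. Re s > - 1}" using E(1) by (rule holomorphic_on_subset) auto
    have "(\<lambda>s. \<Sum>n. taylor_remainder 1 (Suc n) (s + 1)) holomorphic_on {s. Re s > - 1}"
    proof -
      have "(\<lambda>s. s + 1) ` {s. Re s > - 1} \<subseteq> {s. Re s > 1 - real 1}" by auto
      moreover have "(\<lambda>s. s + 1) holomorphic_on {s. Re s > - 1}" by (intro holomorphic_intros)
      ultimately show ?thesis
        using holomorphic_on_compose_gen[OF _ taylor_remainder_series(2)[of 1], of "\<lambda>s. s + 1" "{s. Re s > - 1}"]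
        by (simp add: o_def)
    qed
    moreover have "(\<lambda>s. \<Sum>n. taylor_remainder 2 (Suc n) s) holomorphic_on {s. Re s > - 1}"
      using taylor_remainder_series(2)[of 2] by simp
    ultimately have "(\<lambda>s. 1 + (s - 1) / 2 + ((s - 1) / 2 * (\<Sum>n. taylor_remainder 1 (Suc n) (s + 1)) +
        (\<Sum>n. taylor_remainder 2 (Suc n) s))) holomorphic_on {s. Re s > - 1}"
      by (intro holomorphic_intros) auto
    moreover have "G s = 1 + (s - 1) / 2 + ((s - 1) / 2 * (\<Sum>n. taylor_remainder 1 (Suc n) (s + 1)) +
        (\<Sum>n. taylor_remainder 2 (Suc n) s))" if "Re s > - 1" for s
      unfolding G_def r_def
      by (simp only: suminf_add[symmetric, OF summable_mult[OF sm(1)[OF that]] sm(2)[OF that]]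
          suminf_mult[OF sm(1)[OF that]])
    ultimately show "G holomorphic_on {s. Re s > - 1}"
      by (subst holomorphic_cong[OF refl]) auto
    fix s :: complex assume s: "Re s > 1"
    have z: "(\<lambda>n. of_nat (Suc n) powr (- s)) sums zeta_series s" by (rule zeta_series_sums(1)[OF s])
    then have "(\<lambda>n. of_nat (Suc (Suc n)) powr (- s)) sums (zeta_series s - 1)"
      by (subst sums_Suc_iff) simp
    then have "(\<lambda>n. of_nat (Suc n + 1) powr (- s)) sums (zeta_series s - 1)" by simp
    from sums_add[OF sums_mult[OF sums_add[OF z this], of "(s - 1) / 2"] telescope_sums[OF s]]
    have "(\<lambda>n. r n s) sums ((s - 1) / 2 * (zeta_series s + (zeta_series s - 1)) + - 1)"
      unfolding rt by (simp only: add_diff_eq)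
    then have su: "(\<Sum>n. r n s) = (s - 1) / 2 * (zeta_series s + (zeta_series s - 1)) + - 1"
      by (rule sums_unique[symmetric])
    show "E s = G s" unfolding G_def E(2)[OF s] su by (simp add: field_simps)
  qed auto
  moreover have "(- 1 / 2 :: complex) \<noteq> 1" by (simp add: complex_eq_iff)
  ultimately have z: "zeta (- 1 / 2) = (1 / 4 + (\<Sum>n. r n (- 1 / 2))) / (- 3 / 2)"
    using zeta_eq_entire[OF E, of "- 1 / 2"] by (simp add: G_def)
  have pw: "(of_nat m :: complex) powr (1 / 2) = of_real (sqrt m)"
    "(of_nat m :: complex) powr (3 / 2) = of_real (m * sqrt m)" if "m \<ge> 1" for m :: nat
  proof -
    have "(of_nat m :: complex) powr (1 / 2) = of_real (real m) powr of_real (1 / 2)" by simp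
    also have "\<dots> = of_real (real m powr (1 / 2))" by (rule powr_of_real) simp
    finally show 1: "(of_nat m :: complex) powr (1 / 2) = of_real (sqrt m)" by (simp add: powr_half_sqrt)
    have "(of_nat m :: complex) powr (3 / 2) = of_nat m powr (1 + 1 / 2)" by simp
    also have "\<dots> = of_nat m * of_real (sqrt m)" unfolding powr_add using that 1 by simp
    finally show "(of_nat m :: complex) powr (3 / 2) = of_real (m * sqrt m)" by simp
  qed
  have "(- 1 / 2 - 1) / 2 * (of_nat m powr (- (- 1 / 2)) + of_nat (m + 1) powr (- (- 1 / 2))) +
      of_nat (m + 1) powr (1 - - 1 / 2) - of_nat m powr (1 - - 1 / 2) =
    (of_real (- 3 / 2 * trapezoid_defect m) :: complex)" if "m \<ge> 1" for m
    unfolding trapezoid_defect_def using pw[of m] pw[of "m + 1"] that by (simp add: field_simps)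
  from this[of "Suc _"] have rd: "r n (- 1 / 2) = of_real (- 3 / 2 * trapezoid_defect (Suc n))" for n
    unfolding rt by simp
  have "summable (\<lambda>n. r n (- 1 / 2))" by (rule smr) simp
  then have "(\<lambda>n. of_real (- 3 / 2 * trapezoid_defect (Suc n)) :: complex) sums (\<Sum>n. r n (- 1 / 2))"
    unfolding rd by (rule summable_sums)
  from sums_mult[OF sums_Re[OF this], of "- 2 / 3"]
  have "(\<lambda>k. trapezoid_defect (Suc k)) sums (- 2 / 3 * Re (\<Sum>n. r n (- 1 / 2)))" by simp
  moreover have "Re (zeta (- 1 / 2)) = - 2 / 3 * Re (\<Sum>n. r n (- 1 / 2)) - 1 / 6"
    unfolding z by (simp add: Re_divide_numeral field_simps)
  ultimately show ?thesis by (rule that)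
qed

section \<open>Euler products of dilation operators\<close>

fun prime_op :: "(nat \<Rightarrow> (real \<Rightarrow> real) \<Rightarrow> real \<Rightarrow> real) \<Rightarrow> nat \<Rightarrow> (real \<Rightarrow> real) \<Rightarrow> real \<Rightarrow> real" where
  "prime_op T 0 f = f"
| "prime_op T (Suc n) f = (if prime (Suc n) then T (Suc n) (prime_op T n f) else prime_op T n f)"

text \<open>
  The three coefficients are the contributions of \<open>e = 1, p, p\<^sup>2\<close> when the prime \<open>p\<close> is allowed in
  either of \<open>a\<close> and \<open>b\<close>, namely \<open>(1 - p\<^sup>-\<^sup>2)\<^sup>2\<close> and \<open>\<phi>(e) e / p\<^sup>4\<close> for \<open>e = p, p\<^sup>2\<close>.
\<close>

definition local_op :: "nat \<Rightarrow> (real \<Rightarrow> real) \<Rightarrow> real \<Rightarrow> real" where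
  "local_op p f = (\<lambda>y. (1 - 1 / real p ^ 2) ^ 2 * f y + (1 - 1 / real p) / real p ^ 2 * f (y / real p) +
     (1 - 1 / real p) * f (y / real p ^ 2))"

definition sieve_op :: "nat \<Rightarrow> (real \<Rightarrow> real) \<Rightarrow> real \<Rightarrow> real" where
  "sieve_op p f = (\<lambda>y. f y - f (y / real p ^ 2))"

definition local_factor :: "nat \<Rightarrow> real" where
  "local_factor l = 1 - (2 - real l powr (- 1 / 2) + real l powr (- 1)) / (real l + 1)\<^sup>2"

text \<open>Both operators are linear combinations of dilations, and dilations commute.\<close>

lemma local_sieve_commute: "local_op p (sieve_op q f) = sieve_op q (local_op p f)"
  by (simp add: local_op_def sieve_op_def fun_eq_iff algebra_simps)

lemma prime_op_local_sieve:
  "prime_op local_op n (sieve_op q f) = sieve_op q (prime_op local_op n f)"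
  by (induction n) (simp_all add: local_sieve_commute)

lemma prime_op_compose:
  "prime_op local_op n (prime_op sieve_op n f) = prime_op (\<lambda>p f. local_op p (sieve_op p f)) n f"
  by (induction n) (simp_all add: prime_op_local_sieve)

lemma local_op_diff:
  "local_op p (\<lambda>y. f y - g y) = (\<lambda>y. local_op p f y - local_op p g y)"
  by (simp add: local_op_def fun_eq_iff algebra_simps diff_divide_distrib add_divide_distrib)

lemma prime_op_local_diff:
  "prime_op local_op n (\<lambda>y. f y - g y) = (\<lambda>y. prime_op local_op n f y - prime_op local_op n g y)"
  by (induction n) (simp_all add: local_op_diff)

lemma prime_op_sieve_linear:
  "prime_op sieve_op n (\<lambda>y. z * y) = (\<lambda>y. (\<Prod>p\<in>primes_upto n. 1 - 1 / real p ^ 2) * z * y)"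
proof (induction n)
  case (Suc n)
  have "Suc n \<notin> primes_upto n" by (simp add: primes_upto_def)
  with Suc show ?case by (auto simp: primes_upto_Suc sieve_op_def fun_eq_iff algebra_simps)
qed simp

text \<open>With \<open>q = 1 / p\<close> the nonnegative coefficients, weighted by the dilations of
  a linear bound, total \<open>(1 - q^2)^2 + (1 - q) * q^3 + (1 - q) * q^2 = 1 - q^2\<close>. A
  linear bound therefore survives all local operators uniformly in \<open>n\<close>, which carries
  the error of an incomplete sieve through them.\<close>

lemma prime_op_local_linear_bound:
  assumes "\<And>y. y > 0 \<Longrightarrow> \<bar>f y\<bar> \<le> a * y" "y > 0"
  shows "\<bar>prime_op local_op n f y\<bar> \<le> a * y"
  using assms(2)
proof (induction n arbitrary: y)
  case 0
  then show ?case using assms(1) by simp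
next
  case (Suc n)
  show ?case
  proof (cases "prime (Suc n)")
    case True
    define p where "p = Suc n"
    define q where "q = 1 / real p"
    have p: "real p \<ge> 2" using prime_ge_2_nat[OF True] unfolding p_def by linarith
    have q: "0 < q" "q \<le> 1 / 2" using p unfolding q_def by (auto simp: field_simps)
    define F where "F = prime_op local_op n f"
    have F: "\<bar>F y\<bar> \<le> a * y" "\<bar>F (y / real p)\<bar> \<le> a * (y * q)" "\<bar>F (y / real p ^ 2)\<bar> \<le> a * (y * q\<^sup>2)"
      using Suc.IH[of y] Suc.IH[of "y / real p"] Suc.IH[of "y / real p ^ 2"] Suc.prems p
      unfolding F_def q_def by (auto simp: power_divide)
    have a: "a \<ge> 0" using F(1) Suc.prems by (meson abs_ge_zero order_trans zero_le_mult_iff not_less)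
    have "\<bar>local_op p F y\<bar> \<le> (1 - q\<^sup>2) ^ 2 * \<bar>F y\<bar> + (1 - q) * q\<^sup>2 * \<bar>F (y / real p)\<bar> + (1 - q) * \<bar>F (y / real p ^ 2)\<bar>"
    proof -
      have "local_op p F y = (1 - q\<^sup>2) ^ 2 * F y + (1 - q) * q\<^sup>2 * F (y / real p) + (1 - q) * F (y / real p ^ 2)"
        by (simp add: local_op_def q_def power_divide)
      also have "\<bar>\<dots>\<bar> \<le> \<bar>(1 - q\<^sup>2) ^ 2 * F y\<bar> + \<bar>(1 - q) * q\<^sup>2 * F (y / real p)\<bar> + \<bar>(1 - q) * F (y / real p ^ 2)\<bar>"
        by linarith
      finally show ?thesis using q by (simp add: abs_mult)
    qed
    also have "\<dots> \<le> (1 - q\<^sup>2) ^ 2 * (a * y) + (1 - q) * q\<^sup>2 * (a * (y * q)) + (1 - q) * (a * (y * q\<^sup>2))"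
      using F q by (intro add_mono mult_left_mono mult_nonneg_nonneg) auto
    also have "\<dots> = (1 - q\<^sup>2) * (a * y)"
      by (simp add: algebra_simps power2_eq_square power4_eq_xxxx)
    also have "\<dots> \<le> 1 * (a * y)" using a Suc.prems by (intro mult_right_mono) auto
    finally show ?thesis using True by (simp add: F_def p_def)
  qed (use Suc in simp)
qed

text \<open>On the left stands the eigenvalue of the combined operator on \<open>sqrt y\<close>: the
  sieve contributes \<open>1 - 1 / p\<close>, the local operator the bracket. On the right are the
  Euler factors of \<open>1 / zeta(2)^2\<close> and of the product in \<open>gamma0\<close>; the
  link is \<open>(p + 1) * (1 / p) = 1 + 1 / p\<close>.\<close>

lemma sqrt_factor:
  assumes p: "p \<ge> 2"
  shows "(1 - 1 / p) * ((1 - 1 / p ^ 2) ^ 2 + (1 - 1 / p) / p ^ 2 / sqrt p + (1 - 1 / p) / p) =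
    (1 - 1 / p ^ 2) ^ 2 * (1 - (2 - p powr (- 1 / 2) + p powr (- 1)) / (p + 1)\<^sup>2)"
proof -
  define q u where "q = 1 / p" and "u = 1 / sqrt p"
  have q: "q > 0" "1 + q \<noteq> 0" "p = 1 / q" using p unfolding q_def by (simp_all add: field_simps)
  have "(p + 1) * q = 1 + q" using q by (simp add: field_simps)
  then have "(1 - q)\<^sup>2 * (1 + q)\<^sup>2 = (1 - q)\<^sup>2 * q\<^sup>2 * (p + 1)\<^sup>2"
    by (metis mult.assoc mult.commute power_mult_distrib)
  moreover have "(1 - q ^ 2) ^ 2 = (1 - q)\<^sup>2 * (1 + q)\<^sup>2"
    by (simp add: power2_eq_square algebra_simps)
  ultimately have "(1 - q ^ 2) ^ 2 = (1 - q)\<^sup>2 * q\<^sup>2 * (p + 1)\<^sup>2" by simp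
  then have key: "(1 - q ^ 2) ^ 2 * (z / (p + 1)\<^sup>2) = (1 - q)\<^sup>2 * q\<^sup>2 * z" for z
    using p by simp
  have pw: "p powr (- 1 / 2) = u" "p powr (- 1) = q"
    using p unfolding q_def u_def by (simp_all add: powr_minus_divide powr_half_sqrt)
  have "(1 - q) * ((1 - q ^ 2) ^ 2 + (1 - q) * q ^ 2 * u + (1 - q) * q) =
      (1 - q ^ 2) ^ 2 - (1 - q)\<^sup>2 * q\<^sup>2 * (2 - u + q)"
    by (simp add: power2_eq_square algebra_simps)
  also have "\<dots> = (1 - q ^ 2) ^ 2 * (1 - (2 - u + q) / (p + 1)\<^sup>2)"
    by (simp only: right_diff_distrib[of "(1 - q ^ 2) ^ 2" 1] key mult_1_right)
  finally show ?thesis unfolding pw by (simp add: q_def u_def power_divide)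
qed

text \<open>The composition weights the dilations by \<open>1, q, q^2, q^3, q^4\<close>, where
  \<open>q = 1 / p\<close>, with \<alpha>, \<beta>, \<open>\<gamma> - \<alpha>\<close>,
  \<open>- \<beta>\<close> and \<open>- \<gamma>\<close>. The gain is at \<open>q^2\<close>: there
  the coefficient is only \<open>O(q)\<close>, whereas the local operator alone has one close to 1.
  As \<beta> is \<open>O(q^2)\<close>, the worst remaining contribution to the error is
  \<open>q^(16/9)\<close> from the last dilation, which is summable over the primes.\<close>

lemma local_sieve_op_approx:
  fixes f :: "real \<Rightarrow> real"
  assumes f: "\<And>y. y > 0 \<Longrightarrow> \<bar>f y - c * sqrt y\<bar> \<le> B * y powr (4 / 9)" and y: "y > 0" and p: "p \<ge> 2"
  shows "\<bar>local_op p (sieve_op p f) y - (1 - 1 / real p ^ 2) ^ 2 * local_factor p * c * sqrt y\<bar>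
    \<le> (1 + 5 * real p powr (- 16 / 9)) * B * y powr (4 / 9)"
proof -
  define q where "q = 1 / real p"
  have p': "real p \<ge> 2" using p by simp
  have q: "0 < q" "q \<le> 1 / 2" using p' unfolding q_def by (auto simp: field_simps)
  define \<alpha> where "\<alpha> = (1 - q\<^sup>2)\<^sup>2"
  define \<beta> where "\<beta> = (1 - q) * q\<^sup>2"
  define \<gamma> where "\<gamma> = 1 - q"
  define e where "e y = f y - c * sqrt y" for y
  define Y where "Y = B * y powr (4 / 9)"
  have Y: "Y \<ge> 0" using f[OF y] unfolding Y_def by linarith
  have e: "\<bar>e (y * q ^ j)\<bar> \<le> Y * q powr (4 * j / 9)" for j :: nat
  proof -
    have "\<bar>e (y * q ^ j)\<bar> \<le> B * (y * q ^ j) powr (4 / 9)" using f[of "y * q ^ j"] y q by (simp add: e_def)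
    also have "(y * q ^ j) powr (4 / 9) = y powr (4 / 9) * q powr (4 * j / 9)"
      using y q by (simp add: powr_mult powr_powr mult.commute flip: powr_realpow)
    finally show ?thesis by (simp add: Y_def)
  qed
  have expand: "local_op p (sieve_op p h) y = \<alpha> * h y + \<beta> * h (y * q) + (\<gamma> - \<alpha>) * h (y * q ^ 2)
      - \<beta> * h (y * q ^ 3) - \<gamma> * h (y * q ^ 4)" for h
    unfolding local_op_def sieve_op_def \<alpha>_def \<beta>_def \<gamma>_def q_def
    by (simp add: power_divide power2_eq_square power3_eq_cube power4_eq_xxxx algebra_simps
        diff_divide_distrib add_divide_distrib)
  have sq: "sqrt (y * q ^ 2) = sqrt y * q" "sqrt (y * q) = sqrt y * sqrt q" "sqrt (y * q ^ 3) = sqrt y * (q * sqrt q)"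
    "sqrt (y * q ^ 4) = sqrt y * q\<^sup>2"
  proof -
    have "q ^ 4 = (q\<^sup>2)\<^sup>2" "q ^ 3 = q\<^sup>2 * q" by (simp_all add: eval_nat_numeral)
    then show "sqrt (y * q ^ 2) = sqrt y * q" "sqrt (y * q) = sqrt y * sqrt q"
      "sqrt (y * q ^ 3) = sqrt y * (q * sqrt q)" "sqrt (y * q ^ 4) = sqrt y * q\<^sup>2"
      using q by (simp_all only: real_sqrt_mult real_sqrt_abs) auto
  qed
  have main: "local_op p (sieve_op p (\<lambda>y. c * sqrt y)) y = (1 - 1 / real p ^ 2) ^ 2 * local_factor p * c * sqrt y"
  proof -
    have "local_op p (sieve_op p (\<lambda>y. c * sqrt y)) y =
        (1 - q) * (\<alpha> + \<beta> * sqrt q + \<gamma> * q) * c * sqrt y"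
      unfolding expand sq by (simp add: algebra_simps power2_eq_square)
    also have "(1 - q) * (\<alpha> + \<beta> * sqrt q + \<gamma> * q) = (1 - 1 / real p ^ 2) ^ 2 * local_factor p"
      using sqrt_factor[OF p'] unfolding \<alpha>_def \<beta>_def \<gamma>_def local_factor_def q_def
      by (simp add: power_divide real_sqrt_divide)
    finally show ?thesis .
  qed
  have "local_op p (sieve_op p f) y - local_op p (sieve_op p (\<lambda>y. c * sqrt y)) y =
    \<alpha> * e y + \<beta> * e (y * q) + (\<gamma> - \<alpha>) * e (y * q ^ 2) - \<beta> * e (y * q ^ 3) - \<gamma> * e (y * q ^ 4)"
    unfolding expand e_def by (simp add: algebra_simps)
  also have "\<bar>\<dots>\<bar> \<le> \<bar>\<alpha> * e y\<bar> + \<bar>\<beta> * e (y * q)\<bar> + \<bar>(\<gamma> - \<alpha>) * e (y * q ^ 2)\<bar> + \<bar>\<beta> * e (y * q ^ 3)\<bar> + \<bar>\<gamma> * e (y * q ^ 4)\<bar>"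
    by linarith
  also have "\<dots> = \<bar>\<alpha>\<bar> * \<bar>e y\<bar> + \<bar>\<beta>\<bar> * \<bar>e (y * q)\<bar> + \<bar>\<gamma> - \<alpha>\<bar> * \<bar>e (y * q ^ 2)\<bar> + \<bar>\<beta>\<bar> * \<bar>e (y * q ^ 3)\<bar> + \<bar>\<gamma>\<bar> * \<bar>e (y * q ^ 4)\<bar>"
    by (simp only: abs_mult)
  also have "\<dots> \<le> 1 * Y + q\<^sup>2 * Y + (2 * q) * (Y * q powr (8 / 9)) + q\<^sup>2 * Y + 1 * (Y * q powr (16 / 9))"
  proof (intro add_mono mult_mono)
    have q2: "q\<^sup>2 \<le> 1" using q by (intro power_le_one) auto
    show "\<bar>\<alpha>\<bar> \<le> 1" unfolding \<alpha>_def using q2 by (simp add: power_le_one)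
    show "\<bar>\<beta>\<bar> \<le> q\<^sup>2" "\<bar>\<beta>\<bar> \<le> q\<^sup>2" unfolding \<beta>_def using q by (simp_all add: abs_mult mult_left_le_one_le)
    show "\<bar>\<gamma>\<bar> \<le> 1" unfolding \<gamma>_def using q by simp
    have "\<gamma> - \<alpha> = q * (- 1 + 2 * q - q ^ 3)"
      unfolding \<alpha>_def \<gamma>_def by (simp add: algebra_simps power2_eq_square power3_eq_cube)
    also have "\<bar>\<dots>\<bar> \<le> q * 2"
    proof -
      have "0 \<le> q ^ 3" "q ^ 3 \<le> 1" using q by (auto intro!: power_le_one)
      then have "\<bar>- 1 + 2 * q - q ^ 3\<bar> \<le> 2" using q by linarith
      then show ?thesis using q by (simp add: abs_mult)
    qed
    finally show "\<bar>\<gamma> - \<alpha>\<bar> \<le> 2 * q" by simp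
    show "\<bar>e y\<bar> \<le> Y" using e[of 0] q by simp
    have le: "Y * q powr t \<le> Y" if "t \<ge> 0" for t
      using Y q that by (intro mult_left_le powr_le1) auto
    show "\<bar>e (y * q)\<bar> \<le> Y" using e[of 1] le[of "4/9"] by simp
    show "\<bar>e (y * q ^ 3)\<bar> \<le> Y" using e[of 3] le[of "12/9"] by simp
    show "\<bar>e (y * q\<^sup>2)\<bar> \<le> Y * q powr (8 / 9)" using e[of 2] by simp
    show "\<bar>e (y * q ^ 4)\<bar> \<le> Y * q powr (16 / 9)" using e[of 4] by simp
  qed (use q Y in auto)
  also have "\<dots> \<le> Y + q powr (16 / 9) * Y + 2 * (q powr (16 / 9) * Y) + q powr (16 / 9) * Y + q powr (16 / 9) * Y"
  proof -
    have "q\<^sup>2 = q powr 2" using q by simp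
    also have "\<dots> \<le> q powr (16 / 9)" using q by (intro powr_mono') auto
    finally have 1: "q\<^sup>2 * Y \<le> q powr (16 / 9) * Y" using Y by (rule mult_right_mono)
    have "q * q powr (8 / 9) = q powr (17 / 9)" using q powr_add[of q 1 "8/9"] by simp
    also have "\<dots> \<le> q powr (16 / 9)" using q by (intro powr_mono') auto
    finally have "(q * q powr (8 / 9)) * Y \<le> q powr (16 / 9) * Y" using Y by (rule mult_right_mono)
    then show ?thesis using 1 by (simp add: mult_ac)
  qed
  also have "\<dots> = (1 + 5 * q powr (16 / 9)) * Y" by (simp add: algebra_simps)
  also have "q powr (16 / 9) = real p powr (- 16 / 9)"
    unfolding q_def using p' by (simp add: powr_divide powr_minus_divide)
  finally show ?thesis unfolding main Y_def by (simp add: mult_ac)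
qed

lemma prime_op_approx:
  fixes f :: "real \<Rightarrow> real"
  assumes f: "\<And>y. y > 0 \<Longrightarrow> \<bar>f y - c * sqrt y\<bar> \<le> B * y powr (4 / 9)" and y: "y > 0"
  shows "\<bar>prime_op (\<lambda>p f. local_op p (sieve_op p f)) n f y -
      (\<Prod>p\<in>primes_upto n. (1 - 1 / real p ^ 2) ^ 2 * local_factor p) * c * sqrt y\<bar>
    \<le> (\<Prod>p\<in>primes_upto n. 1 + 5 * real p powr (- 16 / 9)) * B * y powr (4 / 9)"
  using y
proof (induction n arbitrary: y)
  case 0
  then show ?case using f by simp
next
  case (Suc n)
  show ?case
  proof (cases "prime (Suc n)")
    case True
    have *: "Suc n \<notin> primes_upto n" by (simp add: primes_upto_def)
    show ?thesis
      using local_sieve_op_approx[OF Suc.IH Suc.prems prime_ge_2_nat[OF True]] True *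
      by (simp add: primes_upto_Suc mult_ac)
  qed (use Suc in \<open>simp add: primes_upto_Suc\<close>)
qed

section \<open>Sieving a sum over square dilations\<close>

lemma summable_on_inverse_squares: "(\<lambda>m. 1 / (real m)\<^sup>2) summable_on {1..}"
proof -
  have "summable (\<lambda>m. 1 / (real m)\<^sup>2)"
    using summable_inverse_squares by (subst (asm) summable_Suc_iff)
  then have "(\<lambda>m. 1 / (real m)\<^sup>2) summable_on UNIV"
    by (subst summable_on_UNIV_nonneg_real_iff) auto
  then show ?thesis by (rule summable_on_subset) auto
qed

lemma summable_on_scaled:
  assumes f: "\<And>y. y > 0 \<Longrightarrow> 0 \<le> f y \<and> f y \<le> y" and y: "y > 0" and A: "A \<subseteq> {1..}"
  shows "(\<lambda>m. f (y / (real m)\<^sup>2)) summable_on A"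
proof (rule summable_on_comparison_test)
  have "(\<lambda>m. y * (1 / (real m)\<^sup>2)) summable_on {1..}"
    by (intro summable_on_cmult_right summable_on_inverse_squares)
  then show "(\<lambda>m. y * (1 / (real m)\<^sup>2)) summable_on A" using A by (rule summable_on_subset)
  fix m assume "m \<in> A"
  then have "real m > 0" using A by auto
  then show "f (y / (real m)\<^sup>2) \<le> y * (1 / (real m)\<^sup>2)" "0 \<le> f (y / (real m)\<^sup>2)"
    using f[of "y / (real m)\<^sup>2"] y by auto
qed

definition rough :: "nat \<Rightarrow> nat set" where
  "rough n = {m. m \<ge> 1 \<and> (\<forall>p. prime p \<and> p \<le> n \<longrightarrow> \<not> p dvd m)}"

lemma rough_0: "rough 0 = {1..}"
  by (auto simp: rough_def)

lemma rough_subset: "rough n \<subseteq> insert 1 {n<..}"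
proof
  fix m assume m: "m \<in> rough n"
  show "m \<in> insert 1 {n<..}"
  proof (cases "m = 1")
    case False
    then obtain p where p: "prime p" "p dvd m" using prime_factor_nat[OF False] by auto
    then have "\<not> p \<le> n" using m by (auto simp: rough_def)
    moreover have "p \<le> m" using p(2) m by (intro dvd_imp_le) (auto simp: rough_def)
    ultimately show ?thesis by simp
  qed simp
qed

lemma one_in_rough: "1 \<in> rough n"
  by (auto simp: rough_def)

lemma rough_Suc:
  "rough (Suc n) = (if prime (Suc n) then rough n - times (Suc n) ` rough n else rough n)"
proof (cases "prime (Suc n)")
  case True
  have "m \<in> times (Suc n) ` rough n" if m: "m \<in> rough n" and dvd: "Suc n dvd m" for m
  proof -
    obtain k where k: "m = Suc n * k" using dvd by (rule dvdE)
    have "k \<ge> 1" using m k by (cases k) (auto simp: rough_def)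
    moreover have "\<not> p dvd k" if "prime p" "p \<le> n" for p
      using m that k by (auto simp: rough_def simp del: mult_Suc)
    ultimately have "k \<in> rough n" by (simp add: rough_def)
    then show ?thesis using k by blast
  qed
  moreover have "rough (Suc n) = {m \<in> rough n. \<not> Suc n dvd m}"
    using True by (auto simp: rough_def le_Suc_eq)
  moreover have "Suc n dvd m" if "m \<in> times (Suc n) ` rough n" for m
    using that by (auto simp del: mult_Suc)
  ultimately have "rough (Suc n) = rough n - times (Suc n) ` rough n" by blast
  then show ?thesis using True by (simp only: if_True)
qed (auto simp: rough_def le_Suc_eq)

lemma image_rough_subset:
  assumes "prime (Suc n)"
  shows "times (Suc n) ` rough n \<subseteq> rough n"
proof
  fix m assume "m \<in> times (Suc n) ` rough n"
  then obtain k where k: "k \<in> rough n" "m = Suc n * k" by auto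
  have "\<not> p dvd Suc n * k" if "prime p" "p \<le> n" for p
  proof
    assume "p dvd Suc n * k"
    then have "p dvd Suc n" using k that by (auto simp: prime_dvd_mult_iff rough_def simp del: mult_Suc)
    then have "p = Suc n" using assms that primes_dvd_imp_eq by blast
    then show False using that by simp
  qed
  then show "m \<in> rough n" using k by (auto simp: rough_def)
qed

text \<open>The sieve of Eratosthenes: replacing \<open>y\<close> by \<open>y / p^2\<close> turns
  the sum over \<open>m\<close> into the sum over the multiples \<open>p * m\<close>, so each step
  deletes the multiples of one more prime.\<close>

lemma prime_op_sieve_sum:
  assumes f: "\<And>y. y > 0 \<Longrightarrow> 0 \<le> f y \<and> f y \<le> y"
    and F: "\<And>y. y > 0 \<Longrightarrow> F y = (\<Sum>\<^sub>\<infinity>m\<in>{1..}. f (y / (real m)\<^sup>2))" and y: "y > 0"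
  shows "prime_op sieve_op n F y = (\<Sum>\<^sub>\<infinity>m\<in>rough n. f (y / (real m)\<^sup>2))"
  using y
proof (induction n arbitrary: y)
  case 0
  then show ?case using F by (simp add: rough_0)
next
  case (Suc n)
  have R: "rough n \<subseteq> {1..}" by (auto simp: rough_def)
  show ?case
  proof (cases "prime (Suc n)")
    case True
    define p where "p = Suc n"
    have p: "real p > 0" by (simp add: p_def)
    have sub: "times p ` rough n \<subseteq> rough n" using image_rough_subset[OF True] by (simp add: p_def)
    have "prime_op sieve_op n F (y / real p ^ 2) = (\<Sum>\<^sub>\<infinity>m\<in>rough n. f (y / real p ^ 2 / (real m)\<^sup>2))"
      by (rule Suc.IH) (use Suc.prems p in auto)
    also have "\<dots> = (\<Sum>\<^sub>\<infinity>m\<in>rough n. f (y / (real (p * m))\<^sup>2))"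
      by (simp add: power_mult_distrib)
    also have "\<dots> = (\<Sum>\<^sub>\<infinity>m\<in>times p ` rough n. f (y / (real m)\<^sup>2))"
      by (subst infsum_reindex) (use p in \<open>auto simp: inj_on_def o_def\<close>)
    finally have "sieve_op p (prime_op sieve_op n F) y =
        (\<Sum>\<^sub>\<infinity>m\<in>rough n. f (y / (real m)\<^sup>2)) - (\<Sum>\<^sub>\<infinity>m\<in>times p ` rough n. f (y / (real m)\<^sup>2))"
      using Suc.IH[OF Suc.prems] by (simp only: sieve_op_def[of p "prime_op sieve_op n F"])
    also have "\<dots> = (\<Sum>\<^sub>\<infinity>m\<in>rough n - times p ` rough n. f (y / (real m)\<^sup>2))"
      by (rule infsum_Diff[symmetric, OF summable_on_scaled[OF f Suc.prems R]
            summable_on_scaled[OF f Suc.prems order_trans[OF sub R]] sub])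
    finally show ?thesis using True by (simp add: rough_Suc p_def)
  qed (use Suc in \<open>simp add: rough_Suc\<close>)
qed

text \<open>An integer without prime factors up to \<open>n\<close> is 1 or exceeds
  \<open>n\<close>, so only \<open>f y\<close> and a tail bounded by \<open>y\<close> times the sum
  of \<open>1 / m^2\<close> over \<open>m > n\<close> remain.\<close>

lemma rough_tail_bound:
  assumes f: "\<And>y. y > 0 \<Longrightarrow> 0 \<le> f y \<and> f y \<le> y" and y: "y > 0" and n: "n \<ge> 1"
  shows "\<bar>(\<Sum>\<^sub>\<infinity>m\<in>rough n. f (y / (real m)\<^sup>2)) - f y\<bar> \<le> 1 / n * y"
proof -
  have R: "rough n - {1} \<subseteq> {1..}" "rough n - {1} \<subseteq> {n<..}" using rough_subset[of n] by (auto simp: rough_def)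
  have "(\<Sum>\<^sub>\<infinity>m\<in>insert 1 (rough n - {1}). f (y / (real m)\<^sup>2)) = f y + (\<Sum>\<^sub>\<infinity>m\<in>rough n - {1}. f (y / (real m)\<^sup>2))"
    using summable_on_scaled[OF f y R(1)] by (subst infsum_insert) auto
  moreover have "insert 1 (rough n - {1}) = rough n" using one_in_rough[of n] by blast
  ultimately have eq: "(\<Sum>\<^sub>\<infinity>m\<in>rough n. f (y / (real m)\<^sup>2)) - f y = (\<Sum>\<^sub>\<infinity>m\<in>rough n - {1}. f (y / (real m)\<^sup>2))"
    by simp
  have pos: "0 \<le> f (y / (real m)\<^sup>2)" "f (y / (real m)\<^sup>2) \<le> y / (real m)\<^sup>2" if "m \<ge> 1" for m :: nat
    using f[of "y / (real m)\<^sup>2"] y that by auto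
  have "(\<Sum>\<^sub>\<infinity>m\<in>rough n - {1}. f (y / (real m)\<^sup>2)) \<ge> 0"
    by (rule infsum_nonneg) (use pos R in auto)
  moreover have "(\<Sum>\<^sub>\<infinity>m\<in>rough n - {1}. f (y / (real m)\<^sup>2)) \<le> 1 / n * y"
  proof (rule infsum_le_finite_sums)
    show "(\<lambda>m. f (y / (real m)\<^sup>2)) summable_on rough n - {1}"
      by (rule summable_on_scaled[OF f y R(1)])
    fix A assume A: "finite A" "A \<subseteq> rough n - {1}"
    define N where "N = Suc (n + Max (insert 0 A))"
    have AN: "A \<subseteq> {Suc n..<Suc N}"
    proof
      fix m assume m: "m \<in> A"
      then have "m \<le> Max (insert 0 A)" using A by (intro Max_ge) auto
      moreover have "m > n" using m A R(2) by auto
      ultimately show "m \<in> {Suc n..<Suc N}" by (simp add: N_def)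
    qed
    have "(\<Sum>m\<in>A. f (y / (real m)\<^sup>2)) \<le> (\<Sum>m\<in>A. y * (1 / (real m - 1) - 1 / real m))"
    proof (rule sum_mono)
      fix m assume "m \<in> A"
      then have m: "m > n" "m \<ge> 1" using A R by auto
      then have m1: "real m > 1" using n by linarith
      have "1 / (real m)\<^sup>2 \<le> 1 / (real m - 1) - 1 / real m"
        using m1 by (simp add: field_simps power2_eq_square)
      then have "y * (1 / (real m)\<^sup>2) \<le> y * (1 / (real m - 1) - 1 / real m)"
        using y by (intro mult_left_mono) auto
      then show "f (y / (real m)\<^sup>2) \<le> y * (1 / (real m - 1) - 1 / real m)" using pos[OF m(2)] by simp
    qed
    also have "\<dots> \<le> (\<Sum>m\<in>{Suc n..<Suc N}. y * (1 / (real m - 1) - 1 / real m))"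
      by (rule sum_mono2[OF _ AN]) (use y n in \<open>auto intro!: mult_nonneg_nonneg simp: frac_le\<close>)
    also have "\<dots> = y * (\<Sum>m\<in>{n..<N}. 1 / real m - 1 / real (Suc m))"
      by (subst sum.shift_bounds_Suc_ivl) (simp add: sum_distrib_left)
    also have "\<dots> = y * (1 / n - 1 / N)"
      by (subst sum_Suc_diff'[of n N "\<lambda>m. - (1 / real m)", simplified, symmetric]) (auto simp: N_def)
    also have "\<dots> \<le> y * (1 / n)" using y by (intro mult_left_mono) auto
    finally show "(\<Sum>m\<in>A. f (y / (real m)\<^sup>2)) \<le> 1 / n * y" by simp
  qed
  ultimately show ?thesis using eq by simp
qed

lemma infsum_from_1_eq_suminf:
  fixes g :: "nat \<Rightarrow> real"
  assumes "(\<lambda>m. g m) summable_on {1..}"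
  shows "(\<Sum>\<^sub>\<infinity>m\<in>{1..}. g m) = (\<Sum>b. g (Suc b))"
proof -
  have eq: "{1..} = range Suc" by (auto simp: image_iff Suc_le_eq gr0_conv_Suc)
  have "((\<lambda>b. g (Suc b)) has_sum (\<Sum>\<^sub>\<infinity>m\<in>{1..}. g m)) UNIV"
    using has_sum_infsum[OF assms] unfolding eq by (subst (asm) has_sum_reindex) (auto simp: o_def)
  then show ?thesis by (simp add: has_sum_imp_sums sums_unique)
qed

lemma psi_bounds: "y > 0 \<Longrightarrow> 0 \<le> psi y \<and> psi y \<le> y"
  using psi_nonneg psi_le_self by simp

lemma local_factor_bounds:
  assumes "l \<ge> 1"
  shows "0 \<le> local_factor l \<and> local_factor l \<le> 1"
proof -
  have l: "real l \<ge> 1" using assms by simp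
  have 1: "real l powr (- 1 / 2) \<le> 1" "real l powr (- 1) \<le> 1" "real l powr (- 1 / 2) > 0" "real l powr (-1) > 0"
    using l by (auto intro!: powr_mono[of _ 0 "real l", simplified])
  have "4 \<le> (real l + 1)\<^sup>2" using l power_mono[of 2 "real l + 1" 2] by simp
  moreover define N where "N = 2 - real l powr (- 1 / 2) + real l powr (- 1)"
  ultimately have "0 \<le> N" "N \<le> (real l + 1)\<^sup>2" using 1 by linarith+
  then show ?thesis unfolding local_factor_def N_def[symmetric] using l
    by (simp add: divide_le_eq_1)
qed

text \<open>The sieve is applied to \<open>f y = y\<close>: its sum over square dilations is
  \<open>Z * y\<close>, each prime multiplies this by \<open>1 - 1 / p^2\<close>, and at
  \<open>y = 1\<close> only the term \<open>m = 1\<close> survives in the limit.\<close>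

lemma prod_inverse_zeta_LIMSEQ:
  "(\<lambda>n. \<Prod>p\<in>primes_upto n. 1 - 1 / real p ^ 2) \<longlonglongrightarrow> 1 / (\<Sum>b. 1 / (real (Suc b))\<^sup>2)"
proof -
  define Z where "Z = (\<Sum>b. 1 / (real (Suc b))\<^sup>2)"
  have Z: "Z > 0" unfolding Z_def by (rule suminf_pos[OF summable_inverse_squares]) simp
  have F: "Z * y = (\<Sum>\<^sub>\<infinity>m\<in>{1..}. y / (real m)\<^sup>2)" if "y > 0" for y
  proof -
    have "(\<Sum>\<^sub>\<infinity>m\<in>{1..}. y / (real m)\<^sup>2) = (\<Sum>\<^sub>\<infinity>m\<in>{1..}. y * (1 / (real m)\<^sup>2))" by simp
    also have "\<dots> = y * (\<Sum>\<^sub>\<infinity>m\<in>{1..}. 1 / (real m)\<^sup>2)"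
      by (intro infsum_cmult_right summable_on_inverse_squares)
    finally show ?thesis
      using infsum_from_1_eq_suminf[OF summable_on_inverse_squares] by (simp add: Z_def mult.commute)
  qed
  have bd: "\<bar>(\<Prod>p\<in>primes_upto n. 1 - 1 / real p ^ 2) * Z - 1\<bar> \<le> 1 / n" if "n \<ge> 1" for n
    using prime_op_sieve_sum[of "\<lambda>y. y" "\<lambda>y. Z * y" 1 n] F rough_tail_bound[of "\<lambda>y. y" 1 n] that
    by (simp add: prime_op_sieve_linear)
  have "(\<lambda>n. (\<Prod>p\<in>primes_upto n. 1 - 1 / real p ^ 2) * Z - 1) \<longlonglongrightarrow> 0"
    by (rule Lim_null_comparison[of _ "\<lambda>n. 1 / real n"])
      (use bd in \<open>auto simp: lim_1_over_n intro!: eventually_sequentiallyI[of 1]\<close>)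
  then have "(\<lambda>n. ((\<Prod>p\<in>primes_upto n. 1 - 1 / real p ^ 2) * Z - 1 + 1) / Z) \<longlonglongrightarrow> (0 + 1) / Z"
    using Z by (intro tendsto_intros) auto
  then show ?thesis using Z unfolding Z_def[symmetric] by simp
qed

text \<open>Sieving the sum over squares up to \<open>n\<close> returns \<open>psi\<close> with
  error \<open>y / n\<close>, which the local operators do not enlarge. After interchanging the
  operators, each prime acts on the sum over squares through the combined operator, whose effect on
  \<open>sqrt y\<close> is known. The threshold for \<open>n\<close> may depend on \<open>x\<close>,
  but the constant does not.\<close>

lemma prime_op_psi_approx:
  assumes sums: "(\<lambda>k. trapezoid_defect (Suc k)) sums S" and c: "c = 2 / 3 - 4 * S"
    and Z: "Z = (\<Sum>b. 1 / (real (Suc b))\<^sup>2)"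
  obtains C where "C \<ge> 0" "\<And>x. x > 0 \<Longrightarrow>
    eventually (\<lambda>n. \<bar>prime_op local_op n psi x - c / Z\<^sup>2 * prime_prod local_factor * sqrt x\<bar> \<le> C * x powr (4 / 9)) sequentially"
proof -
  obtain B where B: "B \<ge> 0" "\<And>y. y > 0 \<Longrightarrow> \<bar>psi_square_sum y - c * sqrt y\<bar> \<le> B * y powr (4 / 9)"
    using psi_square_sum_approx[OF sums c] by blast
  obtain K where K: "K \<ge> 1" "\<And>S :: nat set. finite S \<Longrightarrow> 0 \<notin> S \<Longrightarrow> (\<Prod>p\<in>S. 1 + 5 * real p powr (- (16 / 9))) \<le> K"
    using prod_one_plus_bounded[of 5 "16 / 9"] by auto
  define \<kappa> where "\<kappa> n = (\<Prod>p\<in>primes_upto n. (1 - 1 / real p ^ 2) ^ 2 * local_factor p)" for n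
  have lf: "(\<lambda>n. \<Prod>p\<in>primes_upto n. local_factor p) \<longlonglongrightarrow> prime_prod local_factor"
    unfolding primes_upto_def by (rule prime_prod_LIMSEQ) (intro local_factor_bounds prime_ge_1_nat)
  have \<kappa>: "\<kappa> \<longlonglongrightarrow> 1 / Z\<^sup>2 * prime_prod local_factor"
  proof -
    have "(\<lambda>n. (\<Prod>p\<in>primes_upto n. 1 - 1 / real p ^ 2) ^ 2 * (\<Prod>p\<in>primes_upto n. local_factor p))
      \<longlonglongrightarrow> (1 / Z) ^ 2 * prime_prod local_factor"
      unfolding Z by (intro tendsto_intros prod_inverse_zeta_LIMSEQ lf)
    then show ?thesis by (simp add: \<kappa>_def[abs_def] prod.distrib prod_power_distrib power_divide)
  qed
  have main: "\<bar>prime_op local_op n psi x - \<kappa> n * c * sqrt x\<bar> \<le> 1 / n * x + K * B * x powr (4 / 9)"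
    if n: "n \<ge> 1" and x: "x > 0" for n x
  proof -
    let ?J = "prime_op sieve_op n psi_square_sum"
    have F: "psi_square_sum y = (\<Sum>\<^sub>\<infinity>m\<in>{1..}. psi (y / (real m)\<^sup>2))" if "y > 0" for y
      unfolding psi_square_sum_def
      by (subst infsum_from_1_eq_suminf[OF summable_on_scaled]) (use psi_bounds that in auto)
    have "\<bar>?J y - psi y\<bar> \<le> 1 / n * y" if "y > 0" for y
      using prime_op_sieve_sum[OF psi_bounds F that, of n] rough_tail_bound[OF psi_bounds that n] by simp
    then have "\<bar>prime_op local_op n (\<lambda>y. ?J y - psi y) x\<bar> \<le> 1 / n * x"
      using x by (rule prime_op_local_linear_bound)
    then have 1: "\<bar>prime_op local_op n ?J x - prime_op local_op n psi x\<bar> \<le> 1 / n * x"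
      by (simp only: prime_op_local_diff)
    have "\<bar>prime_op local_op n ?J x - \<kappa> n * c * sqrt x\<bar>
        \<le> (\<Prod>p\<in>primes_upto n. 1 + 5 * real p powr (- 16 / 9)) * B * x powr (4 / 9)"
      unfolding prime_op_compose \<kappa>_def by (rule prime_op_approx[OF B(2) x])
    also have "\<dots> \<le> K * B * x powr (4 / 9)"
      using K(2)[of "primes_upto n"] B(1) by (intro mult_right_mono) (auto simp: primes_upto_def)
    finally show ?thesis using 1 by linarith
  qed
  show ?thesis
  proof (rule that)
    \<comment> \<open>The 2 accounts for the convergence of the partial products and for the error
      \<open>x / n\<close>; for fixed \<open>x\<close> each is eventually below
      \<open>x powr (4 / 9)\<close>.\<close>
    show "K * B + 2 \<ge> 0" using K B by simp
    fix x :: real assume x: "x > 0"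
    let ?l = "1 / Z\<^sup>2 * prime_prod local_factor * c * sqrt x"
    have p: "x powr (4 / 9) > 0" using x by simp
    have "(\<lambda>n. \<kappa> n * c * sqrt x) \<longlonglongrightarrow> ?l" by (intro tendsto_intros \<kappa>)
    then have "eventually (\<lambda>n. dist (\<kappa> n * c * sqrt x) ?l < x powr (4 / 9)) sequentially"
      using p by (rule tendstoD)
    moreover have "eventually (\<lambda>n. 1 / real n * x < x powr (4 / 9)) sequentially"
    proof (rule order_tendstoD(2)[of _ 0])
      show "(\<lambda>n. 1 / real n * x) \<longlonglongrightarrow> 0" using tendsto_mult_left_zero[OF lim_1_over_n] by auto
    qed (use p in auto)
    moreover have "eventually (\<lambda>n::nat. n \<ge> 1) sequentially" by (rule eventually_ge_at_top)
    ultimately show "eventually (\<lambda>n. \<bar>prime_op local_op n psi x - c / Z\<^sup>2 * prime_prod local_factor * sqrt x\<bar> \<le> (K * B + 2) * x powr (4 / 9)) sequentially"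
    proof eventually_elim
      case (elim n)
      then show ?case using main[OF elim(3) x] by (simp add: dist_real_def algebra_simps)
    qed
  qed
qed

lemma prime_op_psi_gamma0:
  obtains C where "C \<ge> 0" "\<And>x. x > 0 \<Longrightarrow>
    eventually (\<lambda>n. \<bar>prime_op local_op n psi x - gamma0 * sqrt x\<bar> \<le> C * x powr (4 / 9)) sequentially"
proof -
  obtain S where S: "(\<lambda>k. trapezoid_defect (Suc k)) sums S" "Re (zeta (- 1 / 2)) = S - 1 / 6"
    by (rule zeta_minus_half)
  \<comment> \<open>By the value of \<open>zeta (- 1 / 2)\<close> this equals
    \<open>- 4 * (S - 1 / 6) = - 4 * zeta (- 1 / 2)\<close>.\<close>
  define c where "c = 2 / 3 - 4 * S"
  have g: "gamma0 = c / (Re (zeta 2))\<^sup>2 * prime_prod local_factor"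
    unfolding gamma0_def S(2) c_def local_factor_def[abs_def] by (simp add: algebra_simps diff_divide_distrib)
  show ?thesis
    using prime_op_psi_approx[OF S(1) c_def Re_zeta_2] that unfolding g by blast
qed

section \<open>Sums over pairs of squarefree integers as products of local operators\<close>

lemma sum_Pow_insert:
  assumes "finite S" "p \<notin> S"
  shows "(\<Sum>A\<in>Pow (insert p S). h A) = (\<Sum>A\<in>Pow S. h A + h (insert p A))"
proof -
  have "inj_on (insert p) (Pow S)" using assms by (auto simp: inj_on_def)
  then show ?thesis using assms
    by (subst Pow_insert, subst sum.union_disjoint) (auto simp: sum.reindex sum.distrib)
qed

lemma sum_divisors_prime_square:
  fixes p m :: nat
  assumes p: "prime p" "\<not> p dvd m" and m: "m > 0"
  shows "(\<Sum>e | e dvd p\<^sup>2 * m. F e) = (\<Sum>e | e dvd m. F e + F (p * e) + F (p\<^sup>2 * e) :: real)"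
proof -
  let ?D = "{e. e dvd m}"
  have fin: "finite ?D" using m by simp
  have p0: "p > 0" using p by (simp add: prime_gt_0_nat)
  have nd: "\<not> p dvd e" if "e dvd m" for e using p(2) that dvd_trans by blast
  have eq: "{e. e dvd p\<^sup>2 * m} = ?D \<union> times p ` ?D \<union> times (p\<^sup>2) ` ?D"
  proof (intro equalityI subsetI)
    fix e assume "e \<in> {e. e dvd p\<^sup>2 * m}"
    then obtain b c where bc: "e = b * c" "b dvd p\<^sup>2" "c dvd m"
      using division_decomp[of e "p\<^sup>2" m] by auto
    then obtain i where "i \<le> 2" "b = p ^ i" using divides_primepow_nat[OF p(1), of b 2] by auto
    then have "b = 1 \<or> b = p \<or> b = p\<^sup>2"
      by (cases i) (auto simp: le_Suc_eq numeral_2_eq_2)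
    then show "e \<in> ?D \<union> times p ` ?D \<union> times (p\<^sup>2) ` ?D" using bc by auto
  next
    fix e assume "e \<in> ?D \<union> times p ` ?D \<union> times (p\<^sup>2) ` ?D"
    then show "e \<in> {e. e dvd p\<^sup>2 * m}"
      by (auto intro: dvd_mult mult_dvd_mono simp: power2_eq_square)
  qed
  have d1: "?D \<inter> times p ` ?D = {}"
  proof -
    have "x \<notin> ?D" if "x \<in> times p ` ?D" for x using that nd[of x] by auto
    then show ?thesis by blast
  qed
  have d2: "(?D \<union> times p ` ?D) \<inter> times (p\<^sup>2) ` ?D = {}"
  proof -
    have "x \<notin> ?D \<union> times p ` ?D" if x: "x \<in> times (p\<^sup>2) ` ?D" for x
    proof -
      obtain e where e: "x = p * (p * e)" using x by (auto simp: power2_eq_square mult.assoc)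
      have "x \<noteq> p * y" if "y dvd m" for y using nd[OF that] p0 e by auto
      moreover have "p dvd x" using e by simp
      ultimately show ?thesis using nd[of x] by blast
    qed
    then show ?thesis by blast
  qed
  have "(\<Sum>e | e dvd p\<^sup>2 * m. F e) = (\<Sum>e\<in>?D. F e) + (\<Sum>e\<in>times p ` ?D. F e) + (\<Sum>e\<in>times (p\<^sup>2) ` ?D. F e)"
    unfolding eq using fin d1 d2 by (simp add: sum.union_disjoint)
  also have "\<dots> = (\<Sum>e\<in>?D. F e) + (\<Sum>e\<in>?D. F (p * e)) + (\<Sum>e\<in>?D. F (p\<^sup>2 * e))"
    using p0 by (simp add: sum.reindex inj_on_def)
  finally show ?thesis by (simp add: sum.distrib)
qed

text \<open>For \<open>f = psi\<close> this is the expected product of the centred counts belonging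
  to \<open>a\<close> and \<open>b\<close>, the products of \<open>A\<close> and \<open>B\<close>,
  including both Moebius signs. Keeping \<open>f\<close> general makes it an operator, to which
  primes can be added one at a time.\<close>

definition pair_kernel :: "nat set \<Rightarrow> nat set \<Rightarrow> (real \<Rightarrow> real) \<Rightarrow> real \<Rightarrow> real" where
  "pair_kernel A B f x = (- 1) ^ card A * (- 1) ^ card B / (real (\<Prod>A) ^ 2 * real (\<Prod>B) ^ 2) *
     (\<Sum>e | e dvd (\<Prod>(A \<inter> B))\<^sup>2. real (totient e) * real e * f (x / real e))"

text \<open>A new prime lies in neither set, in one of them, or in both. The first three cases
  contribute \<open>1 - 2 / p^2\<close>. In the last case the divisors split as \<open>e\<close>,
  \<open>p * e\<close> and \<open>p^2 * e\<close>, adding \<open>1 / p^4\<close> at \<open>x\<close>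
  and new terms at \<open>x / p\<close> and \<open>x / p^2\<close>.\<close>

lemma pair_kernel_insert:
  assumes S: "finite S" "\<And>q. q \<in> S \<Longrightarrow> prime q" and p: "prime p" "p \<notin> S" and AB: "A \<subseteq> S" "B \<subseteq> S"
  shows "pair_kernel A B f x + pair_kernel (insert p A) B f x + pair_kernel A (insert p B) f x +
    pair_kernel (insert p A) (insert p B) f x = local_op p (pair_kernel A B f) x"
proof -
  have fin: "finite A" "finite B" using AB S(1) by (auto intro: finite_subset)
  have pn: "p \<notin> A" "p \<notin> B" using AB p by auto
  have p2: "real p \<noteq> 0" using p by (auto simp: prime_gt_0_nat)
  define m where "m = (\<Prod>(A \<inter> B))\<^sup>2"
  have prm: "prime q" if "q \<in> A \<inter> B" for q using that AB S by auto
  have "\<Prod>(A \<inter> B) > 0" by (rule prod_primes_pos) (rule prm)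
  then have m0: "m > 0" by (simp add: m_def)
  have "coprime p (\<Prod>(A \<inter> B))"
    using fin prm p pn by (intro coprime_prod_primes) auto
  then have cop: "\<not> p dvd m" using p(1) unfolding m_def
    by (meson coprime_absorb_left not_prime_unit prime_dvd_power)
  define w where "w = (- 1) ^ card A * (- 1) ^ card B / (real (\<Prod>A) ^ 2 * real (\<Prod>B) ^ 2)"
  define G where "G y = (\<Sum>e | e dvd m. real (totient e) * real e * f (y / real e))" for y
  have k: "pair_kernel A B f y = w * G y" for y by (simp add: pair_kernel_def w_def G_def m_def)
  have k1: "pair_kernel (insert p A) B f x = - (1 / real p ^ 2) * (w * G x)"
  proof -
    have "insert p A \<inter> B = A \<inter> B" using pn by auto
    then show ?thesis using fin pn by (simp add: pair_kernel_def w_def G_def m_def power_mult_distrib)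
  qed
  have k2: "pair_kernel A (insert p B) f x = - (1 / real p ^ 2) * (w * G x)"
  proof -
    have "A \<inter> insert p B = A \<inter> B" using pn by auto
    then show ?thesis using fin pn by (simp add: pair_kernel_def w_def G_def m_def power_mult_distrib)
  qed
  have k3: "pair_kernel (insert p A) (insert p B) f x = 1 / real p ^ 4 *
     (w * (G x + (real p - 1) * real p * G (x / real p) + (real p - 1) * real p ^ 3 * G (x / real p ^ 2)))"
  proof -
    let ?F = "\<lambda>e. real (totient e) * real e * f (x / real e)"
    have m': "(\<Prod>(insert p A \<inter> insert p B))\<^sup>2 = p\<^sup>2 * m"
    proof -
      have "insert p A \<inter> insert p B = insert p (A \<inter> B)" by auto
      then show ?thesis using fin pn by (simp add: m_def power_mult_distrib)
    qed
    have "(\<Sum>e | e dvd p\<^sup>2 * m. ?F e) = (\<Sum>e | e dvd m. ?F e + ?F (p * e) + ?F (p\<^sup>2 * e))"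
      by (rule sum_divisors_prime_square) (use p cop m0 in auto)
    also have "\<dots> = (\<Sum>e | e dvd m. ?F e + (real p - 1) * real p * (real (totient e) * real e * f (x / real p / real e))
        + (real p - 1) * real p ^ 3 * (real (totient e) * real e * f (x / real p ^ 2 / real e)))"
    proof (rule sum.cong[OF refl])
      fix e assume e: "e \<in> {e. e dvd m}"
      have "\<not> p dvd e" using e cop dvd_trans by blast
      then have ce: "coprime p e" "coprime (p\<^sup>2) e" using p(1) by (auto simp: prime_imp_coprime)
      have p1: "p \<ge> 1" using prime_gt_0_nat[OF p(1)] by simp
      have t: "real (totient (p * e)) = (real p - 1) * real (totient e)"
        "real (totient (p\<^sup>2 * e)) = (real p - 1) * real p * real (totient e)"
        using totient_mult_coprime[OF ce(1)] totient_mult_coprime[OF ce(2)] p(1) p1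
        by (simp_all add: totient_prime totient_prime_power_Suc[of p 1, simplified] numeral_2_eq_2 of_nat_diff)
      show "?F e + ?F (p * e) + ?F (p\<^sup>2 * e) = ?F e + (real p - 1) * real p * (real (totient e) * real e * f (x / real p / real e))
        + (real p - 1) * real p ^ 3 * (real (totient e) * real e * f (x / real p ^ 2 / real e))"
        unfolding t by (simp add: power2_eq_square power3_eq_cube mult_ac)
    qed
    also have "\<dots> = G x + (real p - 1) * real p * G (x / real p) + (real p - 1) * real p ^ 3 * G (x / real p ^ 2)"
      unfolding G_def by (simp add: sum.distrib sum_distrib_left)
    finally show ?thesis unfolding pair_kernel_def m' using fin pn
      by (simp add: w_def power_mult_distrib power2_eq_square power4_eq_xxxx)
  qed
  show ?thesis unfolding k k1 k2 k3 local_op_def using p2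
    by (simp add: field_simps power2_eq_square power3_eq_cube power4_eq_xxxx)
qed

lemma sum_pair_kernel:
  "(\<Sum>A\<in>Pow (primes_upto n). \<Sum>B\<in>Pow (primes_upto n). pair_kernel A B f x) = prime_op local_op n f x"
proof (induction n arbitrary: x)
  case 0
  have "{e. e dvd (1::nat)} = {1}" by auto
  then show ?case by (simp add: pair_kernel_def)
next
  case (Suc n)
  show ?case
  proof (cases "prime (Suc n)")
    case True
    define p where "p = Suc n"
    let ?S = "primes_upto n"
    have p: "prime p" "p \<notin> ?S" using True by (auto simp: p_def primes_upto_def)
    have IH: "(\<Sum>A\<in>Pow ?S. \<Sum>B\<in>Pow ?S. pair_kernel A B f y) = prime_op local_op n f y" for y
      using Suc.IH .
    have "(\<Sum>A\<in>Pow (insert p ?S). \<Sum>B\<in>Pow (insert p ?S). pair_kernel A B f x) =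
      (\<Sum>A\<in>Pow ?S. \<Sum>B\<in>Pow ?S. pair_kernel A B f x + pair_kernel (insert p A) B f x +
        pair_kernel A (insert p B) f x + pair_kernel (insert p A) (insert p B) f x)"
      using p by (simp add: sum_Pow_insert flip: sum.distrib) (simp add: add_ac)
    also have "\<dots> = (\<Sum>A\<in>Pow ?S. \<Sum>B\<in>Pow ?S. local_op p (pair_kernel A B f) x)"
      by (intro sum.cong refl pair_kernel_insert[where S = ?S]) (use p in \<open>auto simp: prime_primes_upto\<close>)
    also have "\<dots> = local_op p (prime_op local_op n f) x"
      by (simp only: local_op_def sum.distrib sum_distrib_left[symmetric] IH)
    finally show ?thesis using True by (simp add: primes_upto_Suc p_def)
  qed (use Suc in \<open>simp add: primes_upto_Suc\<close>)
qed

text \<open>The estimate \<open>psi (x / e) <= x / e\<close> cancels the factor \<open>e\<close>,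
  and the totients of the divisors of a number add up to it.\<close>

lemma abs_pair_kernel_psi_le:
  assumes AB: "finite A" "finite B" "\<And>q. q \<in> A \<union> B \<Longrightarrow> prime q" and x: "x > 0"
  shows "\<bar>pair_kernel A B psi x\<bar> \<le> x * (real (\<Prod>(A \<inter> B)) ^ 2 / (real (\<Prod>A) ^ 2 * real (\<Prod>B) ^ 2))"
proof -
  define m where "m = (\<Prod>(A \<inter> B))\<^sup>2"
  have m0: "m > 0" using prod_primes_pos[of "A \<inter> B"] AB(3) by (auto simp: m_def)
  have "(\<Sum>e | e dvd m. real (totient e) * real e * psi (x / real e)) \<le> (\<Sum>e | e dvd m. real (totient e) * x)"
  proof (rule sum_mono)
    fix e assume "e \<in> {e. e dvd m}"
    then have "e > 0" using m0 dvd_pos_nat by auto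
    then have "real (totient e) * real e * psi (x / real e) \<le> real (totient e) * real e * (x / real e)"
      using x psi_le_self[of "x / real e"] by (intro mult_left_mono) auto
    then show "real (totient e) * real e * psi (x / real e) \<le> real (totient e) * x" using \<open>e > 0\<close> by simp
  qed
  also have "\<dots> = real (\<Sum>e | e dvd m. totient e) * x" by (simp add: sum_distrib_right)
  also have "(\<Sum>e | e dvd m. totient e) = m" by (rule totient_divisor_sum)
  finally have 1: "(\<Sum>e | e dvd m. real (totient e) * real e * psi (x / real e)) \<le> real m * x" .
  have 2: "(\<Sum>e | e dvd m. real (totient e) * real e * psi (x / real e)) \<ge> 0"
    by (intro sum_nonneg mult_nonneg_nonneg psi_nonneg) auto
  have "\<bar>pair_kernel A B psi x\<bar> = 1 / (real (\<Prod>A) ^ 2 * real (\<Prod>B) ^ 2) * (\<Sum>e | e dvd m. real (totient e) * real e * psi (x / real e))"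
    using 2 unfolding pair_kernel_def m_def[symmetric] by (simp add: abs_mult power_abs)
  also have "\<dots> \<le> 1 / (real (\<Prod>A) ^ 2 * real (\<Prod>B) ^ 2) * (real m * x)"
    using 1 by (intro mult_left_mono) auto
  finally show ?thesis by (simp add: m_def mult.commute)
qed

text \<open>For fixed \<open>A\<close> the weights factor over the primes of \<open>B\<close>: a
  prime of \<open>A\<close> contributes 2, any other prime \<open>1 + 1 / p^2\<close>. The sum over
  \<open>A\<close> beyond \<open>L\<close> is then treated by Rankin's trick with exponent
  \<open>1 / 2\<close>, leaving the convergent product of \<open>1 + 2 * p^(-3/2)\<close>. Symmetry
  covers the pairs where only \<open>B\<close> is large.\<close>

lemma pair_kernel_tail:
  obtains C where "C \<ge> 0" "\<And>n L x. L > 0 \<Longrightarrow> x > 0 \<Longrightarrow>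
    \<bar>(\<Sum>A | A \<subseteq> primes_upto n \<and> real (\<Prod>A) \<le> L. \<Sum>B | B \<subseteq> primes_upto n \<and> real (\<Prod>B) \<le> L. pair_kernel A B psi x)
      - prime_op local_op n psi x\<bar> \<le> C * x * L powr (- 1 / 2)"
proof -
  obtain K1 where K1: "K1 \<ge> 1" "\<And>S :: nat set. finite S \<Longrightarrow> 0 \<notin> S \<Longrightarrow> (\<Prod>p\<in>S. 1 + 1 * real p powr (- 2)) \<le> K1"
    using prod_one_plus_bounded[of 1 2] by auto
  obtain K2 where K2: "K2 \<ge> 1" "\<And>S :: nat set. finite S \<Longrightarrow> 0 \<notin> S \<Longrightarrow> (\<Prod>p\<in>S. 1 + 2 * real p powr (- (3 / 2))) \<le> K2"
    using prod_one_plus_bounded[of 2 "3 / 2"] by auto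
  show ?thesis
  proof (rule that)
    show "2 * K1 * K2 \<ge> 0" using K1 K2 by simp
    fix n :: nat and L x :: real assume L: "L > 0" and x: "x > 0"
    let ?S = "primes_upto n"
    have S: "finite ?S" "0 \<notin> ?S" by (auto simp: primes_upto_def)
    define w where "w A B = real (\<Prod>(A \<inter> B)) ^ 2 / (real (\<Prod>A) ^ 2 * real (\<Prod>B) ^ 2)" for A B :: "nat set"
    define lo where "lo = {A. A \<subseteq> ?S \<and> real (\<Prod>A) \<le> L}"
    define hi where "hi = {A. A \<subseteq> ?S \<and> L < real (\<Prod>A)}"
    have Pow: "Pow ?S = lo \<union> hi" "lo \<inter> hi = {}" "finite lo" "finite hi"
      unfolding lo_def hi_def using S by (auto intro: finite_subset[of _ "Pow ?S"])
    have w0: "w A B \<ge> 0" for A B by (simp add: w_def)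
    have wsym: "w A B = w B A" for A B by (simp add: w_def Int_commute mult.commute)
    have kw: "\<bar>pair_kernel A B psi x\<bar> \<le> x * w A B" if "A \<subseteq> ?S" "B \<subseteq> ?S" for A B
      unfolding w_def using that S x prime_primes_upto
      by (intro abs_pair_kernel_psi_le) (auto intro: finite_subset)
    have inner: "(\<Sum>B\<in>Pow ?S. w A B) \<le> K1 * (\<Prod>p\<in>A. 2 * (1 / real p ^ 2))" if A: "A \<subseteq> ?S" for A
    proof -
      have finA: "finite A" using A S finite_subset by blast
      have "w A B = 1 / real (\<Prod>A) ^ 2 * (\<Prod>p\<in>B. if p \<in> A then 1 else 1 / real p ^ 2)" if B: "B \<subseteq> ?S" for B
      proof -
        have finB: "finite B" using B S finite_subset by blast
        have "(\<Prod>p\<in>B. if p \<in> A then 1 else 1 / real p ^ 2) = (\<Prod>p\<in>B. (if p \<in> A then real p ^ 2 else 1) / real p ^ 2)"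
        proof (rule prod.cong[OF refl])
          fix p assume "p \<in> B"
          then have "real p > 0" using B by (auto simp: primes_upto_def prime_gt_0_nat)
          then show "(if p \<in> A then 1 else 1 / real p ^ 2) = (if p \<in> A then real p ^ 2 else 1) / real p ^ 2" by simp
        qed
        also have "\<dots> = (\<Prod>p\<in>B. if p \<in> A then real p ^ 2 else 1) / (\<Prod>p\<in>B. real p ^ 2)"
          by (simp add: prod_dividef)
        also have "(\<Prod>p\<in>B. if p \<in> A then real p ^ 2 else 1) = (\<Prod>p\<in>A \<inter> B. real p ^ 2)"
          using finB by (simp add: prod.If_cases Int_def conj_commute)
        finally show ?thesis by (simp add: w_def prod_power_distrib)
      qed
      then have a1: "(\<Sum>B\<in>Pow ?S. w A B) = 1 / real (\<Prod>A) ^ 2 * (\<Sum>B\<in>Pow ?S. \<Prod>p\<in>B. if p \<in> A then 1 else 1 / real p ^ 2)"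
        by (simp add: sum_distrib_left)
      have "(\<Sum>B\<in>Pow ?S. \<Prod>p\<in>B. if p \<in> A then 1 else 1 / real p ^ 2) = (\<Prod>p\<in>?S. 1 + (if p \<in> A then 1 else 1 / real p ^ 2))"
        by (rule sum_Pow_prod) fact
      also have "\<dots> \<le> (\<Prod>p\<in>?S. (1 + 1 * real p powr (- 2)) * (if p \<in> A then 2 else 1))"
      proof (intro prod_mono conjI)
        fix p assume "p \<in> ?S"
        then have "real p > 0" by (auto simp: primes_upto_def prime_gt_0_nat)
        then show "1 + (if p \<in> A then 1 else 1 / real p ^ 2) \<le> (1 + 1 * real p powr (- 2)) * (if p \<in> A then 2 else 1)"
          by (simp add: powr_minus_divide powr_numeral)
      qed auto
      also have "\<dots> = (\<Prod>p\<in>?S. 1 + 1 * real p powr (- 2)) * (\<Prod>p\<in>A. 2)"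
        using A S by (simp add: prod.distrib prod.If_cases Int_absorb1)
      also have "\<dots> \<le> K1 * (\<Prod>p\<in>A. 2)" using K1(2)[OF S] by (intro mult_right_mono) auto
      finally have "(\<Sum>B\<in>Pow ?S. w A B) \<le> 1 / real (\<Prod>A) ^ 2 * (K1 * (\<Prod>p\<in>A. 2))"
        unfolding a1 by (rule mult_left_mono) simp
      also have "\<dots> = K1 * (\<Prod>p\<in>A. 2 * (1 / real p ^ 2))"
        by (simp add: prod.distrib prod_dividef prod_power_distrib)
      finally show ?thesis .
    qed
    have hi_sum: "(\<Sum>A\<in>hi. \<Sum>B\<in>Pow ?S. w A B) \<le> K1 * K2 * L powr (- 1 / 2)"
    proof -
      have b1: "(\<Sum>A\<in>hi. \<Sum>B\<in>Pow ?S. w A B) \<le> K1 * (\<Sum>A\<in>hi. \<Prod>p\<in>A. 2 * (1 / real p ^ 2))"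
        unfolding sum_distrib_left
        using inner by (intro sum_mono) (auto simp: hi_def)
      have "(\<Sum>A\<in>hi. \<Prod>p\<in>A. 2 * (1 / real p ^ 2)) \<le>
          L powr (- (1 / 2)) * (\<Prod>p\<in>?S. 1 + 2 * (1 / real p ^ 2) * real p powr (1 / 2))"
        unfolding hi_def by (rule rankin_bound) (use S L in auto)
      also have "(\<Prod>p\<in>?S. 1 + 2 * (1 / real p ^ 2) * real p powr (1 / 2)) = (\<Prod>p\<in>?S. 1 + 2 * real p powr (- (3 / 2)))"
      proof (rule prod.cong[OF refl])
        fix p assume "p \<in> ?S"
        then have p: "real p > 0" by (auto simp: primes_upto_def prime_gt_0_nat)
        then have "1 / real p ^ 2 = real p powr (- 2)" by (simp add: powr_minus_divide powr_numeral)
        then have "1 / real p ^ 2 * real p powr (1 / 2) = real p powr (- (3 / 2))"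
          by (simp flip: powr_add)
        then show "1 + 2 * (1 / real p ^ 2) * real p powr (1 / 2) = 1 + 2 * real p powr (- (3 / 2))" by simp
      qed
      also have "L powr (- (1 / 2)) * \<dots> \<le> L powr (- (1 / 2)) * K2"
        by (intro mult_left_mono K2(2)[OF S]) simp
      finally have "K1 * (\<Sum>A\<in>hi. \<Prod>p\<in>A. 2 * (1 / real p ^ 2)) \<le> K1 * (L powr (- (1 / 2)) * K2)"
        using K1 by (intro mult_left_mono) auto
      then show ?thesis using b1 by (simp add: mult_ac)
    qed
    let ?k = "\<lambda>A B. pair_kernel A B psi x"
    have "prime_op local_op n psi x = (\<Sum>A\<in>lo. \<Sum>B\<in>lo. ?k A B) + (\<Sum>A\<in>lo. \<Sum>B\<in>hi. ?k A B) + (\<Sum>A\<in>hi. \<Sum>B\<in>Pow ?S. ?k A B)"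
      unfolding sum_pair_kernel[symmetric] using Pow
      by (simp add: sum.union_disjoint sum.distrib)
    then have "\<bar>(\<Sum>A\<in>lo. \<Sum>B\<in>lo. ?k A B) - prime_op local_op n psi x\<bar> \<le>
        \<bar>\<Sum>A\<in>lo. \<Sum>B\<in>hi. ?k A B\<bar> + \<bar>\<Sum>A\<in>hi. \<Sum>B\<in>Pow ?S. ?k A B\<bar>" by linarith
    also have "\<dots> \<le> (\<Sum>A\<in>lo. \<Sum>B\<in>hi. x * w A B) + (\<Sum>A\<in>hi. \<Sum>B\<in>Pow ?S. x * w A B)"
      by (intro add_mono order_trans[OF sum_abs] sum_mono kw) (auto simp: lo_def hi_def)
    also have "(\<Sum>A\<in>lo. \<Sum>B\<in>hi. x * w A B) = (\<Sum>B\<in>hi. \<Sum>A\<in>lo. x * w B A)"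
      by (subst sum.swap) (simp add: wsym)
    also have "\<dots> \<le> (\<Sum>B\<in>hi. \<Sum>A\<in>Pow ?S. x * w B A)"
      using x w0 S by (intro sum_mono sum_mono2) (auto simp: lo_def)
    also have "(\<Sum>B\<in>hi. \<Sum>A\<in>Pow ?S. x * w B A) + (\<Sum>A\<in>hi. \<Sum>B\<in>Pow ?S. x * w A B) = 2 * x * (\<Sum>A\<in>hi. \<Sum>B\<in>Pow ?S. w A B)"
      by (simp add: sum_distrib_left mult.assoc)
    also have "\<dots> \<le> 2 * x * (K1 * K2 * L powr (- 1 / 2))"
      using hi_sum x by (intro mult_left_mono) auto
    finally show "\<bar>(\<Sum>A | A \<subseteq> ?S \<and> real (\<Prod>A) \<le> L. \<Sum>B | B \<subseteq> ?S \<and> real (\<Prod>B) \<le> L. ?k A B)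
      - prime_op local_op n psi x\<bar> \<le> 2 * K1 * K2 * x * L powr (- 1 / 2)"
      unfolding lo_def by (simp add: mult_ac)
  qed
qed

section \<open>Roots modulo squares of primes and elimination\<close>

lemma poly_cong:
  fixes P :: "int poly"
  assumes "[a = b] (mod m)"
  shows "[poly P a = poly P b] (mod m)"
  by (induction P) (auto intro!: cong_add cong_mult assms)

lemma poly_mod_dvd_iff:
  fixes P :: "int poly"
  assumes "m dvd k"
  shows "m dvd poly P (t mod k) \<longleftrightarrow> m dvd poly P t"
proof -
  have "[t mod k = t] (mod m)" using assms by (metis cong_dvd_modulus cong_mod_left cong_refl)
  then show ?thesis by (intro cong_dvd_iff poly_cong)
qed

lemma roots_mod_iff: "t \<in> roots_mod P m \<longleftrightarrow> 0 \<le> t \<and> t < int m \<and> int m dvd poly P t"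
  by (auto simp: roots_mod_def cong_0_iff)

lemma finite_roots_mod [simp]: "finite (roots_mod P m)"
  by (rule finite_subset[of _ "{0..<int m}"]) (auto simp: roots_mod_iff)

lemma card_roots_mod_le: "card (roots_mod P m) \<le> m"
proof -
  have "card (roots_mod P m) \<le> card {0..<int m}"
    by (rule card_mono) (auto simp: roots_mod_iff)
  then show ?thesis by simp
qed

lemma card_roots_mod_mult:
  assumes cop: "coprime m n" and pos: "m > 0" "n > 0"
  shows "card (roots_mod P (m * n)) = card (roots_mod P m) * card (roots_mod P n)"
proof -
  have cop': "coprime (int m) (int n)" using cop by (simp only: coprime_int_iff)
  have "bij_betw (\<lambda>t. (t mod int m, t mod int n)) (roots_mod P (m * n)) (roots_mod P m \<times> roots_mod P n)"
  proof (rule bij_betw_imageI)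
    show "inj_on (\<lambda>t. (t mod int m, t mod int n)) (roots_mod P (m * n))"
    proof (rule inj_onI, clarify)
      fix t u assume tu: "t \<in> roots_mod P (m * n)" "u \<in> roots_mod P (m * n)"
        "t mod int m = u mod int m" "t mod int n = u mod int n"
      then have "[t = u] (mod int m)" "[t = u] (mod int n)" by (simp_all add: cong_def)
      then have "[t = u] (mod int m * int n)" using cop' by (rule coprime_cong_mult)
      then show "t = u" using tu by (intro cong_less_imp_eq_int[of t "int m * int n" u]) (auto simp: roots_mod_iff)
    qed
    show "(\<lambda>t. (t mod int m, t mod int n)) ` roots_mod P (m * n) = roots_mod P m \<times> roots_mod P n"
    proof (intro equalityI subsetI)
      fix z assume "z \<in> (\<lambda>t. (t mod int m, t mod int n)) ` roots_mod P (m * n)"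
      then obtain t where t: "t \<in> roots_mod P (m * n)" "z = (t mod int m, t mod int n)" by blast
      then have "int m * int n dvd poly P t" by (simp add: roots_mod_iff)
      then have "int m dvd poly P t" "int n dvd poly P t" by (auto dest: dvd_mult_left dvd_mult_right)
      then show "z \<in> roots_mod P m \<times> roots_mod P n"
        using t pos by (auto simp: roots_mod_iff poly_mod_dvd_iff)
    next
      fix z assume "z \<in> roots_mod P m \<times> roots_mod P n"
      then obtain u v where z: "z = (u, v)" "u \<in> roots_mod P m" "v \<in> roots_mod P n" by blast
      obtain x where x: "[x = u] (mod int m)" "[x = v] (mod int n)"
        using binary_chinese_remainder_int[OF cop'] by blast
      define t where "t = x mod (int m * int n)"
      have "[t = x] (mod int m)" "[t = x] (mod int n)"
        unfolding t_def by (auto simp: cong_def mod_mod_cancel)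
      then have tu: "[t = u] (mod int m)" "[t = v] (mod int n)" using x cong_trans by blast+
      then have "int m dvd poly P t" "int n dvd poly P t"
        using cong_dvd_iff[OF poly_cong] z by (auto simp: roots_mod_iff)
      then have "int m * int n dvd poly P t" using cop' by (rule divides_mult)
      then have "t \<in> roots_mod P (m * n)" using pos by (simp add: roots_mod_iff t_def)
      moreover have "t mod int m = u" "t mod int n = v" using tu z by (auto simp: cong_def roots_mod_iff)
      ultimately show "z \<in> (\<lambda>t. (t mod int m, t mod int n)) ` roots_mod P (m * n)" using z by blast
    qed
  qed
  then have "card (roots_mod P (m * n)) = card (roots_mod P m \<times> roots_mod P n)" by (rule bij_betw_same_card)
  then show ?thesis by (simp add: card_cartesian_product)
qed

lemma card_roots_mod_prod_primes:
  assumes "finite A" "\<And>p. p \<in> A \<Longrightarrow> prime p"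
  shows "card (roots_mod P ((\<Prod>A)\<^sup>2)) = (\<Prod>p\<in>A. card (roots_mod P (p\<^sup>2)))"
  using assms
proof (induction A rule: finite_induct)
  case empty
  have "roots_mod P 1 = {0}" by (auto simp: roots_mod_iff)
  then show ?case by simp
next
  case (insert p A)
  have "coprime p (\<Prod>A)" using insert by (intro coprime_prod_primes) auto
  then have cop: "coprime (p\<^sup>2) ((\<Prod>A)\<^sup>2)" by simp
  have "\<Prod>A > 0" "p > 0" using insert.prems by (auto intro: prod_primes_pos simp: prime_gt_0_nat)
  then have "card (roots_mod P (p\<^sup>2 * (\<Prod>A)\<^sup>2)) = card (roots_mod P (p\<^sup>2)) * card (roots_mod P ((\<Prod>A)\<^sup>2))"
    by (intro card_roots_mod_mult cop) auto
  then show ?case using insert by (simp add: power_mult_distrib)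
qed

text \<open>Lagrange's argument, splitting off a linear factor at a root. The degree may drop modulo
  \<open>l\<close>; what passes to the quotient is that not all coefficients vanish modulo
  \<open>l\<close>.\<close>

lemma card_roots_mod_prime:
  assumes l: "prime l" and "\<not> (\<forall>i. int l dvd coeff P i)"
  shows "card (roots_mod P l) \<le> degree P"
  using assms(2)
proof (induction "degree P" arbitrary: P)
  case 0
  then obtain c where c: "P = [:c:]" by (metis degree_eq_zeroE)
  have "\<not> int l dvd c"
  proof
    assume "int l dvd c"
    then have "\<forall>i. int l dvd coeff P i" using c by (auto simp: coeff_pCons split: nat.split)
    then show False using 0 by blast
  qed
  then have "roots_mod P l = {}" using c by (auto simp: roots_mod_iff)
  then show ?case by simp
next
  case (Suc n)
  show ?case
  proof (cases "roots_mod P l = {}")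
    case False
    then obtain r where r: "r \<in> roots_mod P l" by blast
    define Q where "Q = synthetic_div P r"
    have P: "P = [:- r, 1:] * Q + [:poly P r:]"
      using synthetic_div_correct'[of r P] by (simp add: Q_def)
    have degQ: "degree Q = n" using Suc by (simp add: Q_def degree_synthetic_div)
    have dr: "int l dvd poly P r" using r by (simp add: roots_mod_iff)
    have "\<not> (\<forall>i. int l dvd coeff Q i)"
    proof
      assume *: "\<forall>i. int l dvd coeff Q i"
      have "int l dvd coeff ([:- r, 1:] * Q + [:poly P r:]) i" for i
        using * dr by (cases i) (auto simp: coeff_pCons split: nat.splits)
      then show False using Suc.prems P by metis
    qed
    then have IH: "card (roots_mod Q l) \<le> n" using Suc.hyps(1)[of Q] degQ by simp
    have "roots_mod P l \<subseteq> insert r (roots_mod Q l)"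
    proof
      fix t assume t: "t \<in> roots_mod P l"
      have "poly P t = (t - r) * poly Q t + poly P r" by (subst P) (simp add: algebra_simps)
      then have "int l dvd (t - r) * poly Q t"
        using t dr by (simp add: roots_mod_iff) (metis dvd_add_left_iff)
      then have "int l dvd t - r \<or> int l dvd poly Q t" using l by (simp add: prime_dvd_mult_iff)
      moreover have "t = r" if "int l dvd t - r"
        using that t r by (intro cong_less_imp_eq_int[of t "int l" r]) (auto simp: roots_mod_iff cong_iff_dvd_diff)
      ultimately show "t \<in> insert r (roots_mod Q l)" using t by (auto simp: roots_mod_iff)
    qed
    then have "card (roots_mod P l) \<le> card (insert r (roots_mod Q l))" by (intro card_mono) auto
    also have "\<dots> \<le> Suc (card (roots_mod Q l))" by (rule card_insert_le_m1) auto
    also have "\<dots> \<le> Suc n" using IH by simp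
    finally show ?thesis using Suc by simp
  qed simp
qed

text \<open>Each of the at most \<open>degree P\<close> roots modulo \<open>l\<close> has at most
  \<open>l\<close> lifts. This serves the primes at which a multiple root may occur.\<close>

lemma card_roots_mod_prime_square:
  assumes l: "prime l" and "\<not> (\<forall>i. int l dvd coeff P i)"
  shows "card (roots_mod P (l\<^sup>2)) \<le> degree P * l"
proof -
  have l0: "l > 0" using l by (simp add: prime_gt_0_nat)
  have "inj_on (\<lambda>t. (t mod int l, t div int l)) (roots_mod P (l\<^sup>2))"
    by (rule inj_onI) (metis Pair_inject mult_div_mod_eq)
  moreover have "(\<lambda>t. (t mod int l, t div int l)) ` roots_mod P (l\<^sup>2) \<subseteq> roots_mod P l \<times> {0..<int l}"
  proof clarify
    fix t assume t: "t \<in> roots_mod P (l\<^sup>2)"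
    then have "t < int l * int l" "0 \<le> t" "int l * int l dvd poly P t" by (auto simp: roots_mod_iff power2_eq_square)
    moreover have "int l * (t div int l) < int l * int l"
      using mult_div_mod_eq[of "int l" t] pos_mod_sign[of "int l" t] l0 calculation by linarith
    ultimately have "t div int l < int l" "int l dvd poly P t" "0 \<le> t"
      using l0 by (auto dest: dvd_mult_left)
    then show "t mod int l \<in> roots_mod P l \<and> t div int l \<in> {0..<int l}"
      using l0 by (auto simp: roots_mod_iff poly_mod_dvd_iff pos_imp_zdiv_nonneg_iff)
  qed
  ultimately have "card (roots_mod P (l\<^sup>2)) \<le> card (roots_mod P l \<times> {0..<int l})"
    by (intro card_inj_on_le) auto
  also have "\<dots> \<le> degree P * l" using card_roots_mod_prime[OF assms] by (simp add: card_cartesian_product)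
  finally show ?thesis .
qed

lemma poly_taylor_2:
  fixes P :: "'a :: idom poly"
  shows "\<exists>q. poly P (t + h) = poly P t + h * poly (pderiv P) t + h\<^sup>2 * q"
proof (induction P)
  case (pCons a P)
  then obtain q where q: "poly P (t + h) = poly P t + h * poly (pderiv P) t + h\<^sup>2 * q" by blast
  show ?case
    by (rule exI[of _ "poly (pderiv P) t + (t + h) * q"])
      (simp only: poly_pCons pderiv_pCons poly_add q, simp add: algebra_simps power2_eq_square)
qed (auto intro: exI[of _ 0])

text \<open>Uniqueness in Hensel's lemma: if two roots modulo \<open>l^2\<close> agree modulo
  \<open>l\<close>, the second order Taylor term vanishes modulo \<open>l^2\<close>, and since the
  derivative is a unit the difference is divisible by \<open>l^2\<close>.\<close>

lemma card_roots_mod_prime_square_separable: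
  assumes l: "prime l" and sep: "\<And>t. int l dvd poly P t \<Longrightarrow> \<not> int l dvd poly (pderiv P) t"
  shows "card (roots_mod P (l\<^sup>2)) \<le> degree P"
proof -
  have l0: "l > 0" using l by (simp add: prime_gt_0_nat)
  have ndvd: "\<not> (\<forall>i. int l dvd coeff P i)"
  proof
    assume "\<forall>i. int l dvd coeff P i"
    then have "int l dvd poly P 0" "int l dvd poly (pderiv P) 0"
      by (auto simp: poly_0_coeff_0 coeff_pderiv)
    then show False using sep by blast
  qed
  have sq: "int (l\<^sup>2) = int l * int l" by (simp add: power2_eq_square)
  have "inj_on (\<lambda>t. t mod int l) (roots_mod P (l\<^sup>2))"
  proof (rule inj_onI)
    fix t u assume t: "t \<in> roots_mod P (l\<^sup>2)" and u: "u \<in> roots_mod P (l\<^sup>2)" and eq: "t mod int l = u mod int l"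
    then have "int l dvd u - t" by (metis mod_eq_dvd_iff)
    then obtain k where k: "u = t + int l * k" by (metis add.commute diff_add_cancel dvdE)
    obtain q where q: "poly P u = poly P t + (int l * k) * poly (pderiv P) t + (int l * k)\<^sup>2 * q"
      using poly_taylor_2[of P t "int l * k"] k by blast
    have d: "int l * int l dvd poly P t" "int l * int l dvd poly P u" using t u by (simp_all only: roots_mod_iff sq)
    have "int l * (k * poly (pderiv P) t) = poly P u - poly P t - (int l * int l) * (k\<^sup>2 * q)"
      unfolding q by (simp add: power2_eq_square algebra_simps)
    moreover have "int l * int l dvd \<dots>" using d by (intro dvd_diff) auto
    ultimately have "int l * int l dvd int l * (k * poly (pderiv P) t)" by simp
    then have "int l dvd k * poly (pderiv P) t" using l0 by simp
    moreover have "\<not> int l dvd poly (pderiv P) t" using d(1) by (intro sep) (auto dest: dvd_mult_left)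
    ultimately have "int l dvd k" using l by (simp add: prime_dvd_mult_iff)
    then have "int (l\<^sup>2) dvd u - t" unfolding sq k by auto
    then show "t = u" using t u by (intro cong_less_imp_eq_int[of t "int (l\<^sup>2)" u])
        (auto simp: roots_mod_iff cong_iff_dvd_diff dvd_diff_commute)
  qed
  moreover have "(\<lambda>t. t mod int l) ` roots_mod P (l\<^sup>2) \<subseteq> roots_mod P l"
    using l0 by (auto simp: roots_mod_iff poly_mod_dvd_iff power2_eq_square dest: dvd_mult_left)
  ultimately have "card (roots_mod P (l\<^sup>2)) \<le> card (roots_mod P l)"
    by (intro card_inj_on_le) auto
  then show ?thesis using card_roots_mod_prime[OF l ndvd] by simp
qed

section \<open>Complex roots and elimination\<close>

definition cpoly :: "int poly \<Rightarrow> complex \<Rightarrow> complex" where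
  "cpoly P z = poly (map_poly of_int P) z"

lemma cpoly_0 [simp]: "cpoly 0 z = 0"
  by (simp add: cpoly_def)

lemma cpoly_pCons [simp]: "cpoly (pCons a P) z = of_int a + z * cpoly P z"
  by (simp add: cpoly_def map_poly_pCons)

lemma cpoly_add [simp]: "cpoly (P + Q) z = cpoly P z + cpoly Q z"
  by (induction P Q rule: poly_induct2) (simp_all add: algebra_simps)

lemma cpoly_smult [simp]: "cpoly (smult a P) z = of_int a * cpoly P z"
  by (induction P) (simp_all add: algebra_simps)

lemma cpoly_minus [simp]: "cpoly (P - Q) z = cpoly P z - cpoly Q z"
  using cpoly_add[of P "- Q" z] cpoly_smult[of "- 1" Q z] by simp

lemma cpoly_mult [simp]: "cpoly (P * Q) z = cpoly P z * cpoly Q z"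
  by (induction P) (simp_all add: algebra_simps)

lemma cpoly_no_root:
  assumes "\<And>z. cpoly P z \<noteq> 0"
  shows "degree P = 0"
proof (rule ccontr)
  assume "degree P \<noteq> 0"
  then have "degree (map_poly of_int P :: complex poly) \<noteq> 0" by (simp add: degree_map_poly)
  then have "\<exists>z. poly (map_poly of_int P :: complex poly) z = 0"
    by (intro fundamental_theorem_of_algebra) (simp add: constant_degree)
  then show False using assms by (auto simp: cpoly_def)
qed

lemma finite_cpoly_roots:
  assumes "P \<noteq> 0"
  shows "finite {z. cpoly P z = 0}" "card {z. cpoly P z = 0} \<le> degree P"
proof -
  have "map_poly of_int P \<noteq> (0 :: complex poly)" using assms by (simp add: map_poly_eq_0_iff)
  then show "finite {z. cpoly P z = 0}" "card {z. cpoly P z = 0} \<le> degree P"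
    using poly_roots_finite card_poly_roots_bound[of "map_poly of_int P :: complex poly"]
    unfolding cpoly_def by (simp_all add: degree_map_poly)
qed

text \<open>
  A nonzero integer combination of \<open>F\<close> and \<open>G\<close>, found by eliminating leading terms. It plays the
  role of the resultant; the bound is much weaker but still a power of the height.
\<close>

lemma elimination_step:
  fixes F G :: "int poly"
  assumes "degree G \<ge> 1" "degree F \<ge> degree G"
  defines "F' \<equiv> smult (lead_coeff G) F - monom (lead_coeff F) (degree F - degree G) * G"
  shows "degree F' < degree F"
proof -
  have "coeff F' k = 0" if "k \<ge> degree F" for k
  proof (cases "k = degree F")
    case True
    then show ?thesis using assms by (simp add: F'_def coeff_monom_mult)
  next
    case False
    then have "k > degree F" using that by simp
    then show ?thesis using assms by (simp add: F'_def coeff_monom_mult coeff_eq_0)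
  qed
  then have "degree F' \<le> degree F - 1" using assms by (intro degree_le) auto
  then show ?thesis using assms by simp
qed

lemma elimination:
  fixes F G :: "int poly" and X :: real
  assumes "F \<noteq> 0 \<or> G \<noteq> 0" and "\<And>z. \<not> (cpoly F z = 0 \<and> cpoly G z = 0)"
    and "X \<ge> 1" and "\<And>i. \<bar>real_of_int (coeff F i)\<bar> \<le> X" "\<And>i. \<bar>real_of_int (coeff G i)\<bar> \<le> X"
    and "degree F + degree G \<le> n"
  shows "\<exists>R. R \<noteq> 0 \<and> \<bar>real_of_int R\<bar> \<le> (2 * X) ^ (2 ^ n) \<and>
    (\<forall>m t. m dvd poly F t \<and> m dvd poly G t \<longrightarrow> m dvd R)"
  using assms
proof (induction n arbitrary: F G X)
  have const: "\<exists>R. R \<noteq> 0 \<and> \<bar>real_of_int R\<bar> \<le> (2 * X) ^ (2 ^ n) \<and> (\<forall>m t. m dvd poly F t \<longrightarrow> m dvd R)"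
    if F0: "degree F = 0" and F: "F \<noteq> 0" "X \<ge> 1" "\<And>i. \<bar>real_of_int (coeff F i)\<bar> \<le> X" for F X n
  proof -
    obtain c where c: "F = [:c:]" using F0 by (rule degree_eq_zeroE)
    have "\<bar>real_of_int c\<bar> \<le> X" using F(3)[of 0] c by simp
    also have "\<dots> \<le> (2 * X) ^ 1" using F(2) by simp
    also have "\<dots> \<le> (2 * X) ^ (2 ^ n)" using F(2) by (intro power_increasing) auto
    finally show ?thesis using F(1) c by (intro exI[of _ c]) auto
  qed
  {
    case 0
    then have "degree F = 0" "degree G = 0" by auto
    then show ?case using const[of F X 0] const[of G X 0] 0 by blast
  next
    case (Suc n)
    have wlog: "\<exists>R. R \<noteq> 0 \<and> \<bar>real_of_int R\<bar> \<le> (2 * X) ^ (2 ^ Suc n) \<and>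
        (\<forall>m t. m dvd poly F t \<and> m dvd poly G t \<longrightarrow> m dvd R)"
      if FG: "F \<noteq> 0 \<or> G \<noteq> 0" "\<And>z. \<not> (cpoly F z = 0 \<and> cpoly G z = 0)"
        "\<And>i. \<bar>real_of_int (coeff F i)\<bar> \<le> X" "\<And>i. \<bar>real_of_int (coeff G i)\<bar> \<le> X"
        "degree F + degree G \<le> Suc n" "degree F \<ge> degree G" for F G
    proof (cases "degree G = 0")
      case True
      show ?thesis
      proof (cases "G = 0")
        case True
        then have "cpoly F z \<noteq> 0" for z using FG(2)[of z] by simp
        then have "degree F = 0" by (rule cpoly_no_root)
        then show ?thesis using const[of F X "Suc n"] True FG Suc.prems(3) by blast
      next
        case False
        then show ?thesis using const[of G X "Suc n"] \<open>degree G = 0\<close> FG Suc.prems(3) by blast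
      qed
    next
      case False
      define F' where "F' = smult (lead_coeff G) F - monom (lead_coeff F) (degree F - degree G) * G"
      have deg: "degree F' < degree F" using elimination_step[of G F] False FG unfolding F'_def by simp
      have X: "X \<ge> 1" by fact
      have "\<exists>R. R \<noteq> 0 \<and> \<bar>real_of_int R\<bar> \<le> (2 * (2 * X\<^sup>2)) ^ (2 ^ n) \<and>
          (\<forall>m t. m dvd poly F' t \<and> m dvd poly G t \<longrightarrow> m dvd R)"
      proof (rule Suc.IH)
        have G0: "G \<noteq> 0" using False by auto
        then show "F' \<noteq> 0 \<or> G \<noteq> 0" by simp
        \<comment> \<open>At a root of \<open>G\<close> the new polynomial equals
          \<open>lead_coeff G\<close> times \<open>F\<close>, so a common root of the new pair would
          be one of the old pair.\<close>
        show "\<not> (cpoly F' z = 0 \<and> cpoly G z = 0)" for z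
          using FG(2)[of z] G0 by (auto simp: F'_def)
        have X2: "X\<^sup>2 \<ge> X" using X by (simp add: power2_eq_square)
        then show "2 * X\<^sup>2 \<ge> 1" using X by linarith
        show "\<bar>real_of_int (coeff G i)\<bar> \<le> 2 * X\<^sup>2" for i using FG(4)[of i] X2 X by linarith
        show "\<bar>real_of_int (coeff F' i)\<bar> \<le> 2 * X\<^sup>2" for i
        proof -
          let ?c = "if degree F - degree G \<le> i then coeff G (i - (degree F - degree G)) else 0"
          have "coeff F' i = lead_coeff G * coeff F i - lead_coeff F * ?c"
            by (simp add: F'_def coeff_monom_mult)
          then have "\<bar>real_of_int (coeff F' i)\<bar> \<le> \<bar>real_of_int (lead_coeff G)\<bar> * \<bar>real_of_int (coeff F i)\<bar> +
              \<bar>real_of_int (lead_coeff F)\<bar> * \<bar>real_of_int ?c\<bar>"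
            by (simp add: abs_mult[symmetric] abs_triangle_ineq4 del: abs_mult)
          also have "\<dots> \<le> X * X + X * X"
            using FG(3,4) X by (intro add_mono mult_mono) auto
          finally show ?thesis by (simp add: power2_eq_square)
        qed
        show "degree F' + degree G \<le> n" using deg FG by simp
      qed
      then obtain R where R: "R \<noteq> 0" "\<bar>real_of_int R\<bar> \<le> (2 * (2 * X\<^sup>2)) ^ (2 ^ n)"
          "\<And>m t. m dvd poly F' t \<and> m dvd poly G t \<Longrightarrow> m dvd R" by blast
      \<comment> \<open>One elimination step replaces the bound \<open>X\<close> by
        \<open>2 * X^2\<close>, which squares \<open>2 * X\<close>; this is why the exponent doubles
        with the sum of the degrees.\<close>
      have "(2 * (2 * X\<^sup>2)) ^ (2 ^ n) = ((2 * X)\<^sup>2) ^ (2 ^ n)" by (simp add: power_mult_distrib)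
      also have "\<dots> = (2 * X) ^ (2 ^ Suc n)" by (simp only: power_mult[symmetric] power_Suc)
      finally have "\<bar>real_of_int R\<bar> \<le> (2 * X) ^ (2 ^ Suc n)" using R(2) by simp
      moreover have "m dvd R" if "m dvd poly F t \<and> m dvd poly G t" for m t
        using that by (intro R(3)[of m t]) (auto simp: F'_def)
      ultimately show ?thesis using R(1) by blast
    qed
    show ?case
    proof (cases "degree F \<ge> degree G")
      case True
      then show ?thesis using wlog[of F G] Suc.prems by blast
    next
      case False
      then have "\<exists>R. R \<noteq> 0 \<and> \<bar>real_of_int R\<bar> \<le> (2 * X) ^ (2 ^ Suc n) \<and>
          (\<forall>m t. m dvd poly G t \<and> m dvd poly F t \<longrightarrow> m dvd R)"
        using Suc.prems by (intro wlog) (auto simp: add.commute)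
      then show ?thesis by blast
    qed
  }
qed

section \<open>Truncation of the singular series\<close>

definition root_density :: "int poly \<Rightarrow> nat \<Rightarrow> real" where
  "root_density P l = real (card (roots_mod P (l\<^sup>2))) / real (l\<^sup>2)"

definition prime_sets :: "real \<Rightarrow> nat set set" where
  "prime_sets L = {A. finite A \<and> (\<forall>p\<in>A. prime p) \<and> real (\<Prod>A) \<le> L}"

lemma prime_setsD:
  assumes "A \<in> prime_sets L"
  shows "finite A" "\<And>p. p \<in> A \<Longrightarrow> prime p" "\<Prod>A > 0" "real (\<Prod>A) \<le> L"
proof -
  show 1: "finite A" "\<And>p. p \<in> A \<Longrightarrow> prime p" "real (\<Prod>A) \<le> L"
    using assms by (auto simp: prime_sets_def)
  show "\<Prod>A > 0" by (rule prod_primes_pos) (rule 1)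
qed

lemma prime_sets_eq:
  assumes "L \<le> real n"
  shows "prime_sets L = {A. A \<subseteq> primes_upto n \<and> real (\<Prod>A) \<le> L}"
proof (intro equalityI subsetI)
  fix A assume A: "A \<in> prime_sets L"
  have "p \<le> n" if "p \<in> A" for p
  proof -
    have "p dvd \<Prod>A" using that A by (auto simp: prime_sets_def intro: dvd_prodI)
    then have "p \<le> \<Prod>A" using prime_setsD(3)[OF A] by (rule dvd_imp_le)
    then have "real p \<le> real (\<Prod>A)" by (simp only: of_nat_le_iff)
    then show ?thesis using prime_setsD(4)[OF A] assms by linarith
  qed
  then show "A \<in> {A. A \<subseteq> primes_upto n \<and> real (\<Prod>A) \<le> L}"
    using A by (auto simp: prime_sets_def primes_upto_def)
next
  fix A assume "A \<in> {A. A \<subseteq> primes_upto n \<and> real (\<Prod>A) \<le> L}"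
  moreover from this have "finite A" using finite_primes_upto finite_subset by blast
  ultimately show "A \<in> prime_sets L" by (auto simp: prime_sets_def primes_upto_def)
qed

lemma finite_prime_sets [simp]: "finite (prime_sets L)"
proof -
  obtain n where "L \<le> real n" using real_arch_simple by blast
  from prime_sets_eq[OF this] show ?thesis
    by (simp add: finite_subset[of _ "Pow (primes_upto n)"])
qed

lemma card_prime_sets:
  assumes "L \<ge> 0"
  shows "real (card (prime_sets L)) \<le> L"
proof -
  have "card (prime_sets L) \<le> card {1..nat \<lfloor>L\<rfloor>}"
  proof (rule card_inj_on_le)
    show "inj_on Prod (prime_sets L)" by (rule inj_on_prod_primes) (auto simp: prime_sets_def)
    show "Prod ` prime_sets L \<subseteq> {1..nat \<lfloor>L\<rfloor>}"
      using prime_setsD(3,4) by (force simp: le_nat_floor Suc_le_eq)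
  qed simp
  also have "real \<dots> \<le> L" using assms by simp
  finally show ?thesis by simp
qed

definition truncated_series :: "real \<Rightarrow> int poly \<Rightarrow> real" where
  "truncated_series L P = (\<Sum>A\<in>prime_sets L. (- 1) ^ card A * (\<Prod>p\<in>A. root_density P p))"

lemma root_density_bounds: "0 \<le> root_density P l" "root_density P l \<le> 1"
proof -
  show "0 \<le> root_density P l" by (simp add: root_density_def)
  have le: "real (card (roots_mod P (l\<^sup>2))) \<le> real (l\<^sup>2)" by (simp only: of_nat_le_iff card_roots_mod_le)
  show "root_density P l \<le> 1"
  proof (cases "l = 0")
    case False
    then have "real (l\<^sup>2) > 0" by simp
    then show ?thesis unfolding root_density_def using le by (simp only: divide_le_eq_1_pos)
  qed (simp add: root_density_def)
qed

lemma prod_root_density: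
  assumes "finite A" "\<And>p. p \<in> A \<Longrightarrow> prime p"
  shows "(\<Prod>p\<in>A. root_density P p) = real (card (roots_mod P ((\<Prod>A)\<^sup>2))) / real ((\<Prod>A)\<^sup>2)"
proof -
  have "real (card (roots_mod P ((\<Prod>A)\<^sup>2))) = (\<Prod>p\<in>A. real (card (roots_mod P (p\<^sup>2))))"
    by (simp only: card_roots_mod_prod_primes[OF assms] of_nat_prod)
  moreover have "real ((\<Prod>A)\<^sup>2) = (\<Prod>p\<in>A. real (p\<^sup>2))" by (simp add: prod_power_distrib)
  ultimately show ?thesis by (simp only: root_density_def prod_dividef)
qed

lemma singular_partial_product:
  "(\<Prod>l | prime l \<and> l \<le> N. 1 - real (card (roots_mod P (l\<^sup>2))) / real (l\<^sup>2)) =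
    (\<Sum>A\<in>Pow (primes_upto N). (- 1) ^ card A * (\<Prod>p\<in>A. root_density P p))"
proof -
  have "(\<Prod>l | prime l \<and> l \<le> N. 1 - real (card (roots_mod P (l\<^sup>2))) / real (l\<^sup>2)) =
      (\<Prod>l\<in>primes_upto N. 1 + (- 1) * root_density P l)"
    by (simp add: root_density_def primes_upto_def)
  also have "\<dots> = (\<Sum>A\<in>Pow (primes_upto N). \<Prod>p\<in>A. (- 1) * root_density P p)"
    by (rule sum_Pow_prod[symmetric]) simp
  finally show ?thesis by (simp only: prod.distrib prod_constant)
qed

lemma singular_series_bounds: "0 \<le> singular_series P" "singular_series P \<le> 1"
proof -
  have "0 \<le> 1 - root_density P l \<and> 1 - root_density P l \<le> 1" for l
    using root_density_bounds[of P l] by simp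
  then have "0 \<le> (\<Prod>l | prime l \<and> l \<le> N. 1 - real (card (roots_mod P (l\<^sup>2))) / real (l\<^sup>2))"
    "(\<Prod>l | prime l \<and> l \<le> N. 1 - real (card (roots_mod P (l\<^sup>2))) / real (l\<^sup>2)) \<le> 1" for N
    unfolding root_density_def by (auto intro!: prod_nonneg prod_le_1)
  then show "0 \<le> singular_series P" "singular_series P \<le> 1"
    using LIMSEQ_le_const[OF singular_series_LIMSEQ] LIMSEQ_le_const2[OF singular_series_LIMSEQ] by blast+
qed

text \<open>Every term has modulus at most 1 and there are at most \<open>L\<close> of them. This
  crude bound serves the nonseparable polynomials, which are sufficiently rare.\<close>

lemma singular_series_truncation_trivial:
  assumes "L \<ge> 0"
  shows "\<bar>singular_series P - truncated_series L P\<bar> \<le> 1 + L"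
proof -
  have "\<bar>truncated_series L P\<bar> \<le> (\<Sum>A\<in>prime_sets L. \<bar>(- 1) ^ card A * (\<Prod>p\<in>A. root_density P p)\<bar>)"
    unfolding truncated_series_def by (rule sum_abs)
  also have "\<dots> \<le> (\<Sum>A\<in>prime_sets L. 1)"
    using root_density_bounds by (intro sum_mono) (auto simp: abs_mult power_abs abs_prod intro!: prod_le_1)
  also have "\<dots> \<le> L" using card_prime_sets[OF assms] by simp
  finally show ?thesis using singular_series_bounds[of P] by linarith
qed

definition separable :: "int poly \<Rightarrow> bool" where
  "separable P \<longleftrightarrow> (\<forall>z. \<not> (cpoly P z = 0 \<and> cpoly (pderiv P) z = 0))"

lemma prod_primes_dvd:
  fixes A :: "nat set"
  assumes "finite A" "\<And>p. p \<in> A \<Longrightarrow> prime p" "\<And>p. p \<in> A \<Longrightarrow> p dvd m"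
  shows "\<Prod>A dvd m"
  using assms
proof (induction A rule: finite_induct)
  case (insert p A)
  then have "coprime p (\<Prod>A)" by (intro coprime_prod_primes) auto
  then show ?case using insert by (simp add: divides_mult)
qed simp

lemma prod_prime_divisors_le:
  fixes S :: "nat set"
  assumes "finite S" "\<And>p. p \<in> S \<Longrightarrow> prime p" "m > 0"
  shows "(\<Prod>p\<in>S. if p dvd m then real p else 1) \<le> real m"
proof -
  let ?T = "{p \<in> S. p dvd m}"
  have "(\<Prod>p\<in>S. if p dvd m then real p else 1) = (\<Prod>p\<in>?T. real p)"
    using assms by (subst prod.inter_filter) auto
  also have "\<dots> = real (\<Prod>?T)" by simp
  also have "\<Prod>?T \<le> m"
  proof (rule dvd_imp_le)
    show "\<Prod>?T dvd m" by (rule prod_primes_dvd) (use assms in auto)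
  qed fact
  finally show ?thesis by simp
qed

lemma prime_dvd_content_iff: "int p dvd content P \<longleftrightarrow> (\<forall>i. int p dvd coeff P i)"
  by (simp add: const_poly_dvd_iff flip: const_poly_dvd_iff_dvd_content)

text \<open>Rankin's trick with exponent \<open>9 / 10\<close>. A prime dividing neither the content
  nor the eliminant \<open>R\<close> has root density at most \<open>d / p^2\<close>, giving the
  convergent factor \<open>1 + d * p^(-11/10)\<close>. The other primes dividing \<open>R\<close>
  cost at most \<open>1 + d\<close> each, a power of the number of prime factors of \<open>R\<close>
  and hence at most about \<open>X powr \<eta>\<close>. A prime of the content may have density 1
  and costs a further \<open>p\<close>; all of these together cost at most the content.\<close>

lemma singular_series_truncation:
  fixes d :: nat and \<eta> :: real
  assumes d: "d \<ge> 1" and \<eta>: "\<eta> > 0"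
  obtains C where "C \<ge> 0" "\<And>P X L. degree P = d \<Longrightarrow> X \<ge> 1 \<Longrightarrow> (\<And>i. \<bar>real_of_int (coeff P i)\<bar> \<le> X) \<Longrightarrow>
    separable P \<Longrightarrow> L > 0 \<Longrightarrow>
    \<bar>singular_series P - truncated_series L P\<bar> \<le> C * X powr \<eta> * real_of_int (content P) * L powr (- 9 / 10)"
proof -
  \<comment> \<open>The exponent in the elimination bound: the degrees of \<open>P\<close> and its
    derivative add up to at most \<open>2 * d\<close>. Dividing \<eta> by it makes the final loss
    \<open>X powr \<eta>\<close>.\<close>
  define E where "E = (2 :: nat) ^ (2 * d)"
  have E: "real E > 0" unfolding E_def by simp
  obtain K where K: "K \<ge> 1" "\<And>S :: nat set. finite S \<Longrightarrow> 0 \<notin> S \<Longrightarrow> (\<Prod>p\<in>S. 1 + real d * real p powr (- (11 / 10))) \<le> K"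
    using prod_one_plus_bounded[of "real d" "11 / 10"] by auto
  obtain C1 where C1: "C1 \<ge> 1" "\<And>m :: nat. m > 0 \<Longrightarrow> (1 + real d) ^ card (prime_factors m) \<le> C1 * real m powr (\<eta> / E)"
    using power_card_prime_factors_bound[of "1 + real d" "\<eta> / E"] \<eta> E by auto
  define C where "C = K * C1 * (2 * real d) powr \<eta>"
  show ?thesis
  proof (rule that)
    show "C \<ge> 0" unfolding C_def using K C1 by simp
    fix P :: "int poly" and X L :: real
    assume P: "degree P = d" and X: "X \<ge> 1" and co: "\<And>i. \<bar>real_of_int (coeff P i)\<bar> \<le> X"
      and sep: "separable P" and L: "L > 0"
    have P0: "P \<noteq> 0" using P d by auto
    have dX: "real d * X \<ge> 1" "X \<le> real d * X"
      using d X mult_mono[of 1 "real d" 1 X] mult_right_mono[of 1 "real d" X] by auto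
    have "\<exists>R. R \<noteq> 0 \<and> \<bar>real_of_int R\<bar> \<le> (2 * (real d * X)) ^ (2 ^ (2 * d)) \<and>
        (\<forall>m t. m dvd poly P t \<and> m dvd poly (pderiv P) t \<longrightarrow> m dvd R)"
    proof (rule elimination)
      show "P \<noteq> 0 \<or> pderiv P \<noteq> 0" using P0 by simp
      show "\<not> (cpoly P z = 0 \<and> cpoly (pderiv P) z = 0)" for z using sep by (simp add: separable_def)
      show "real d * X \<ge> 1" by fact
      show "\<bar>real_of_int (coeff P i)\<bar> \<le> real d * X" for i using co[of i] dX by linarith
      show "\<bar>real_of_int (coeff (pderiv P) i)\<bar> \<le> real d * X" for i
      proof (cases "Suc i \<le> d")
        case True
        have "\<bar>real_of_int (coeff (pderiv P) i)\<bar> = real (Suc i) * \<bar>real_of_int (coeff P (Suc i))\<bar>"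
          by (simp add: coeff_pderiv abs_mult)
        also have "\<dots> \<le> real d * X" using True co[of "Suc i"] by (intro mult_mono) auto
        finally show ?thesis .
      next
        case False
        then show ?thesis using P dX X by (simp add: coeff_pderiv coeff_eq_0)
      qed
      show "degree P + degree (pderiv P) \<le> 2 * d" using P by (simp add: degree_pderiv)
    qed
    then obtain R where R: "R \<noteq> 0" "\<bar>real_of_int R\<bar> \<le> (2 * (real d * X)) ^ E"
      "\<And>m t. m dvd poly P t \<Longrightarrow> m dvd poly (pderiv P) t \<Longrightarrow> m dvd R"
      unfolding E_def by blast
    define r where "r = nat \<bar>R\<bar>"
    have r: "r > 0" "real r = \<bar>real_of_int R\<bar>" using R(1) unfolding r_def by simp_all
    have pr: "int p dvd R \<longleftrightarrow> p dvd r" for p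
      unfolding r_def using int_dvd_int_iff[of p "nat \<bar>R\<bar>"] by simp
    define c where "c = nat (content P)"
    have cpos: "content P > 0" using P0 content_eq_zero_iff[of P] normalize_content[of P]
      by (simp add: less_le)
    then have c: "c > 0" "real c = real_of_int (content P)" "int c = content P" unfolding c_def by simp_all
    have pc: "p dvd c \<longleftrightarrow> (\<forall>i. int p dvd coeff P i)" for p
      using prime_dvd_content_iff[of p P] c(3) int_dvd_int_iff[of p c] by simp
    have factor: "1 + root_density P p * real p powr (9 / 10) \<le>
        (1 + real d * real p powr (- (11 / 10))) * (if p dvd r then 1 + real d else 1) * (if p dvd c then real p else 1)"
      if p: "prime p" for p
    proof -
      have p1: "real p \<ge> 1" using prime_gt_0_nat[OF p] by simp
      have p2: "real p ^ 2 = real p powr 2" using p1 by (simp add: powr_numeral)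
      have pm: "real p powr (9 / 10) \<le> real p" using p1 powr_mono[of "9/10" 1 "real p"] by simp
      have F1: "1 \<le> 1 + real d * real p powr (- (11 / 10))" by simp
      consider "p dvd c" | "\<not> p dvd c" "p dvd r" | "\<not> p dvd c" "\<not> p dvd r" by blast
      then show ?thesis
      proof cases
        case 1
        then have all: "\<forall>i. int p dvd coeff P i" by (simp add: pc)
        then have "int p dvd poly P 0" "int p dvd poly (pderiv P) 0" by (auto simp: poly_0_coeff_0 coeff_pderiv)
        \<comment> \<open>A prime of the content divides the values of \<open>P\<close> and of its
          derivative, so it divides the eliminant too, and the factor \<open>1 + d\<close> is
          available beside \<open>p\<close>.\<close>
        then have "p dvd r" using R(3) pr by blast
        have "1 + root_density P p * real p powr (9 / 10) \<le> 1 + 1 * real p"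
          using root_density_bounds[of P p] pm by (intro add_mono mult_mono) auto
        also have "\<dots> \<le> (1 + real d) * real p"
          using d p1 mult_mono[of 1 "real d" 1 "real p"] by (simp add: distrib_right)
        also have "\<dots> \<le> (1 + real d * real p powr (- (11 / 10))) * ((1 + real d) * real p)"
          using mult_right_mono[OF F1, of "(1 + real d) * real p"] by simp
        finally show ?thesis using 1 \<open>p dvd r\<close> by (simp add: mult.assoc)
      next
        case 2
        have "\<not> (\<forall>i. int p dvd coeff P i)" using 2 pc by blast
        then have "card (roots_mod P (p\<^sup>2)) \<le> d * p" using card_roots_mod_prime_square[OF p, of P] P by simp
        then have "real (card (roots_mod P (p\<^sup>2))) \<le> real d * real p" by (metis of_nat_le_iff of_nat_mult)
        then have "root_density P p \<le> real d * real p / real (p\<^sup>2)"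
          unfolding root_density_def by (intro divide_right_mono) auto
        also have "\<dots> = real d / real p" using p1 by (simp add: power2_eq_square)
        finally have "root_density P p * real p powr (9 / 10) \<le> real d / real p * real p"
          using pm p1 by (intro mult_mono) auto
        then have "1 + root_density P p * real p powr (9 / 10) \<le> 1 * (1 + real d)" using p1 by simp
        also have "\<dots> \<le> (1 + real d * real p powr (- (11 / 10))) * (1 + real d)"
          using F1 by (intro mult_right_mono) auto
        finally show ?thesis using 2 by simp
      next
        case 3
        have "card (roots_mod P (p\<^sup>2)) \<le> d"
          using card_roots_mod_prime_square_separable[OF p, of P] R(3) pr 3 P by blast
        then have "root_density P p \<le> real d / real p ^ 2"
          unfolding root_density_def by (simp add: divide_right_mono)
        then have "root_density P p * real p powr (9 / 10) \<le> real d / real p powr 2 * real p powr (9 / 10)"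
          unfolding p2 by (rule mult_right_mono) simp
        also have "\<dots> = real d * real p powr (- (11 / 10))"
          using p1 by (simp add: powr_minus_divide[of _ "11/10"] field_simps flip: powr_add)
        finally show ?thesis using 3 by simp
      qed
    qed
    have bound: "\<bar>(\<Sum>A\<in>Pow (primes_upto n). (- 1) ^ card A * (\<Prod>p\<in>A. root_density P p)) - truncated_series L P\<bar>
       \<le> C * X powr \<eta> * real_of_int (content P) * L powr (- 9 / 10)" if n: "L \<le> real n" for n
    proof -
      let ?S = "primes_upto n"
      have S: "finite ?S" "0 \<notin> ?S" by (auto simp: primes_upto_def)
      let ?t = "\<lambda>A. (- 1) ^ card A * (\<Prod>p\<in>A. root_density P p)"
      have "Pow ?S = {A. A \<subseteq> ?S \<and> real (\<Prod>A) \<le> L} \<union> {A. A \<subseteq> ?S \<and> L < real (\<Prod>A)}" by auto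
      moreover have "{A. A \<subseteq> ?S \<and> real (\<Prod>A) \<le> L} \<inter> {A. A \<subseteq> ?S \<and> L < real (\<Prod>A)} = {}" by auto
      ultimately have "(\<Sum>A\<in>Pow ?S. ?t A) = truncated_series L P + (\<Sum>A | A \<subseteq> ?S \<and> L < real (\<Prod>A). ?t A)"
        unfolding truncated_series_def prime_sets_eq[OF n]
        by (simp only:) (rule sum.union_disjoint, auto intro: finite_subset[of _ "Pow ?S"])
      then have "\<bar>(\<Sum>A\<in>Pow ?S. ?t A) - truncated_series L P\<bar> \<le> (\<Sum>A | A \<subseteq> ?S \<and> L < real (\<Prod>A). \<bar>?t A\<bar>)"
        by (simp add: sum_abs)
      also have "\<dots> = (\<Sum>A | A \<subseteq> ?S \<and> L < real (\<Prod>A). \<Prod>p\<in>A. root_density P p)"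
        using root_density_bounds by (intro sum.cong) (auto simp: abs_mult power_abs abs_prod)
      also have "\<dots> \<le> L powr (- (9 / 10)) * (\<Prod>p\<in>?S. 1 + root_density P p * real p powr (9 / 10))"
        by (rule rankin_bound) (use S L root_density_bounds in auto)
      also have "\<dots> \<le> L powr (- (9 / 10)) * (K * (C1 * ((2 * real d) powr \<eta> * X powr \<eta>)) * real c)"
      proof (rule mult_left_mono)
        have "(\<Prod>p\<in>?S. 1 + root_density P p * real p powr (9 / 10)) \<le>
          (\<Prod>p\<in>?S. (1 + real d * real p powr (- (11 / 10))) * (if p dvd r then 1 + real d else 1) * (if p dvd c then real p else 1))"
          using factor root_density_bounds prime_primes_upto by (intro prod_mono conjI add_nonneg_nonneg mult_nonneg_nonneg) auto
        also have "\<dots> = (\<Prod>p\<in>?S. 1 + real d * real p powr (- (11 / 10))) *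
            (\<Prod>p\<in>?S. if p dvd r then 1 + real d else 1) * (\<Prod>p\<in>?S. if p dvd c then real p else 1)"
          by (simp add: prod.distrib)
        also have "\<dots> \<le> K * (C1 * ((2 * real d) powr \<eta> * X powr \<eta>)) * real c"
        proof (intro mult_mono)
          show "(\<Prod>p\<in>?S. 1 + real d * real p powr (- (11 / 10))) \<le> K" by (rule K(2)[OF S])
          show "(\<Prod>p\<in>?S. if p dvd c then real p else 1) \<le> real c"
            by (rule prod_prime_divisors_le) (use c S prime_primes_upto in auto)
          have "(\<Prod>p\<in>?S. if p dvd r then 1 + real d else 1) = (\<Prod>p\<in>{p\<in>?S. p dvd r}. 1 + real d)"
            using S by (subst prod.inter_filter) auto
          also have "\<dots> = (1 + real d) ^ card {p\<in>?S. p dvd r}" by simp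
          also have "\<dots> \<le> (1 + real d) ^ card (prime_factors r)"
            using r by (intro power_increasing card_mono) (auto simp: prime_primes_upto in_prime_factors_iff)
          also have "\<dots> \<le> C1 * real r powr (\<eta> / E)" by (rule C1(2)[OF r(1)])
          also have "\<dots> \<le> C1 * ((2 * (real d * X)) ^ E) powr (\<eta> / E)"
            using C1 r R(2) \<eta> E by (intro mult_left_mono powr_mono2) auto
          also have "((2 * (real d * X)) ^ E) powr (\<eta> / E) = (2 * real d * X) powr \<eta>"
          proof -
            have "2 * (real d * X) > 0" using dX by linarith
            then have "((2 * (real d * X)) ^ E) powr (\<eta> / E) = (2 * (real d * X)) powr (real E * (\<eta> / E))"
              by (simp only: powr_realpow[symmetric] powr_powr)
            then show ?thesis using E by (simp add: mult.assoc)
          qed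
          also have "\<dots> = (2 * real d) powr \<eta> * X powr \<eta>" using X by (simp add: powr_mult)
          finally show "(\<Prod>p\<in>?S. if p dvd r then 1 + real d else 1) \<le> C1 * ((2 * real d) powr \<eta> * X powr \<eta>)" .
        qed (use K(1) C1(1) in \<open>auto intro!: prod_nonneg mult_nonneg_nonneg\<close>)
        finally show "(\<Prod>p\<in>?S. 1 + root_density P p * real p powr (9 / 10)) \<le> K * (C1 * ((2 * real d) powr \<eta> * X powr \<eta>)) * real c" .
      qed simp
      finally show ?thesis by (simp add: C_def c(2) mult_ac)
    qed
    have "(\<lambda>n. \<bar>(\<Sum>A\<in>Pow (primes_upto n). (- 1) ^ card A * (\<Prod>p\<in>A. root_density P p)) - truncated_series L P\<bar>)
       \<longlonglongrightarrow> \<bar>singular_series P - truncated_series L P\<bar>"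
      using singular_series_LIMSEQ[of P] unfolding singular_partial_product by (intro tendsto_intros)
    then show "\<bar>singular_series P - truncated_series L P\<bar> \<le> C * X powr \<eta> * real_of_int (content P) * L powr (- 9 / 10)"
    proof (rule LIMSEQ_le_const2)
      obtain N :: nat where "L \<le> real N" using real_arch_simple by blast
      then show "\<exists>N. \<forall>n\<ge>N. \<bar>(\<Sum>A\<in>Pow (primes_upto n). (- 1) ^ card A * (\<Prod>p\<in>A. root_density P p)) - truncated_series L P\<bar>
        \<le> C * X powr \<eta> * real_of_int (content P) * L powr (- 9 / 10)"
        using bound by (intro exI[of _ N] allI impI) (meson of_nat_le_iff order_trans)
    qed
  qed
qed

section \<open>Counting polynomials in a box\<close>

definition height_box :: "nat \<Rightarrow> nat \<Rightarrow> int poly set" where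
  "height_box d N = {P. degree P = d \<and> (\<forall>i. \<bar>coeff P i\<bar> \<le> int N)}"

lemma height_set_eq_box:
  assumes "H \<ge> 0"
  shows "{P. degree P = d \<and> real_of_int (height P) \<le> H} = height_box d (nat \<lfloor>H\<rfloor>)"
proof -
  have "real_of_int (height P) \<le> H \<longleftrightarrow> (\<forall>i. \<bar>coeff P i\<bar> \<le> int (nat \<lfloor>H\<rfloor>))" for P
  proof -
    have "real_of_int (height P) \<le> H \<longleftrightarrow> height P \<le> \<lfloor>H\<rfloor>" by (simp add: le_floor_iff)
    also have "\<dots> \<longleftrightarrow> (\<forall>i\<le>degree P. \<bar>coeff P i\<bar> \<le> \<lfloor>H\<rfloor>)"
      unfolding height_def by (subst Max_le_iff) auto
    also have "\<dots> \<longleftrightarrow> (\<forall>i. \<bar>coeff P i\<bar> \<le> \<lfloor>H\<rfloor>)"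
      using assms by (metis abs_0 coeff_eq_0 not_le zero_le_floor)
    finally show ?thesis using assms by simp
  qed
  then show ?thesis by (auto simp: height_box_def)
qed

lemma finite_box [simp]: "finite (height_box d N)"
proof -
  have "height_box d N \<subseteq> Poly ` {xs. set xs \<subseteq> {- int N..int N} \<and> length xs \<le> Suc d}"
  proof
    fix P assume P: "P \<in> height_box d N"
    have "x \<in> {- int N..int N}" if "x \<in> set (coeffs P)" for x
    proof -
      have "x \<in> range (coeff P)" using that by (simp add: range_coeff)
      then show ?thesis using P by (auto simp: height_box_def abs_le_iff minus_le_iff)
    qed
    moreover have "length (coeffs P) \<le> Suc d"
      using P by (cases "P = 0") (auto simp: length_coeffs_degree height_box_def)
    ultimately show "P \<in> Poly ` {xs. set xs \<subseteq> {- int N..int N} \<and> length xs \<le> Suc d}"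
      by (intro image_eqI[of _ _ "coeffs P"]) auto
  qed
  then show ?thesis by (rule finite_subset) (intro finite_imageI finite_lists_length_le, simp)
qed

lemma boxD:
  assumes "P \<in> height_box d N"
  shows "degree P = d" "\<bar>coeff P i\<bar> \<le> int N"
  using assms by (auto simp: height_box_def)

lemma box_nonzero: "d \<ge> 1 \<Longrightarrow> P \<in> height_box d N \<Longrightarrow> P \<noteq> 0"
  by (auto simp: height_box_def)

text \<open>With the other coefficients fixed, conditions on values of \<open>P\<close> become
  conditions on the constant coefficient alone. The assumption \<open>d >= 1\<close> excludes the
  zero polynomial, whose degree is 0.\<close>

lemma box_Suc:
  assumes "d \<ge> 1"
  shows "height_box (Suc d) N = (\<lambda>(Q, c). pCons c Q) ` (height_box d N \<times> {- int N..int N})"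
proof (intro equalityI subsetI)
  fix P assume P: "P \<in> height_box (Suc d) N"
  obtain c Q where cQ: "P = pCons c Q" by (rule pCons_cases)
  have "Q \<noteq> 0" using P assms cQ by (auto simp: height_box_def)
  then have "degree Q = d" using P cQ by (simp add: height_box_def)
  moreover have "\<bar>coeff Q i\<bar> \<le> int N" for i using boxD(2)[OF P, of "Suc i"] cQ by simp
  moreover have "\<bar>c\<bar> \<le> int N" using boxD(2)[OF P, of 0] cQ by simp
  ultimately have "(Q, c) \<in> height_box d N \<times> {- int N..int N}" by (auto simp: height_box_def)
  then show "P \<in> (\<lambda>(Q, c). pCons c Q) ` (height_box d N \<times> {- int N..int N})"
    using cQ by (intro image_eqI[of _ _ "(Q, c)"]) auto
next
  fix P assume "P \<in> (\<lambda>(Q, c). pCons c Q) ` (height_box d N \<times> {- int N..int N})"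
  then obtain Q c where Q: "Q \<in> height_box d N" "c \<in> {- int N..int N}" "P = pCons c Q" by auto
  then show "P \<in> height_box (Suc d) N"
    using box_nonzero[OF assms Q(1)] by (auto simp: height_box_def coeff_pCons split: nat.split)
qed

lemma sum_box_Suc:
  assumes "d \<ge> 1"
  shows "(\<Sum>P\<in>height_box (Suc d) N. f P) = (\<Sum>Q\<in>height_box d N. \<Sum>c\<in>{- int N..int N}. f (pCons c Q))"
proof -
  have "inj_on (\<lambda>(Q, c). pCons c Q) (height_box d N \<times> {- int N..int N})" by (auto simp: inj_on_def)
  then show ?thesis
    unfolding box_Suc[OF assms] by (simp add: sum.reindex sum.cartesian_product case_prod_unfold)
qed

lemma card_symmetric_interval: "card {- int N..int N} = 2 * N + 1"
  by (subst card_atLeastAtMost_int) linarith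

lemma card_box_Suc:
  assumes "d \<ge> 1"
  shows "card (height_box (Suc d) N) = (2 * N + 1) * card (height_box d N)"
proof -
  have "inj_on (\<lambda>(Q, c). pCons c Q) (height_box d N \<times> {- int N..int N})" by (auto simp: inj_on_def)
  then have "card (height_box (Suc d) N) = card (height_box d N \<times> {- int N..int N})"
    unfolding box_Suc[OF assms] by (rule card_image)
  then show ?thesis by (simp only: card_cartesian_product card_symmetric_interval mult.commute)
qed

lemma card_box_1: "card (height_box 1 N) = 2 * N * (2 * N + 1)"
proof -
  have "height_box 1 N = (\<lambda>(c, b). [:c, b:]) ` ({- int N..int N} \<times> ({- int N..int N} - {0}))"
  proof (intro equalityI subsetI)
    fix P assume P: "P \<in> height_box 1 N"
    obtain c Q where cQ: "P = pCons c Q" by (rule pCons_cases)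
    then have "Q \<noteq> 0" using P by (auto simp: height_box_def)
    then have "degree Q = 0" using P cQ by (simp add: height_box_def)
    then obtain b where b: "Q = [:b:]" by (rule degree_eq_zeroE)
    have "\<bar>b\<bar> \<le> int N" "\<bar>c\<bar> \<le> int N" using boxD(2)[OF P, of 1] boxD(2)[OF P, of 0] cQ b by auto
    then show "P \<in> (\<lambda>(c, b). [:c, b:]) ` ({- int N..int N} \<times> ({- int N..int N} - {0}))"
      using cQ b \<open>Q \<noteq> 0\<close> by (intro image_eqI[of _ _ "(c, b)"]) auto
  qed (auto simp: height_box_def coeff_pCons split: nat.split)
  moreover have "inj_on (\<lambda>(c, b). [:c, b:]) ({- int N..int N} \<times> ({- int N..int N} - {0}))"
    by (auto simp: inj_on_def)
  ultimately have "card (height_box 1 N) = card ({- int N..int N} \<times> ({- int N..int N} - {0}))"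
    by (simp only: card_image)
  then show ?thesis
    by (simp only: card_cartesian_product card_symmetric_interval) (subst card_Diff_singleton, auto simp: card_symmetric_interval simp del: card_atLeastAtMost_int)
qed

lemma card_box:
  assumes "d \<ge> 1"
  shows "card (height_box d N) = 2 * N * (2 * N + 1) ^ d"
  using assms
proof (induction d rule: dec_induct)
  case base
  then show ?case by (simp only: card_box_1 power_one_right)
next
  case (step d)
  then show ?case using card_box_Suc[of d N] by (simp add: algebra_simps)
qed

section \<open>Joint distribution of two values\<close>

lemma card_congruence_interval:
  fixes a b r q :: int
  assumes q: "q > 0" and ab: "a \<le> b"
  shows "\<bar>real (card {c \<in> {a..<b}. q dvd c - r}) - real_of_int (b - a) / real_of_int q\<bar> \<le> 1"
proof -
  define f where "f z = \<lceil>real_of_int (z - r) / real_of_int q\<rceil>" for z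
  have f: "f z \<le> k \<longleftrightarrow> z \<le> r + q * k" for z k
  proof -
    have "f z \<le> k \<longleftrightarrow> real_of_int (z - r) / real_of_int q \<le> real_of_int k"
      unfolding f_def by (rule ceiling_le_iff)
    also have "\<dots> \<longleftrightarrow> real_of_int (z - r) \<le> real_of_int (k * q)" using q by (simp add: pos_divide_le_eq)
    also have "\<dots> \<longleftrightarrow> z - r \<le> k * q" by (rule of_int_le_iff)
    also have "\<dots> \<longleftrightarrow> z \<le> r + q * k" by (simp add: diff_le_eq mult.commute add.commute)
    finally show ?thesis .
  qed
  have "{c \<in> {a..<b}. q dvd c - r} = (\<lambda>k. r + q * k) ` {f a..<f b}"
  proof (intro equalityI subsetI)
    fix c assume c: "c \<in> {c \<in> {a..<b}. q dvd c - r}"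
    then obtain k where "c - r = q * k" by auto
    then have k: "c = r + q * k" by simp
    then have "f a \<le> k" "\<not> f b \<le> k" using c f[of a k] f[of b k] by auto
    then show "c \<in> (\<lambda>k. r + q * k) ` {f a..<f b}" using k by auto
  next
    fix c assume "c \<in> (\<lambda>k. r + q * k) ` {f a..<f b}"
    then obtain k where k: "c = r + q * k" "k \<in> {f a..<f b}" by (rule imageE)
    then have "a \<le> c" "\<not> b \<le> c" using f[of a k] f[of b k] by auto
    then show "c \<in> {c \<in> {a..<b}. q dvd c - r}" using k by auto
  qed
  moreover have "inj_on (\<lambda>k. r + q * k) {f a..<f b}" using q by (auto simp: inj_on_def)
  ultimately have card: "card {c \<in> {a..<b}. q dvd c - r} = nat (f b - f a)" by (simp add: card_image)
  have "real_of_int (a - r) / real_of_int q \<le> real_of_int (b - r) / real_of_int q"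
    using ab q by (intro divide_right_mono) auto
  then have "f a \<le> f b" unfolding f_def by (rule ceiling_mono)
  then have "real (card {c \<in> {a..<b}. q dvd c - r}) = real_of_int (f b) - real_of_int (f a)" using card by simp
  moreover have "real_of_int (b - a) / real_of_int q = real_of_int (b - r) / real_of_int q - real_of_int (a - r) / real_of_int q"
    by (simp add: diff_divide_distrib)
  ultimately show ?thesis unfolding f_def by linarith
qed

lemma card_congruence_box:
  assumes "q > 0"
  shows "\<bar>real (card {c \<in> {- int N..int N}. q dvd c - r}) - real (2 * N + 1) / real_of_int q\<bar> \<le> 1"
proof -
  have "{- int N..int N} = {- int N..<int N + 1}" by auto
  then show ?thesis using card_congruence_interval[OF assms, of "- int N" "int N + 1" r] by (simp add: algebra_simps)
qed

lemma linear_congruence: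
  fixes G \<delta> w :: int
  assumes "coprime \<delta> G"
  obtains r where "\<And>c. G dvd \<delta> * c + w \<longleftrightarrow> G dvd c - r"
proof -
  obtain i where i: "[\<delta> * i = 1] (mod G)" using cong_solve_coprime_int[OF assms] by blast
  have "G dvd \<delta> * c + w \<longleftrightarrow> G dvd c - (- (i * w))" for c
  proof -
    have 1: "G dvd 1 - \<delta> * i" using i by (metis cong_iff_dvd_diff cong_sym)
    have "\<delta> * (c + i * w) = \<delta> * c + w - (1 - \<delta> * i) * w" by (simp add: algebra_simps)
    then have "G dvd \<delta> * (c + i * w) \<longleftrightarrow> G dvd \<delta> * c + w"
      using 1 by (metis diff_add_cancel dvd_add_left_iff dvd_mult2)
    moreover have "G dvd \<delta> * (c + i * w) \<longleftrightarrow> G dvd c + i * w"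
      using assms by (simp add: coprime_commute coprime_dvd_mult_right_iff)
    ultimately show ?thesis by simp
  qed
  then show ?thesis by (rule that)
qed

lemma diff_dvd_poly_diff:
  fixes Q :: "int poly"
  shows "(u - t) dvd poly Q u - poly Q t"
proof -
  have "[u = t] (mod (u - t))" by (simp add: cong_iff_dvd_diff)
  then show ?thesis using poly_cong[of u t "u - t" Q] by (simp add: cong_iff_dvd_diff)
qed

text \<open>For fixed \<open>c1\<close> the two conditions on \<open>c0\<close> are either
  incompatible or a single class modulo \<open>lcm m n\<close>. Compatibility is a linear congruence
  for \<open>c1\<close> modulo \<open>G div gcd (u - t) G\<close>, where \<open>G = gcd m n\<close>.
  Each \<open>c1\<close> costs an error 1, and the count of compatible \<open>c1\<close> an error 1
  times at most \<open>M\<close>. The diagonal \<open>t = u\<close> is included, with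
  \<open>gcd (u - t) G = G\<close>.\<close>

lemma card_pairs_two_congruences:
  fixes t u m n :: int
  assumes mn: "m > 0" "n > 0"
  shows "\<bar>(\<Sum>c1\<in>{- int N..int N}. real (card {c0 \<in> {- int N..int N}. m dvd c0 + t * (c1 + t * poly Q t) \<and> n dvd c0 + u * (c1 + u * poly Q u)}))
     - real (2 * N + 1) ^ 2 * real_of_int (gcd (u - t) (gcd m n)) / (real_of_int m * real_of_int n)\<bar> \<le> 2 * real (2 * N + 1)"
proof -
  define M where "M = real (2 * N + 1)"
  let ?I = "{- int N..int N}"
  define \<alpha> where "\<alpha> c1 = t * (c1 + t * poly Q t)" for c1
  define \<beta> where "\<beta> c1 = u * (c1 + u * poly Q u)" for c1
  define G where "G = gcd m n"
  define l where "l = lcm m n"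
  define e where "e = gcd (u - t) G"
  have G: "G > 0" and l: "l > 0" "l \<ge> 1" using mn by (simp_all add: G_def l_def lcm_pos_int) (smt (verit) lcm_pos_int mn)?
  have e: "e > 0" using G by (simp add: e_def)
  have Gl: "real_of_int G * real_of_int l = real_of_int m * real_of_int n"
    using mn prod_gcd_lcm_int[of m n] by (simp add: G_def l_def flip: of_int_mult)
  define K where "K = {c1 \<in> ?I. G dvd \<beta> c1 - \<alpha> c1}"
  have inner: "\<bar>real (card {c0 \<in> ?I. m dvd c0 + \<alpha> c1 \<and> n dvd c0 + \<beta> c1}) - (if c1 \<in> K then M / real_of_int l else 0)\<bar> \<le> 1"
    if c1: "c1 \<in> ?I" for c1
  proof (cases "G dvd \<beta> c1 - \<alpha> c1")
    case True
    have "\<exists>c. m dvd c + \<alpha> c1 \<and> n dvd c + \<beta> c1"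
    proof -
      obtain x y where xy: "x * m + y * n = G" unfolding G_def using bezout_int[of m n] by blast
      obtain k where k: "\<beta> c1 - \<alpha> c1 = G * k" using True by auto
      have "\<beta> c1 = \<alpha> c1 + (x * m + y * n) * k" using k xy by simp
      then have "- \<alpha> c1 - x * k * m + \<beta> c1 = y * k * n" by (simp add: algebra_simps)
      then have "n dvd (- \<alpha> c1 - x * k * m) + \<beta> c1" by simp
      moreover have "m dvd (- \<alpha> c1 - x * k * m) + \<alpha> c1" by simp
      ultimately show ?thesis by blast
    qed
    then obtain c where c: "m dvd c + \<alpha> c1" "n dvd c + \<beta> c1" by blast
    have "m dvd c0 + \<alpha> c1 \<and> n dvd c0 + \<beta> c1 \<longleftrightarrow> l dvd c0 - c" for c0
    proof -
      have "m dvd c0 + \<alpha> c1 \<longleftrightarrow> m dvd c0 - c" "n dvd c0 + \<beta> c1 \<longleftrightarrow> n dvd c0 - c"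
        using dvd_add_left_iff[OF c(1), of "c0 - c"] dvd_add_left_iff[OF c(2), of "c0 - c"] by simp_all
      then show ?thesis by (simp add: l_def)
    qed
    then have "{c0 \<in> ?I. m dvd c0 + \<alpha> c1 \<and> n dvd c0 + \<beta> c1} = {c0 \<in> ?I. l dvd c0 - c}" by simp
    then show ?thesis using card_congruence_box[OF l(1), of N c] True c1 by (simp add: K_def M_def)
  next
    case False
    have emp: "{c0 \<in> ?I. m dvd c0 + \<alpha> c1 \<and> n dvd c0 + \<beta> c1} = {}"
    proof -
      have False if "m dvd c0 + \<alpha> c1" "n dvd c0 + \<beta> c1" for c0
      proof -
        have "G dvd c0 + \<alpha> c1" "G dvd c0 + \<beta> c1" using that unfolding G_def by (meson dvd_trans gcd_dvd1 gcd_dvd2)+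
        then have "G dvd (c0 + \<beta> c1) - (c0 + \<alpha> c1)" by (intro dvd_diff)
        then show False using False by simp
      qed
      then show ?thesis by blast
    qed
    show ?thesis unfolding emp using False by (simp add: K_def)
  qed
  have Kcard: "\<bar>real (card K) - M * real_of_int e / real_of_int G\<bar> \<le> 1"
  proof -
    define \<delta> where "\<delta> = (u - t) div e"
    define G' where "G' = G div e"
    have ut: "u - t = e * \<delta>" and GG: "G = e * G'" unfolding \<delta>_def G'_def e_def by simp_all
    have G': "G' > 0" using G GG e by (simp add: zero_less_mult_iff)
    have "coprime \<delta> G'" unfolding \<delta>_def G'_def e_def using G by (intro div_gcd_coprime) auto
    define W where "W = u * (u * poly Q u) - t * (t * poly Q t)"
    \<comment> \<open>The higher coefficients contribute a difference of values of one polynomial at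
      \<open>u\<close> and \<open>t\<close>, so they never obstruct division of the congruence by
      \<open>e\<close>.\<close>
    have "(u - t) dvd W" using diff_dvd_poly_diff[of u t "pCons 0 (pCons 0 Q)"] by (simp add: W_def)
    then have "e dvd W" using ut by (metis dvd_mult_left)
    then obtain w where w: "W = e * w" by auto
    obtain r where r: "\<And>c. G' dvd \<delta> * c + w \<longleftrightarrow> G' dvd c - r"
      using linear_congruence[OF \<open>coprime \<delta> G'\<close>] by blast
    have "G dvd \<beta> c1 - \<alpha> c1 \<longleftrightarrow> G' dvd c1 - r" for c1
    proof -
      have "\<beta> c1 - \<alpha> c1 = (u - t) * c1 + W" by (simp add: \<alpha>_def \<beta>_def W_def algebra_simps)
      also have "\<dots> = e * (\<delta> * c1 + w)" by (simp add: ut w algebra_simps)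
      finally show ?thesis using e r by (simp add: GG)
    qed
    then have "K = {c1 \<in> ?I. G' dvd c1 - r}" by (simp add: K_def)
    moreover have "M * real_of_int e / real_of_int G = M / real_of_int G'" using e by (simp add: GG)
    ultimately show ?thesis using card_congruence_box[OF G', of N r] by (simp add: M_def)
  qed
  define T where "T = (\<Sum>c1\<in>?I. real (card {c0 \<in> ?I. m dvd c0 + \<alpha> c1 \<and> n dvd c0 + \<beta> c1}))"
  have "T - real (card K) * (M / real_of_int l) =
      (\<Sum>c1\<in>?I. real (card {c0 \<in> ?I. m dvd c0 + \<alpha> c1 \<and> n dvd c0 + \<beta> c1}) - (if c1 \<in> K then M / real_of_int l else 0))"
  proof -
    have "(\<Sum>c1\<in>?I. if c1 \<in> K then M / real_of_int l else 0) = (\<Sum>c1\<in>K. M / real_of_int l)"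
      by (rule sum.mono_neutral_cong_right) (auto simp: K_def)
    then show ?thesis by (simp add: T_def sum_subtractf)
  qed
  also have "\<bar>\<dots>\<bar> \<le> (\<Sum>c1\<in>?I. 1)" by (rule order_trans[OF sum_abs sum_mono]) (rule inner)
  also have "\<dots> = M" by (simp add: M_def)
  finally have 1: "\<bar>T - real (card K) * (M / real_of_int l)\<bar> \<le> M" .
  have "real (card K) * (M / real_of_int l) - M ^ 2 * real_of_int e / (real_of_int m * real_of_int n) =
      (real (card K) - M * real_of_int e / real_of_int G) * (M / real_of_int l)"
    unfolding Gl[symmetric] using G l by (simp add: field_simps power2_eq_square)
  also have "\<bar>\<dots>\<bar> \<le> 1 * M"
    unfolding abs_mult using Kcard l by (intro mult_mono) (auto simp: M_def divide_le_eq)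
  finally have 2: "\<bar>real (card K) * (M / real_of_int l) - M ^ 2 * real_of_int e / (real_of_int m * real_of_int n)\<bar> \<le> 1 * M" .
  have "\<bar>a - b\<bar> \<le> M \<Longrightarrow> \<bar>b - c\<bar> \<le> 1 * M \<Longrightarrow> \<bar>a - c\<bar> \<le> 2 * M" for a b c :: real by linarith
  from this[OF 1 2] show ?thesis by (simp add: T_def M_def e_def G_def \<alpha>_def \<beta>_def)
qed

lemma card_filter_eq_sum:
  assumes "finite A"
  shows "real (card {x \<in> A. \<phi> x}) = (\<Sum>x\<in>A. if \<phi> x then 1 else 0)"
  using assms by (simp add: sum.If_cases Int_def)

lemma card_filter_box_Suc:
  assumes "d \<ge> 1"
  shows "real (card {P \<in> height_box (Suc d) N. \<phi> P}) =
    (\<Sum>Q\<in>height_box d N. real (card {c \<in> {- int N..int N}. \<phi> (pCons c Q)}))"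
  by (simp only: card_filter_eq_sum[OF finite_box] sum_box_Suc[OF assms] card_filter_eq_sum[OF finite_atLeastAtMost_int])

lemma card_box_Suc_Suc:
  assumes "d \<ge> 1"
  shows "real (card (height_box (Suc (Suc d)) N)) = real (2 * N + 1) ^ 2 * real (card (height_box d N))"
  using assms card_box_Suc[of d N] card_box_Suc[of "Suc d" N] by (simp add: power2_eq_square algebra_simps)

lemma card_box_zero_value:
  assumes "d \<ge> 1"
  shows "real (card {P \<in> height_box (Suc d) N. poly P t = 0}) \<le> real (card (height_box d N))"
proof -
  have "card {c \<in> {- int N..int N}. poly (pCons c Q) t = 0} \<le> card {- (t * poly Q t)}" for Q
    by (rule card_mono) auto
  then have "(\<Sum>Q\<in>height_box d N. real (card {c \<in> {- int N..int N}. poly (pCons c Q) t = 0})) \<le> (\<Sum>Q\<in>height_box d N. 1)"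
    by (intro sum_mono) simp
  then show ?thesis unfolding card_filter_box_Suc[OF assms] by simp
qed

text \<open>A repeated root is a root of the derivative, which does not involve the constant
  coefficient. Each of its at most \<open>d\<close> complex roots determines at most one such
  coefficient.\<close>

lemma card_box_nonseparable:
  assumes d: "d \<ge> 1"
  shows "real (card {P \<in> height_box (Suc d) N. \<not> separable P}) \<le> real d * real (card (height_box d N))"
proof -
  have "card {c \<in> {- int N..int N}. \<not> separable (pCons c Q)} \<le> d" if Q: "Q \<in> height_box d N" for Q
  proof -
    have Q0: "Q \<noteq> 0" "degree Q = d" using Q d by (auto simp: box_nonzero boxD)
    define D where "D = pderiv (pCons 0 Q)"
    have D: "pderiv (pCons c Q) = D" for c by (simp add: D_def pderiv_pCons)
    have degD: "degree D = d" using Q0 by (simp add: D_def degree_pderiv)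
    then have D0: "D \<noteq> 0" using d by auto
    have "card {c \<in> {- int N..int N}. \<not> separable (pCons c Q)} \<le> card ((\<lambda>z. - (z * cpoly Q z)) ` {z. cpoly D z = 0})"
    proof (rule card_inj_on_le)
      show "inj_on complex_of_int {c \<in> {- int N..int N}. \<not> separable (pCons c Q)}" by (simp add: inj_on_def)
      show "complex_of_int ` {c \<in> {- int N..int N}. \<not> separable (pCons c Q)} \<subseteq> (\<lambda>z. - (z * cpoly Q z)) ` {z. cpoly D z = 0}"
        by (auto simp: separable_def D eq_neg_iff_add_eq_0 image_iff)
      show "finite ((\<lambda>z. - (z * cpoly Q z)) ` {z. cpoly D z = 0})"
        using finite_cpoly_roots(1)[OF D0] by simp
    qed
    also have "\<dots> \<le> card {z. cpoly D z = 0}" by (rule card_image_le) (rule finite_cpoly_roots(1)[OF D0])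
    also have "\<dots> \<le> d" using finite_cpoly_roots(2)[OF D0] degD by simp
    finally show ?thesis .
  qed
  then have "(\<Sum>Q\<in>height_box d N. real (card {c \<in> {- int N..int N}. \<not> separable (pCons c Q)})) \<le> (\<Sum>Q\<in>height_box d N. real d)"
    by (intro sum_mono) simp
  then show ?thesis unfolding card_filter_box_Suc[OF d] by (simp add: mult.commute)
qed

lemma card_box_two_divisors:
  assumes d: "d \<ge> 1" and mn: "m > 0" "n > 0"
  shows "\<bar>real (card {P \<in> height_box (Suc (Suc d)) N. m dvd poly P t \<and> n dvd poly P u}) -
     real (card (height_box (Suc (Suc d)) N)) * real_of_int (gcd (u - t) (gcd m n)) / (real_of_int m * real_of_int n)\<bar>
    \<le> 2 * real (card (height_box (Suc (Suc d)) N)) / real (2 * N + 1)"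
proof -
  let ?I = "{- int N..int N}"
  let ?M = "real (2 * N + 1)"
  let ?r = "real_of_int (gcd (u - t) (gcd m n)) / (real_of_int m * real_of_int n)"
  let ?T = "\<lambda>Q. \<Sum>c1\<in>?I. real (card {c0 \<in> ?I. m dvd c0 + t * (c1 + t * poly Q t) \<and> n dvd c0 + u * (c1 + u * poly Q u)})"
  have "real (card {P \<in> height_box (Suc (Suc d)) N. m dvd poly P t \<and> n dvd poly P u}) = (\<Sum>Q\<in>height_box d N. ?T Q)"
    using d by (simp add: card_filter_box_Suc sum_box_Suc)
  then have "real (card {P \<in> height_box (Suc (Suc d)) N. m dvd poly P t \<and> n dvd poly P u}) -
      real (card (height_box (Suc (Suc d)) N)) * ?r = (\<Sum>Q\<in>height_box d N. ?T Q - ?M ^ 2 * ?r)"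
    unfolding card_box_Suc_Suc[OF d] by (simp add: sum_subtractf mult_ac)
  also have "\<bar>\<dots>\<bar> \<le> (\<Sum>Q\<in>height_box d N. 2 * ?M)"
    by (rule order_trans[OF sum_abs sum_mono])
      (use card_pairs_two_congruences[OF mn] in \<open>simp only: times_divide_eq_right\<close>)
  also have "\<dots> = 2 * real (card (height_box (Suc (Suc d)) N)) / ?M"
    unfolding card_box_Suc_Suc[OF d] by (simp add: power2_eq_square)
  finally show ?thesis by simp
qed

text \<open>Dividing by \<open>c\<close> maps the polynomials with content divisible by
  \<open>c\<close> into a box of height \<open>N div c\<close>, a proportion of about
  \<open>c^(- d - 1) <= c^(-4)\<close>; this leaves a convergent sum even after weighting by
  \<open>c^2\<close>. The factor \<open>(3 / 2) ^ d\<close> comes from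
  \<open>2 * K + 1 <= 3 * K\<close>.\<close>

lemma sum_content_square:
  assumes d: "d \<ge> 3" and N: "N \<ge> 1"
  shows "(\<Sum>P\<in>height_box d N. (real_of_int (content P))\<^sup>2) \<le> (3 / 2) ^ d * (\<Sum>b. 1 / (real (Suc b))\<^sup>2) * real (card (height_box d N))"
proof -
  have card_le: "real (card {P \<in> height_box d N. int c dvd content P}) \<le> (3 / 2) ^ d * real (card (height_box d N)) / real c ^ 4"
    if c: "c \<in> {1..N}" for c
  proof -
    define K where "K = N div c"
    have K: "K \<ge> 1" using c by (simp add: K_def Suc_le_eq div_greater_zero_iff)
    have "{P \<in> height_box d N. int c dvd content P} \<subseteq> smult (int c) ` height_box d K"
    proof
      fix P assume P: "P \<in> {P \<in> height_box d N. int c dvd content P}"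
      then have "[:int c:] dvd P" by (simp add: const_poly_dvd_iff_dvd_content)
      then obtain Q where Q: "P = smult (int c) Q" by (auto elim: dvdE)
      have "\<bar>coeff Q i\<bar> \<le> int K" for i
      proof -
        have "int c * \<bar>coeff Q i\<bar> \<le> int N" using boxD(2)[of P d N i] P Q by (simp add: abs_mult)
        then have "(int c * \<bar>coeff Q i\<bar>) div int c \<le> int N div int c" using c by (intro zdiv_mono1) auto
        then have "\<bar>coeff Q i\<bar> \<le> int N div int c" using c by simp
        then show ?thesis by (simp add: K_def zdiv_int)
      qed
      moreover have "degree Q = d" using boxD(1)[of P d N] P Q c by simp
      ultimately show "P \<in> smult (int c) ` height_box d K" using Q by (auto simp: height_box_def)
    qed
    then have "card {P \<in> height_box d N. int c dvd content P} \<le> card (height_box d K)"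
      by (meson card_image_le card_mono finite_box finite_imageI order_trans)
    then have "real (card {P \<in> height_box d N. int c dvd content P}) \<le> real (2 * K * (2 * K + 1) ^ d)"
      using d by (simp add: card_box del: of_nat_mult of_nat_power)
    also have "\<dots> = 2 * real K * (2 * real K + 1) ^ d" by (simp add: add.commute)
    also have "\<dots> \<le> 2 * real K * (3 * real K) ^ d" using K by (intro mult_left_mono power_mono) auto
    also have "\<dots> \<le> 2 * (real N / real c) * (3 * (real N / real c)) ^ d"
    proof -
      have "K * c \<le> N" unfolding K_def by (rule div_times_less_eq_dividend)
      then have "real K * real c \<le> real N" by (metis of_nat_le_iff of_nat_mult)
      then have "real K \<le> real N / real c" using c by (simp add: pos_le_divide_eq)
      then show ?thesis by (intro mult_mono power_mono) auto
    qed
    also have "\<dots> = (3 / 2) ^ d * (2 * real N * (2 * real N) ^ d) / real c ^ Suc d"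
      by (simp add: power_mult_distrib power_divide field_simps)
    also have "\<dots> \<le> (3 / 2) ^ d * real (card (height_box d N)) / real c ^ 4"
    proof (intro frac_le mult_left_mono)
      have "2 * real N * (2 * real N) ^ d \<le> 2 * real N * (2 * real N + 1) ^ d"
        by (intro mult_left_mono power_mono) auto
      then show "2 * real N * (2 * real N) ^ d \<le> real (card (height_box d N))" using d by (simp add: card_box add.commute)
      show "real c ^ 4 \<le> real c ^ Suc d" using c d by (intro power_increasing) auto
    qed (use c in auto)
    finally show ?thesis .
  qed
  have "(\<Sum>P\<in>height_box d N. (real_of_int (content P))\<^sup>2) \<le>
      (\<Sum>P\<in>height_box d N. \<Sum>c\<in>{1..N}. (real c)\<^sup>2 * (if int c dvd content P then 1 else 0))"
  proof (rule sum_mono)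
    fix P assume P: "P \<in> height_box d N"
    have P0: "P \<noteq> 0" using box_nonzero[OF _ P] d by simp
    have pos: "content P > 0" using P0 content_eq_zero_iff[of P] normalize_content[of P] by (simp add: less_le)
    have "content P dvd lead_coeff P" by simp
    then have "\<bar>content P\<bar> \<le> \<bar>lead_coeff P\<bar>" using P0 by (intro dvd_imp_le_int) auto
    then have "content P \<le> int N" using boxD(2)[OF P] pos by (meson abs_le_D1 order_trans)
    define c where "c = nat (content P)"
    have c: "c \<in> {1..N}" "int c = content P" using pos \<open>content P \<le> int N\<close> by (auto simp: c_def)
    have "(real_of_int (content P))\<^sup>2 = (real c)\<^sup>2 * (if int c dvd content P then 1 else 0)" by (simp flip: c(2))
    also have "\<dots> \<le> (\<Sum>c\<in>{1..N}. (real c)\<^sup>2 * (if int c dvd content P then 1 else 0))"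
      by (rule member_le_sum[OF c(1)]) auto
    finally show "(real_of_int (content P))\<^sup>2 \<le> (\<Sum>c\<in>{1..N}. (real c)\<^sup>2 * (if int c dvd content P then 1 else 0))" .
  qed
  also have "\<dots> = (\<Sum>c\<in>{1..N}. (real c)\<^sup>2 * real (card {P \<in> height_box d N. int c dvd content P}))"
    by (subst sum.swap) (simp only: card_filter_eq_sum[OF finite_box] sum_distrib_left)
  also have "\<dots> \<le> (\<Sum>c\<in>{1..N}. (3 / 2) ^ d * real (card (height_box d N)) * (1 / (real c)\<^sup>2))"
  proof (rule sum_mono)
    fix c assume c: "c \<in> {1..N}"
    have "(real c)\<^sup>2 * real (card {P \<in> height_box d N. int c dvd content P}) \<le>
        (real c)\<^sup>2 * ((3 / 2) ^ d * real (card (height_box d N)) / real c ^ 4)"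
      by (intro mult_left_mono card_le c) simp
    also have "\<dots> = (3 / 2) ^ d * real (card (height_box d N)) * (1 / (real c)\<^sup>2)"
      using c by (simp add: power2_eq_square power4_eq_xxxx)
    finally show "(real c)\<^sup>2 * real (card {P \<in> height_box d N. int c dvd content P}) \<le>
        (3 / 2) ^ d * real (card (height_box d N)) * (1 / (real c)\<^sup>2)" .
  qed
  also have "\<dots> = (3 / 2) ^ d * real (card (height_box d N)) * (\<Sum>c\<in>{1..N}. 1 / (real c)\<^sup>2)"
    by (simp only: sum_distrib_left)
  also have "(\<Sum>c\<in>{1..N}. 1 / (real c)\<^sup>2) = (\<Sum>b<N. 1 / (real (Suc b))\<^sup>2)"
    using sum.shift_bounds_Suc_ivl[of "\<lambda>c. 1 / (real c)\<^sup>2" 0 N] by (simp add: lessThan_atLeast0 atLeastLessThanSuc_atLeastAtMost)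
  also have "(3 / 2) ^ d * real (card (height_box d N)) * \<dots> \<le>
      (3 / 2) ^ d * real (card (height_box d N)) * (\<Sum>b. 1 / (real (Suc b))\<^sup>2)"
    by (intro mult_left_mono sum_le_suminf summable_inverse_squares) auto
  finally show ?thesis by (simp add: mult_ac)
qed

text \<open>The pairs are reparametrised by \<open>w = c0 + n * c1\<close> and \<open>c0\<close>.
  There are at most about \<open>2 * M * n / a^2 + 1\<close> values of \<open>w\<close> in the
  required class, and \<open>c0\<close> is then fixed modulo \<open>n\<close>, leaving at most
  \<open>2 * M / n\<close> choices. Thus the rounding error is \<open>M / n\<close> instead of
  \<open>M\<close>, which matters since it is summed over many \<open>a\<close>.\<close>

lemma card_pairs_square_divisor:
  fixes s :: int
  assumes n: "1 \<le> n" "n \<le> 2 * N + 1" and a: "a \<ge> 1"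
  shows "(\<Sum>c1\<in>{- int N..int N}. real (card {c0 \<in> {- int N..int N}. int (a\<^sup>2) dvd c0 + int n * c1 + s}))
    \<le> 4 * real (2 * N + 1) ^ 2 / real a ^ 2 + 2 * real (2 * N + 1) / real n"
proof -
  let ?I = "{- int N..int N}"
  define M where "M = real (2 * N + 1)"
  define B where "B = int N * (int n + 1)"
  define W where "W = {w \<in> {- B..<B + 1}. int (a\<^sup>2) dvd w - (- s)}"
  have n0: "real n > 0" and nM: "real n \<le> M" using n by (auto simp: M_def)
  have a2: "real a ^ 2 > 0" using a by simp
  have B0: "B \<ge> 0" by (simp add: B_def)
  have W: "real (card W) \<le> 2 * M * real n / real a ^ 2 + 1"
  proof -
    have "real (card W) \<le> real_of_int (B + 1 - - B) / real_of_int (int (a\<^sup>2)) + 1"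
      using card_congruence_interval[of "int (a\<^sup>2)" "- B" "B + 1" "- s"] a B0 by (simp add: W_def)
    also have "real_of_int (B + 1 - - B) \<le> 2 * M * real n"
    proof -
      have "(2 * int N + 2) * 1 \<le> (2 * int N + 2) * int n" using n by (intro mult_left_mono) auto
      then have "2 * int N + 1 + (2 * int N * int n) \<le> (2 * int N + 2) * int n + 2 * int N * int n"
        by (simp add: algebra_simps)
      then have "B + 1 - - B \<le> 2 * (2 * int N + 1) * int n" by (simp add: B_def algebra_simps)
      then have "real_of_int (B + 1 - - B) \<le> real_of_int (2 * (2 * int N + 1) * int n)" by (simp only: of_int_le_iff)
      then show ?thesis by (simp add: M_def algebra_simps)
    qed
    finally show ?thesis by (simp add: divide_right_mono)
  qed
  have fibre: "real (card {c0 \<in> ?I. int n dvd c0 - w}) \<le> 2 * M / real n" for w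
  proof -
    have "real (card {c0 \<in> ?I. int n dvd c0 - w}) \<le> M / real n + 1"
      using card_congruence_box[of "int n" N w] n by (simp add: M_def)
    also have "1 \<le> M / real n" using n0 nM by simp
    finally show ?thesis by simp
  qed
  have finW: "finite W" by (rule finite_subset[of _ "{- B..<B + 1}"]) (auto simp: W_def)
  have fin: "finite {c \<in> ?I. \<phi> c}" for \<phi> by (rule finite_subset[of _ ?I]) auto
  have "(\<Sum>c1\<in>?I. real (card {c0 \<in> ?I. int (a\<^sup>2) dvd c0 + int n * c1 + s})) =
      real (card (SIGMA c1:?I. {c0 \<in> ?I. int (a\<^sup>2) dvd c0 + int n * c1 + s}))"
    by (simp only: card_SigmaI[OF finite_atLeastAtMost_int ballI[OF fin]] of_nat_sum)
  also have "\<dots> \<le> real (card (SIGMA w:W. {c0 \<in> ?I. int n dvd c0 - w}))"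
  proof -
    let ?g = "\<lambda>(c1, c0). (c0 + int n * c1, c0)"
    have "card (SIGMA c1:?I. {c0 \<in> ?I. int (a\<^sup>2) dvd c0 + int n * c1 + s}) \<le> card (SIGMA w:W. {c0 \<in> ?I. int n dvd c0 - w})"
    proof (rule card_inj_on_le)
      show "inj_on ?g (SIGMA c1:?I. {c0 \<in> ?I. int (a\<^sup>2) dvd c0 + int n * c1 + s})"
        using n by (auto simp: inj_on_def)
      show "?g ` (SIGMA c1:?I. {c0 \<in> ?I. int (a\<^sup>2) dvd c0 + int n * c1 + s}) \<subseteq> (SIGMA w:W. {c0 \<in> ?I. int n dvd c0 - w})"
      proof
        fix z assume "z \<in> ?g ` (SIGMA c1:?I. {c0 \<in> ?I. int (a\<^sup>2) dvd c0 + int n * c1 + s})"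
        then obtain y where y: "z = ?g y" "y \<in> (SIGMA c1:?I. {c0 \<in> ?I. int (a\<^sup>2) dvd c0 + int n * c1 + s})"
          by (rule imageE)
        obtain c1 c0 where cc: "y = (c1, c0)" by (cases y)
        have z: "z = (c0 + int n * c1, c0)"
          and c: "c1 \<in> ?I" "c0 \<in> ?I" "int (a\<^sup>2) dvd c0 + int n * c1 + s"
          using y unfolding cc by auto
        have "int n * c1 \<le> int n * int N" "int n * - int N \<le> int n * c1" using c by (intro mult_left_mono; simp)+
        then have "- B \<le> c0 + int n * c1" "c0 + int n * c1 < B + 1" using c by (auto simp: B_def algebra_simps)
        then show "z \<in> (SIGMA w:W. {c0 \<in> ?I. int n dvd c0 - w})" using c unfolding z by (auto simp: W_def)
      qed
      show "finite (SIGMA w:W. {c0 \<in> ?I. int n dvd c0 - w})" by (rule finite_SigmaI[OF finW fin])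
    qed
    then show ?thesis by (simp only: of_nat_le_iff)
  qed
  also have "\<dots> = (\<Sum>w\<in>W. real (card {c0 \<in> ?I. int n dvd c0 - w}))"
    by (simp only: card_SigmaI[OF finW ballI[OF fin]] of_nat_sum)
  also have "\<dots> \<le> (\<Sum>w\<in>W. 2 * M / real n)" by (intro sum_mono fibre)
  also have "\<dots> = real (card W) * (2 * M / real n)" by simp
  also have "\<dots> \<le> (2 * M * real n / real a ^ 2 + 1) * (2 * M / real n)"
    using W n0 by (intro mult_right_mono) (auto simp: M_def)
  also have "\<dots> = 4 * M ^ 2 / real a ^ 2 + 2 * M / real n"
    using n0 a2 by (simp add: field_simps power2_eq_square)
  finally show ?thesis by (simp add: M_def)
qed

lemma poly_box_bound:
  assumes P: "P \<in> height_box d N" and n: "n \<ge> 1"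
  shows "\<bar>real_of_int (poly P (int n))\<bar> \<le> real (Suc d) * real N * real n ^ d"
proof -
  have "\<bar>real_of_int (poly P (int n))\<bar> = \<bar>\<Sum>i\<le>d. real_of_int (coeff P i) * real n ^ i\<bar>"
    using boxD(1)[OF P] by (simp add: poly_altdef)
  also have "\<dots> \<le> (\<Sum>i\<le>d. \<bar>real_of_int (coeff P i) * real n ^ i\<bar>)" by (rule sum_abs)
  also have "\<dots> \<le> (\<Sum>i\<le>d. real N * real n ^ d)"
  proof (rule sum_mono)
    fix i assume i: "i \<in> {..d}"
    have "\<bar>real_of_int (coeff P i)\<bar> \<le> real N" using boxD(2)[OF P, of i] by linarith
    moreover have "real n ^ i \<le> real n ^ d" using i n by (intro power_increasing) auto
    ultimately show "\<bar>real_of_int (coeff P i) * real n ^ i\<bar> \<le> real N * real n ^ d"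
      unfolding abs_mult by (intro mult_mono) auto
  qed
  also have "\<dots> = real (Suc d) * real N * real n ^ d" by simp
  finally show ?thesis .
qed

lemma sum_inverse_squares_tail:
  assumes "L \<ge> 1" "finite A" "\<And>a. a \<in> A \<Longrightarrow> real a > L"
  shows "(\<Sum>a\<in>A. 1 / real a ^ 2) \<le> 2 / L"
proof -
  define m where "m = nat \<lfloor>L\<rfloor>"
  have m: "m \<ge> 1" "real m \<le> L" "L < real m + 1" using assms(1) unfolding m_def by linarith+
  define N where "N = Suc (m + Max (insert 0 A))"
  have AN: "A \<subseteq> {Suc m..<Suc N}"
  proof
    fix a assume a: "a \<in> A"
    have "a \<le> Max (insert 0 A)" using assms(2) a by (intro Max_ge) auto
    moreover have "real a > real m" using assms(3)[OF a] m by linarith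
    ultimately show "a \<in> {Suc m..<Suc N}" by (simp add: N_def)
  qed
  have "(\<Sum>a\<in>A. 1 / real a ^ 2) \<le> (\<Sum>a\<in>A. 1 / (real a - 1) - 1 / real a)"
  proof (rule sum_mono)
    fix a assume "a \<in> A"
    then have "real a > 1" using assms by force
    then show "1 / real a ^ 2 \<le> 1 / (real a - 1) - 1 / real a" by (simp add: field_simps power2_eq_square)
  qed
  also have "\<dots> \<le> (\<Sum>a\<in>{Suc m..<Suc N}. 1 / (real a - 1) - 1 / real a)"
    by (rule sum_mono2[OF _ AN]) (use m in \<open>auto simp: frac_le\<close>)
  also have "\<dots> = (\<Sum>a\<in>{m..<N}. 1 / real a - 1 / real (Suc a))"
    by (subst sum.shift_bounds_Suc_ivl) simp
  also have "\<dots> = 1 / m - 1 / N"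
    by (subst sum_Suc_diff'[of m N "\<lambda>m. - (1 / real m)", simplified, symmetric]) (auto simp: N_def)
  also have "\<dots> \<le> 1 / m" by simp
  also have "\<dots> \<le> 2 / L"
  proof -
    have "real m \<ge> 1" using m(1) by simp
    then have "L \<le> 2 * real m" using m(3) by linarith
    then show ?thesis using assms(1) \<open>real m \<ge> 1\<close> by (simp add: field_simps)
  qed
  finally show ?thesis .
qed

text \<open>A nonzero value is at most \<open>V\<close> in modulus, which limits \<open>a\<close> to
  \<open>sqrt V\<close>. Over \<open>L < a <= sqrt V\<close> the main terms of the pair count add up
  to a multiple of \<open>1 / L\<close>, while the rounding errors are counted \<open>sqrt V\<close>
  times.\<close>

lemma card_box_large_square_divisor:
  assumes d: "d \<ge> 1" and n: "1 \<le> n" "n \<le> 2 * N + 1" and L: "L \<ge> 1"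
  shows "real (card {P \<in> height_box (Suc (Suc d)) N. \<exists>a. real a > L \<and> int (a\<^sup>2) dvd poly P (int n) \<and> poly P (int n) \<noteq> 0})
    \<le> real (card (height_box (Suc (Suc d)) N)) *
      (8 / L + 2 * sqrt (real (d + 3) * real N * real n ^ (d + 2)) / (real n * real (2 * N + 1)))"
proof -
  let ?I = "{- int N..int N}"
  let ?B = "height_box (Suc (Suc d)) N"
  define M where "M = real (2 * N + 1)"
  have M: "M > 0" by (simp add: M_def)
  define V where "V = real (d + 3) * real N * real n ^ (d + 2)"
  have V: "V \<ge> 0" by (simp add: V_def)
  define A where "A = {a :: nat. real a > L \<and> real a \<le> sqrt V}"
  have "A \<subseteq> {1..nat \<lfloor>sqrt V\<rfloor>}" using L by (auto simp: A_def le_nat_floor)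
  then have finA: "finite A" and "card A \<le> nat \<lfloor>sqrt V\<rfloor>"
    using finite_subset card_mono[of "{1..nat \<lfloor>sqrt V\<rfloor>}" A] by auto
  then have "real (card A) \<le> real (nat \<lfloor>sqrt V\<rfloor>)" by simp
  also have "\<dots> \<le> sqrt V" using V by simp
  finally have cardA: "real (card A) \<le> sqrt V" .
  have "{P \<in> ?B. \<exists>a. real a > L \<and> int (a\<^sup>2) dvd poly P (int n) \<and> poly P (int n) \<noteq> 0} \<subseteq>
      (\<Union>a\<in>A. {P \<in> ?B. int (a\<^sup>2) dvd poly P (int n)})"
  proof clarify
    fix P a assume P: "P \<in> ?B" "real a > L" "int (a\<^sup>2) dvd poly P (int n)" "poly P (int n) \<noteq> 0"
    have "int (a\<^sup>2) \<le> \<bar>poly P (int n)\<bar>" using dvd_imp_le_int[OF P(4,3)] by simp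
    then have "real_of_int (int (a\<^sup>2)) \<le> real_of_int \<bar>poly P (int n)\<bar>" by (simp only: of_int_le_iff)
    also have "\<dots> \<le> V" using poly_box_bound[OF P(1) n(1)] by (simp add: V_def algebra_simps)
    finally have "real a \<le> sqrt V" by (intro real_le_rsqrt) simp
    then show "P \<in> (\<Union>a\<in>A. {P \<in> ?B. int (a\<^sup>2) dvd poly P (int n)})" using P by (auto simp: A_def)
  qed
  then have "card {P \<in> ?B. \<exists>a. real a > L \<and> int (a\<^sup>2) dvd poly P (int n) \<and> poly P (int n) \<noteq> 0} \<le>
      card (\<Union>a\<in>A. {P \<in> ?B. int (a\<^sup>2) dvd poly P (int n)})"
    using finA by (intro card_mono) auto
  also have "\<dots> \<le> (\<Sum>a\<in>A. card {P \<in> ?B. int (a\<^sup>2) dvd poly P (int n)})"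
    by (rule card_UN_le[OF finA])
  finally have "real (card {P \<in> ?B. \<exists>a. real a > L \<and> int (a\<^sup>2) dvd poly P (int n) \<and> poly P (int n) \<noteq> 0}) \<le>
      (\<Sum>a\<in>A. real (card {P \<in> ?B. int (a\<^sup>2) dvd poly P (int n)}))"
    by (simp only: of_nat_sum[symmetric] of_nat_le_iff)
  also have "\<dots> \<le> (\<Sum>a\<in>A. real (card (height_box d N)) * (4 * M ^ 2 / real a ^ 2 + 2 * M / real n))"
  proof (rule sum_mono)
    fix a assume "a \<in> A"
    then have a: "a \<ge> 1" using L by (auto simp: A_def)
    have "real (card {P \<in> ?B. int (a\<^sup>2) dvd poly P (int n)}) =
        (\<Sum>Q\<in>height_box d N. \<Sum>c1\<in>?I. real (card {c0 \<in> ?I. int (a\<^sup>2) dvd poly (pCons c0 (pCons c1 Q)) (int n)}))"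
      using d by (simp only: card_filter_box_Suc sum_box_Suc le_SucI)
    also have "\<dots> = (\<Sum>Q\<in>height_box d N. \<Sum>c1\<in>?I. real (card {c0 \<in> ?I. int (a\<^sup>2) dvd c0 + int n * c1 + (int n * (int n * poly Q (int n)))}))"
      by (simp only: poly_pCons distrib_left add.assoc)
    also have "\<dots> \<le> (\<Sum>Q\<in>height_box d N. 4 * M ^ 2 / real a ^ 2 + 2 * M / real n)"
      unfolding M_def by (intro sum_mono card_pairs_square_divisor n a)
    finally show "real (card {P \<in> ?B. int (a\<^sup>2) dvd poly P (int n)}) \<le> real (card (height_box d N)) * (4 * M ^ 2 / real a ^ 2 + 2 * M / real n)"
      by simp
  qed
  also have "\<dots> = real (card (height_box d N)) * (4 * M ^ 2 * (\<Sum>a\<in>A. 1 / real a ^ 2) + real (card A) * (2 * M / real n))"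
    by (simp add: sum.distrib sum_distrib_left algebra_simps)
  also have "\<dots> \<le> real (card (height_box d N)) * (4 * M ^ 2 * (2 / L) + sqrt V * (2 * M / real n))"
    using sum_inverse_squares_tail[OF L finA] cardA M
    by (intro mult_left_mono add_mono mult_right_mono) (auto simp: A_def)
  also have "\<dots> = real (card ?B) * (8 / L + 2 * sqrt V / (real n * M))"
    unfolding card_box_Suc_Suc[OF d] M_def[symmetric] using M L n by (simp add: field_simps power2_eq_square)
  finally show ?thesis by (simp add: V_def M_def)
qed

section \<open>Variance of the truncated error\<close>

text \<open>Indicator of the counted range minus its mean spread over one full period. A single
  weighted sum of a function of period \<open>q\<close> is then the centred count, which keeps the
  second moment a double sum over \<open>t\<close> and \<open>u\<close>.\<close>

definition weight :: "nat \<Rightarrow> nat \<Rightarrow> int \<Rightarrow> real" where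
  "weight x q t = (if t \<in> {1..int x} then 1 else 0) - (if t \<in> {0..<int q} then real x / real q else 0)"

lemma sum_weight:
  "(\<Sum>t\<in>{0..int (x + q)}. weight x q t * f t) =
    (\<Sum>t\<in>{1..int x}. f t) - real x / real q * (\<Sum>t\<in>{0..<int q}. f t)"
proof -
  have "(\<Sum>t\<in>{0..int (x + q)}. weight x q t * f t) =
     (\<Sum>t\<in>{0..int (x + q)}. if t \<in> {1..int x} then f t else 0) -
     (\<Sum>t\<in>{0..int (x + q)}. if t \<in> {0..<int q} then real x / real q * f t else 0)"
    unfolding sum_subtractf[symmetric] by (intro sum.cong refl) (auto simp: weight_def algebra_simps)
  also have "(\<Sum>t\<in>{0..int (x + q)}. if t \<in> {1..int x} then f t else 0) = (\<Sum>t\<in>{1..int x}. f t)"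
    by (rule sum.mono_neutral_cong_right) auto
  also have "(\<Sum>t\<in>{0..int (x + q)}. if t \<in> {0..<int q} then real x / real q * f t else 0) =
      (\<Sum>t\<in>{0..<int q}. real x / real q * f t)"
    by (rule sum.mono_neutral_cong_right) auto
  finally show ?thesis by (simp add: sum_distrib_left)
qed

lemma sum_abs_weight:
  assumes "q > 0"
  shows "(\<Sum>t\<in>{0..int (x + q)}. \<bar>weight x q t\<bar>) \<le> 2 * real x"
proof -
  have "(\<Sum>t\<in>{0..int (x + q)}. \<bar>weight x q t\<bar>) \<le>
     (\<Sum>t\<in>{0..int (x + q)}. if t \<in> {1..int x} then 1 else 0) +
     (\<Sum>t\<in>{0..int (x + q)}. if t \<in> {0..<int q} then real x / real q else 0)"
    unfolding sum.distrib[symmetric] by (intro sum_mono) (auto simp: weight_def abs_if)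
  also have "(\<Sum>t\<in>{0..int (x + q)}. if t \<in> {1..int x} then 1 else 0) = (\<Sum>t\<in>{1..int x}. 1 :: real)"
    by (rule sum.mono_neutral_cong_right) auto
  also have "(\<Sum>t\<in>{0..int (x + q)}. if t \<in> {0..<int q} then real x / real q else 0) =
      (\<Sum>t\<in>{0..<int q}. real x / real q)"
    by (rule sum.mono_neutral_cong_right) auto
  finally show ?thesis using assms by simp
qed

lemma card_residue_class:
  fixes t :: int and e q :: nat
  assumes e: "e > 0" "e dvd q"
  shows "card {u \<in> {0..<int q}. int e dvd u - t} = q div e"
proof -
  obtain k where k: "q = e * k" using e(2) by (rule dvdE)
  have "bij_betw (\<lambda>j. int e * j + t mod int e) {0..<int k} {u \<in> {0..<int q}. int e dvd u - t}"
  proof (rule bij_betwI[where g = "\<lambda>u. u div int e"])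
    show "(\<lambda>j. int e * j + t mod int e) \<in> {0..<int k} \<rightarrow> {u \<in> {0..<int q}. int e dvd u - t}"
    proof
      fix j assume j: "j \<in> {0..<int k}"
      have r: "0 \<le> t mod int e" "t mod int e < int e" using e by auto
      have "int e * (j + 1) \<le> int e * int k" using j by (intro mult_left_mono) auto
      then have "int e * j + t mod int e < int q" using r k by (simp add: algebra_simps)
      moreover have "int e * j + t mod int e \<ge> 0" using j r by simp
      moreover have "int e dvd (int e * j + t mod int e) - t"
      proof -
        have "(int e * j + t mod int e) - t = int e * (j - t div int e)"
          by (simp add: algebra_simps minus_mult_div_eq_mod[symmetric])
        then show ?thesis by simp
      qed
      ultimately show "int e * j + t mod int e \<in> {u \<in> {0..<int q}. int e dvd u - t}" by simp
    qed
    show "(\<lambda>u. u div int e) \<in> {u \<in> {0..<int q}. int e dvd u - t} \<rightarrow> {0..<int k}"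
    proof
      fix u assume u: "u \<in> {u \<in> {0..<int q}. int e dvd u - t}"
      have "int e * (u div int e) \<le> u" using mult_div_mod_eq[of "int e" u] pos_mod_sign[of "int e" u] e by linarith
      then have "int e * (u div int e) < int e * int k" using u k by simp
      then have "u div int e < int k" using e by simp
      then show "u div int e \<in> {0..<int k}" using u e by (simp add: pos_imp_zdiv_nonneg_iff)
    qed
    show "(int e * j + t mod int e) div int e = j" for j using e by simp
    show "int e * (u div int e) + t mod int e = u" if "u \<in> {u \<in> {0..<int q}. int e dvd u - t}" for u
    proof -
      have "u mod int e = t mod int e" using that by (simp add: mod_eq_dvd_iff)
      then show ?thesis using mult_div_mod_eq[of "int e" u] by simp
    qed
  qed
  then have "card {0..<int k} = card {u \<in> {0..<int q}. int e dvd u - t}" by (rule bij_betw_same_card)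
  then show ?thesis using k e by simp
qed

lemma card_congruent_to_next:
  fixes e x :: nat
  assumes e: "e > 0"
  shows "card {u \<in> {1..int x}. int e dvd u - int (Suc x)} = x div e"
proof -
  have "bij_betw (\<lambda>k. int (Suc x) - int e * k) {1..int (x div e)} {u \<in> {1..int x}. int e dvd u - int (Suc x)}"
  proof (rule bij_betw_imageI)
    show "inj_on (\<lambda>k. int (Suc x) - int e * k) {1..int (x div e)}" using e by (auto simp: inj_on_def)
    show "(\<lambda>k. int (Suc x) - int e * k) ` {1..int (x div e)} = {u \<in> {1..int x}. int e dvd u - int (Suc x)}"
    proof (intro equalityI subsetI)
      fix u assume "u \<in> (\<lambda>k. int (Suc x) - int e * k) ` {1..int (x div e)}"
      then obtain k where k: "k \<in> {1..int (x div e)}" "u = int (Suc x) - int e * k" by auto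
      have "int e * k \<le> int e * int (x div e)" using k by (intro mult_left_mono) auto
      also have "\<dots> \<le> int x" using times_div_less_eq_dividend[of e x] by (simp flip: of_nat_mult)
      finally have "int e * k \<le> int x" .
      moreover have "int e * k \<ge> 1" using k e mult_mono[of 1 "int e" 1 k] by simp
      ultimately show "u \<in> {u \<in> {1..int x}. int e dvd u - int (Suc x)}" using k by simp
    next
      fix u assume u: "u \<in> {u \<in> {1..int x}. int e dvd u - int (Suc x)}"
      then have "int e dvd int (Suc x) - u" by (simp add: dvd_diff_commute)
      then obtain k where k: "int (Suc x) - u = int e * k" by (rule dvdE)
      then have "int e * k > 0" "int e * k \<le> int x" using u by auto
      then have "k \<ge> 1" using e by (simp add: zero_less_mult_iff)
      moreover have "k \<le> int (x div e)"
      proof -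
        have "(int e * k) div int e \<le> int x div int e" using \<open>int e * k \<le> int x\<close> e by (intro zdiv_mono1) auto
        then show ?thesis using e by (simp add: zdiv_int)
      qed
      ultimately show "u \<in> (\<lambda>k. int (Suc x) - int e * k) ` {1..int (x div e)}"
        using k by (intro image_eqI[of _ _ k]) auto
    qed
  qed
  then have "card {1..int (x div e)} = card {u \<in> {1..int x}. int e dvd u - int (Suc x)}" by (rule bij_betw_same_card)
  then show ?thesis by simp
qed

text \<open>With \<open>x = e * a + b\<close> there are \<open>b\<close> classes of size
  \<open>a + 1\<close> and \<open>e - b\<close> of size \<open>a\<close>, whose squares add up to
  the right-hand side. The induction adds the new point as a partner of itself and twice as a
  partner of the \<open>x div e\<close> earlier points of its class.\<close>

lemma sum_congruent_pairs:
  fixes e x :: nat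
  assumes e: "e > 0"
  shows "(\<Sum>t\<in>{1..int x}. card {u \<in> {1..int x}. int e dvd u - t}) =
    e * (x div e)\<^sup>2 + 2 * (x div e) * (x mod e) + x mod e"
proof (induction x)
  case (Suc x)
  let ?c = "\<lambda>x t. card {u \<in> {1..int x}. int e dvd u - t}"
  have S: "{1..int (Suc x)} = insert (int (Suc x)) {1..int x}" by auto
  have c: "?c (Suc x) t = ?c x t + (if int e dvd int (Suc x) - t then 1 else 0)" for t
  proof -
    have fin: "finite {u \<in> {1..int x}. int e dvd u - t}" by (rule finite_subset[of _ "{1..int x}"]) auto
    have "{u \<in> {1..int (Suc x)}. int e dvd u - t} =
      (if int e dvd int (Suc x) - t then insert (int (Suc x)) {u \<in> {1..int x}. int e dvd u - t} else {u \<in> {1..int x}. int e dvd u - t})"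
      unfolding S by auto
    then show ?thesis using fin by simp
  qed
  have "(\<Sum>t\<in>{1..int (Suc x)}. ?c (Suc x) t) = ?c (Suc x) (int (Suc x)) + (\<Sum>t\<in>{1..int x}. ?c (Suc x) t)"
    unfolding S by (rule sum.insert) auto
  also have "?c (Suc x) (int (Suc x)) = x div e + 1"
    unfolding c card_congruent_to_next[OF e] by simp
  also have "(\<Sum>t\<in>{1..int x}. ?c (Suc x) t) = (\<Sum>t\<in>{1..int x}. ?c x t) + (\<Sum>t\<in>{1..int x}. if int e dvd int (Suc x) - t then 1 else 0)"
    unfolding c by (rule sum.distrib)
  also have "(\<Sum>t\<in>{1..int x}. if int e dvd int (Suc x) - t then 1 else 0) = card {t \<in> {1..int x}. int e dvd t - int (Suc x)}"
    by (simp add: sum.If_cases Int_def dvd_diff_commute)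
  also have "\<dots> = x div e" by (rule card_congruent_to_next[OF e])
  finally have rec: "(\<Sum>t\<in>{1..int (Suc x)}. ?c (Suc x) t) =
      e * (x div e)\<^sup>2 + 2 * (x div e) * (x mod e) + x mod e + 1 + 2 * (x div e)"
    using Suc.IH by simp
  show ?case
  proof (cases "Suc (x mod e) = e")
    case True
    then have "Suc x div e = Suc (x div e)" "Suc x mod e = 0" by (simp_all add: div_Suc mod_Suc)
    moreover have "e * q\<^sup>2 + 2 * q * r + r + 1 + 2 * q = e * (Suc q)\<^sup>2" if "Suc r = e" for q r
      by (simp add: that[symmetric] power2_eq_square algebra_simps)
    ultimately show ?thesis unfolding rec using True by (simp only: add_0_right mult_0_right)
  next
    case False
    then have "Suc x div e = x div e" "Suc x mod e = Suc (x mod e)" by (simp_all add: div_Suc mod_Suc)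
    then show ?thesis unfolding rec by (simp add: algebra_simps)
  qed
qed simp

text \<open>After subtracting the square of the mean only the remainder \<open>b = x mod e\<close>
  is left, as \<open>b - b^2 / e\<close>; dividing by \<open>e\<close> gives
  \<open>frac * (1 - frac)\<close>, the origin of \<open>psi\<close>.\<close>

lemma congruent_pairs_variance:
  fixes e x :: nat
  assumes e: "e > 0"
  shows "real (\<Sum>t\<in>{1..int x}. card {u \<in> {1..int x}. int e dvd u - t}) - real x ^ 2 / real e = real e * psi (real x / real e)"
proof -
  define a b where "a = real (x div e)" and "b = real (x mod e)"
  have x: "real x = real e * a + b" unfolding a_def b_def by (metis mult_div_mod_eq of_nat_add of_nat_mult)
  have b: "0 \<le> b" "b < real e" unfolding b_def using e by auto
  have fr: "frac (real x / real e) = b / real e"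
  proof -
    have "real x / real e = b / real e + of_int (int (x div e))" unfolding x using e by (simp add: a_def field_simps)
    then show ?thesis using b e by (simp add: frac_unique_iff)
  qed
  have "real e * psi (real x / real e) = b - b\<^sup>2 / real e"
    unfolding psi_def fr using e by (simp add: field_simps power2_eq_square)
  moreover have "real (\<Sum>t\<in>{1..int x}. card {u \<in> {1..int x}. int e dvd u - t}) = real e * a\<^sup>2 + 2 * a * b + b"
    unfolding sum_congruent_pairs[OF e] a_def b_def by simp
  moreover have "real x ^ 2 / real e = real e * a\<^sup>2 + 2 * a * b + b\<^sup>2 / real e"
    unfolding x using e by (simp add: field_simps power2_eq_square)
  ultimately show ?thesis by simp
qed

text \<open>Centring in \<open>u\<close> turns the class count into its deviation from
  \<open>x / e\<close>. This deviation sums to 0 over a full period of \<open>t\<close>, so the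
  centring in \<open>t\<close> adds nothing and the variance of the class counts remains.\<close>

lemma sum_weight_congruent:
  fixes e x q1 q2 :: nat
  assumes e: "e > 0" "e dvd q1" "e dvd q2" and q: "q1 > 0" "q2 > 0"
  shows "(\<Sum>t\<in>{0..int (x + q1)}. \<Sum>u\<in>{0..int (x + q2)}. weight x q1 t * weight x q2 u * (if int e dvd u - t then 1 else 0)) =
    real e * psi (real x / real e)"
proof -
  define c where "c t = real (card {u \<in> {1..int x}. int e dvd u - t})" for t
  have quot: "real (q div e) = real q / real e" if "e dvd q" for q using that by (rule real_of_nat_div)
  have inner: "(\<Sum>u\<in>{0..int (x + q2)}. weight x q2 u * (if int e dvd u - t then 1 else 0)) = c t - real x / real e" for t
    unfolding sum_weight c_def card_filter_eq_sum[OF finite_atLeastAtMost_int, symmetric]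
      card_filter_eq_sum[OF finite_atLeastLessThan_int, symmetric]
      card_residue_class[OF e(1,3)] quot[OF e(3)] using q by simp
  have "(\<Sum>t\<in>{0..int (x + q1)}. \<Sum>u\<in>{0..int (x + q2)}. weight x q1 t * weight x q2 u * (if int e dvd u - t then 1 else 0)) =
      (\<Sum>t\<in>{0..int (x + q1)}. weight x q1 t * (c t - real x / real e))"
    by (simp only: inner[symmetric] sum_distrib_left mult.assoc)
  also have "\<dots> = (\<Sum>t\<in>{1..int x}. c t - real x / real e) - real x / real q1 * (\<Sum>t\<in>{0..<int q1}. c t - real x / real e)"
    by (rule sum_weight)
  also have "(\<Sum>t\<in>{0..<int q1}. c t - real x / real e) = 0"
  proof -
    have "(\<Sum>t\<in>{0..<int q1}. c t) = (\<Sum>t\<in>{0..<int q1}. \<Sum>u\<in>{1..int x}. if int e dvd u - t then 1 else 0)"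
      unfolding c_def card_filter_eq_sum[OF finite_atLeastAtMost_int] ..
    also have "\<dots> = (\<Sum>u\<in>{1..int x}. \<Sum>t\<in>{0..<int q1}. if int e dvd u - t then 1 else 0)" by (rule sum.swap)
    also have "\<dots> = (\<Sum>u\<in>{1..int x}. real (card {t \<in> {0..<int q1}. int e dvd t - u}))"
      unfolding card_filter_eq_sum[OF finite_atLeastLessThan_int] by (simp add: dvd_diff_commute)
    also have "\<dots> = (\<Sum>u\<in>{1..int x}. real q1 / real e)"
      unfolding card_residue_class[OF e(1,2)] quot[OF e(2)] ..
    finally show ?thesis by (simp add: sum_subtractf)
  qed
  also have "(\<Sum>t\<in>{1..int x}. c t - real x / real e) = real (\<Sum>t\<in>{1..int x}. card {u \<in> {1..int x}. int e dvd u - t}) - real x ^ 2 / real e"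
    by (simp add: sum_subtractf c_def power2_eq_square)
  finally show ?thesis using congruent_pairs_variance[OF e(1)] by simp
qed

lemma gcd_prod_primes:
  fixes A B :: "nat set"
  assumes "finite A" "finite B" "\<And>p. p \<in> A \<union> B \<Longrightarrow> prime p"
  shows "gcd (\<Prod>A) (\<Prod>B) = \<Prod>(A \<inter> B)"
proof -
  have "\<Prod>A = \<Prod>(A \<inter> B) * \<Prod>(A - B)" "\<Prod>B = \<Prod>(A \<inter> B) * \<Prod>(B - A)"
    using assms(1,2) by (metis prod.Int_Diff, metis prod.Int_Diff Int_commute)
  moreover have "coprime (\<Prod>(A - B)) (\<Prod>(B - A))"
    by (intro prod_coprime_left coprime_prod_primes) (use assms in auto)
  ultimately show ?thesis by (simp add: gcd_mult_distrib_nat[symmetric])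
qed

text \<open>Gauss' identity for the totient. It replaces the gcd, which depends on
  \<open>u - t\<close> in a complicated way, by congruence conditions between \<open>t\<close> and
  \<open>u\<close>.\<close>

lemma gcd_eq_sum_totient:
  fixes m :: nat and k :: int
  assumes "m > 0"
  shows "real_of_int (gcd k (int m)) = (\<Sum>e | e dvd m. real (totient e) * (if int e dvd k then 1 else 0))"
proof -
  define g where "g = nat (gcd k (int m))"
  have g: "int g = gcd k (int m)" by (simp add: g_def)
  have dv: "e dvd g \<longleftrightarrow> e dvd m \<and> int e dvd k" for e
    unfolding int_dvd_int_iff[symmetric, of e g] g by auto
  have "real g = real (\<Sum>e | e dvd g. totient e)" by (simp add: totient_divisor_sum)
  also have "\<dots> = (\<Sum>e | e dvd m \<and> int e dvd k. real (totient e))" by (simp add: dv)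
  also have "\<dots> = (\<Sum>e | e dvd m. if int e dvd k then real (totient e) else 0)"
    using assms by (subst sum.inter_filter[symmetric]) auto
  also have "\<dots> = (\<Sum>e | e dvd m. real (totient e) * (if int e dvd k then 1 else 0))"
    by (intro sum.cong) auto
  finally show ?thesis using g by (metis of_int_of_nat_eq)
qed

lemma pair_kernel_eq_sum_weight:
  fixes A B :: "nat set" and x :: nat
  assumes A: "A \<in> prime_sets L" and B: "B \<in> prime_sets L"
  defines "a \<equiv> (\<Prod>A)\<^sup>2" and "b \<equiv> (\<Prod>B)\<^sup>2"
  shows "pair_kernel A B psi (real x) = (- 1) ^ card A * (- 1) ^ card B *
    (\<Sum>t\<in>{0..int (x + a)}. \<Sum>u\<in>{0..int (x + b)}. weight x a t * weight x b u *
      (real_of_int (gcd (u - t) (gcd (int a) (int b))) / (real a * real b)))"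
proof -
  define m where "m = (\<Prod>(A \<inter> B))\<^sup>2"
  note A' = prime_setsD[OF A] and B' = prime_setsD[OF B]
  have "gcd (\<Prod>A) (\<Prod>B) = \<Prod>(A \<inter> B)" by (rule gcd_prod_primes) (use A' B' in auto)
  then have m: "gcd a b = m" unfolding a_def b_def m_def by (simp only: gcd_exp)
  have ab: "a > 0" "b > 0" using A'(3) B'(3) by (simp_all add: a_def b_def)
  have m0: "m > 0" using ab unfolding m[symmetric] by simp
  have "m dvd a" "m dvd b" unfolding m[symmetric] by simp_all
  then have dvd: "e dvd a" "e dvd b" "e > 0" if "e dvd m" for e
    using dvd_trans[OF that] dvd_pos_nat[OF m0 that] by simp_all
  have gcdm: "gcd (int a) (int b) = int m" unfolding m[symmetric] by (rule gcd_int_int_eq)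
  have "(\<Sum>t\<in>{0..int (x + a)}. \<Sum>u\<in>{0..int (x + b)}. weight x a t * weight x b u * real_of_int (gcd (u - t) (int m))) =
      (\<Sum>t\<in>{0..int (x + a)}. \<Sum>u\<in>{0..int (x + b)}. \<Sum>e | e dvd m. real (totient e) * (weight x a t * weight x b u * (if int e dvd u - t then 1 else 0)))"
    unfolding gcd_eq_sum_totient[OF m0] sum_distrib_left by (intro sum.cong refl) simp
  also have "\<dots> = (\<Sum>e | e dvd m. \<Sum>t\<in>{0..int (x + a)}. \<Sum>u\<in>{0..int (x + b)}. real (totient e) * (weight x a t * weight x b u * (if int e dvd u - t then 1 else 0)))"
    by (simp only: sum.swap[of _ "{e. e dvd m}"])
  also have "\<dots> = (\<Sum>e | e dvd m. real (totient e) * (real e * psi (real x / real e)))"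
    unfolding sum_distrib_left[symmetric]
    by (intro sum.cong refl arg_cong2[where f = "(*)"] sum_weight_congruent) (use dvd ab in auto)
  finally have "(\<Sum>t\<in>{0..int (x + a)}. \<Sum>u\<in>{0..int (x + b)}. weight x a t * weight x b u * real_of_int (gcd (u - t) (int m))) =
     (\<Sum>e | e dvd m. real (totient e) * real e * psi (real x / real e))"
    by (simp only: mult.assoc)
  then show ?thesis unfolding pair_kernel_def gcdm m_def[symmetric] times_divide_eq_right sum_divide_distrib[symmetric]
    by (simp add: a_def b_def)
qed

section \<open>Mean square of the truncated error\<close>

definition main_error :: "nat \<Rightarrow> real \<Rightarrow> int poly \<Rightarrow> real" where
  "main_error x L P = (\<Sum>A\<in>prime_sets L. (- 1) ^ card A *
     (\<Sum>t\<in>{0..int (x + (\<Prod>A)\<^sup>2)}. weight x ((\<Prod>A)\<^sup>2) t * (if int ((\<Prod>A)\<^sup>2) dvd poly P t then 1 else 0)))"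

lemma main_error_eq:
  "main_error x L P = (\<Sum>A\<in>prime_sets L. (- 1) ^ card A * real (card {n \<in> {1..int x}. int ((\<Prod>A)\<^sup>2) dvd poly P n}))
    - real x * truncated_series L P"
proof -
  have "main_error x L P = (\<Sum>A\<in>prime_sets L. (- 1) ^ card A * real (card {n \<in> {1..int x}. int ((\<Prod>A)\<^sup>2) dvd poly P n})
    - real x * ((- 1) ^ card A * (\<Prod>p\<in>A. root_density P p)))"
    unfolding main_error_def
  proof (rule sum.cong[OF refl])
    fix A assume A: "A \<in> prime_sets L"
    let ?a = "(\<Prod>A)\<^sup>2"
    have "{t \<in> {0..<int ?a}. int ?a dvd poly P t} = roots_mod P ?a" by (auto simp: roots_mod_iff)
    then have "(\<Prod>p\<in>A. root_density P p) = real (card {t \<in> {0..<int ?a}. int ?a dvd poly P t}) / real ?a"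
      using prod_root_density[OF prime_setsD(1,2)[OF A], of P] by (simp only:)
    then show "(- 1) ^ card A * (\<Sum>t\<in>{0..int (x + ?a)}. weight x ?a t * (if int ?a dvd poly P t then 1 else 0)) =
      (- 1) ^ card A * real (card {n \<in> {1..int x}. int ?a dvd poly P n}) - real x * ((- 1) ^ card A * (\<Prod>p\<in>A. root_density P p))"
      unfolding sum_weight card_filter_eq_sum[OF finite_atLeastAtMost_int, symmetric]
        card_filter_eq_sum[OF finite_atLeastLessThan_int, symmetric]
      by (simp only: right_diff_distrib times_divide_eq_left times_divide_eq_right mult_ac)
  qed
  then show ?thesis by (simp add: sum_subtractf truncated_series_def sum_distrib_left)
qed

text \<open>Expanding the square leaves joint divisibility at two points, where the box count is
  inserted. For each pair of sets the errors are weighted by the total variations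
  \<open>2 * x\<close> of both weights, and there are at most \<open>L^2\<close> pairs.\<close>

lemma sum_box_main_error_square:
  assumes d: "d \<ge> 1" and L: "L \<ge> 0"
  shows "\<bar>(\<Sum>P\<in>height_box (Suc (Suc d)) N. (main_error x L P)\<^sup>2) -
     real (card (height_box (Suc (Suc d)) N)) * (\<Sum>A\<in>prime_sets L. \<Sum>B\<in>prime_sets L. pair_kernel A B psi (real x))\<bar>
   \<le> 8 * real x ^ 2 * L ^ 2 * real (card (height_box (Suc (Suc d)) N)) / real (2 * N + 1)"
proof -
  let ?X = "height_box (Suc (Suc d)) N"
  let ?I = "\<lambda>A. {0..int (x + (\<Prod>A)\<^sup>2)}"
  let ?w = "\<lambda>A. weight x ((\<Prod>A)\<^sup>2)"
  let ?v = "\<lambda>A P t. (if int ((\<Prod>A)\<^sup>2) dvd poly P t then 1 else 0 :: real)"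
  let ?s = "\<lambda>A B. (- 1 :: real) ^ card A * (- 1) ^ card B"
  let ?n = "\<lambda>A B t u. real (card {P \<in> ?X. int ((\<Prod>A)\<^sup>2) dvd poly P t \<and> int ((\<Prod>B)\<^sup>2) dvd poly P u})"
  let ?g = "\<lambda>A B t u. real_of_int (gcd (u - t) (gcd (int ((\<Prod>A)\<^sup>2)) (int ((\<Prod>B)\<^sup>2)))) / (real ((\<Prod>A)\<^sup>2) * real ((\<Prod>B)\<^sup>2))"
  let ?c = "real (card ?X)"
  let ?M = "real (2 * N + 1)"
  have "(main_error x L P)\<^sup>2 = (\<Sum>A\<in>prime_sets L. \<Sum>B\<in>prime_sets L. ?s A B * (\<Sum>t\<in>?I A. \<Sum>u\<in>?I B. ?w A t * ?w B u * (?v A P t * ?v B P u)))" for P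
    unfolding main_error_def power2_eq_square[of "\<Sum>A\<in>prime_sets L. _ A"] sum_product
  proof (intro sum.cong refl)
    fix A B
    have "((- 1) ^ card A * (\<Sum>t\<in>?I A. ?w A t * ?v A P t)) * ((- 1) ^ card B * (\<Sum>u\<in>?I B. ?w B u * ?v B P u)) =
        ?s A B * ((\<Sum>t\<in>?I A. ?w A t * ?v A P t) * (\<Sum>u\<in>?I B. ?w B u * ?v B P u))"
      by (simp only: mult_ac)
    also have "(\<Sum>t\<in>?I A. ?w A t * ?v A P t) * (\<Sum>u\<in>?I B. ?w B u * ?v B P u) =
        (\<Sum>t\<in>?I A. \<Sum>u\<in>?I B. (?w A t * ?v A P t) * (?w B u * ?v B P u))"
      by (rule sum_product)
    also have "\<dots> = (\<Sum>t\<in>?I A. \<Sum>u\<in>?I B. ?w A t * ?w B u * (?v A P t * ?v B P u))"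
      by (intro sum.cong refl) (simp only: mult_ac)
    finally show "((- 1) ^ card A * (\<Sum>t\<in>?I A. ?w A t * ?v A P t)) * ((- 1) ^ card B * (\<Sum>u\<in>?I B. ?w B u * ?v B P u)) =
        ?s A B * (\<Sum>t\<in>?I A. \<Sum>u\<in>?I B. ?w A t * ?w B u * (?v A P t * ?v B P u))" .
  qed
  then have "(\<Sum>P\<in>?X. (main_error x L P)\<^sup>2) =
     (\<Sum>P\<in>?X. \<Sum>A\<in>prime_sets L. \<Sum>B\<in>prime_sets L. ?s A B * (\<Sum>t\<in>?I A. \<Sum>u\<in>?I B. ?w A t * ?w B u * (?v A P t * ?v B P u)))"
    by (simp only:)
  also have "\<dots> = (\<Sum>A\<in>prime_sets L. \<Sum>B\<in>prime_sets L. ?s A B * (\<Sum>t\<in>?I A. \<Sum>u\<in>?I B. ?w A t * ?w B u * (\<Sum>P\<in>?X. ?v A P t * ?v B P u)))"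
    by (simp only: sum_distrib_left sum.swap[of _ _ ?X])
  also have "\<dots> = (\<Sum>A\<in>prime_sets L. \<Sum>B\<in>prime_sets L. ?s A B * (\<Sum>t\<in>?I A. \<Sum>u\<in>?I B. ?w A t * ?w B u * ?n A B t u))"
    unfolding card_filter_eq_sum[OF finite_box] by (intro sum.cong arg_cong2[where f = "(*)"] refl) auto
  finally have lhs: "(\<Sum>P\<in>?X. (main_error x L P)\<^sup>2) = \<dots>" .
  have "?c * (\<Sum>A\<in>prime_sets L. \<Sum>B\<in>prime_sets L. pair_kernel A B psi (real x)) =
      (\<Sum>A\<in>prime_sets L. \<Sum>B\<in>prime_sets L. ?s A B * (\<Sum>t\<in>?I A. \<Sum>u\<in>?I B. ?w A t * ?w B u * (?c * ?g A B t u)))"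
    unfolding sum_distrib_left by (intro sum.cong refl) (simp only: pair_kernel_eq_sum_weight sum_distrib_left mult_ac)
  then have diff: "(\<Sum>P\<in>?X. (main_error x L P)\<^sup>2) - ?c * (\<Sum>A\<in>prime_sets L. \<Sum>B\<in>prime_sets L. pair_kernel A B psi (real x)) =
     (\<Sum>A\<in>prime_sets L. \<Sum>B\<in>prime_sets L. ?s A B * (\<Sum>t\<in>?I A. \<Sum>u\<in>?I B. ?w A t * ?w B u * (?n A B t u - ?c * ?g A B t u)))"
    unfolding lhs by (simp only: sum_subtractf right_diff_distrib)
  have "\<bar>\<Sum>A\<in>prime_sets L. \<Sum>B\<in>prime_sets L. ?s A B * (\<Sum>t\<in>?I A. \<Sum>u\<in>?I B. ?w A t * ?w B u * (?n A B t u - ?c * ?g A B t u))\<bar>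
      \<le> (\<Sum>A\<in>prime_sets L. \<Sum>B\<in>prime_sets L. 8 * real x ^ 2 * ?c / ?M)"
  proof (intro order_trans[OF sum_abs sum_mono] order_trans[OF sum_abs])
    fix A B assume A: "A \<in> prime_sets L" and B: "B \<in> prime_sets L"
    have ab: "(\<Prod>A)\<^sup>2 > 0" "(\<Prod>B)\<^sup>2 > 0" using prime_setsD(3)[OF A] prime_setsD(3)[OF B] by simp_all
    have "\<bar>?s A B * (\<Sum>t\<in>?I A. \<Sum>u\<in>?I B. ?w A t * ?w B u * (?n A B t u - ?c * ?g A B t u))\<bar> =
        \<bar>\<Sum>t\<in>?I A. \<Sum>u\<in>?I B. ?w A t * ?w B u * (?n A B t u - ?c * ?g A B t u)\<bar>"
      by (simp add: abs_mult power_abs)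
    also have "\<dots> \<le> (\<Sum>t\<in>?I A. \<Sum>u\<in>?I B. \<bar>?w A t\<bar> * \<bar>?w B u\<bar> * (2 * ?c / ?M))"
    proof (intro order_trans[OF sum_abs sum_mono] order_trans[OF sum_abs])
      fix t u
      have "\<bar>?n A B t u - ?c * ?g A B t u\<bar> \<le> 2 * ?c / ?M"
        using card_box_two_divisors[OF d, of "int ((\<Prod>A)\<^sup>2)" "int ((\<Prod>B)\<^sup>2)" N t u] ab
        by (simp only: of_int_of_nat_eq times_divide_eq_right of_nat_0_less_iff)
      then show "\<bar>?w A t * ?w B u * (?n A B t u - ?c * ?g A B t u)\<bar> \<le> \<bar>?w A t\<bar> * \<bar>?w B u\<bar> * (2 * ?c / ?M)"
        unfolding abs_mult by (intro mult_left_mono) auto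
    qed
    also have "\<dots> = (\<Sum>t\<in>?I A. \<bar>?w A t\<bar>) * (\<Sum>u\<in>?I B. \<bar>?w B u\<bar>) * (2 * ?c / ?M)"
      by (subst sum_product) (simp only: sum_distrib_right)
    also have "\<dots> \<le> (2 * real x) * (2 * real x) * (2 * ?c / ?M)"
      by (intro mult_right_mono mult_mono sum_abs_weight ab sum_nonneg) auto
    also have "\<dots> = 8 * real x ^ 2 * ?c / ?M" by (simp add: power2_eq_square)
    finally show "\<bar>?s A B * (\<Sum>t\<in>?I A. \<Sum>u\<in>?I B. ?w A t * ?w B u * (?n A B t u - ?c * ?g A B t u))\<bar> \<le> 8 * real x ^ 2 * ?c / ?M" .
  qed
  also have "\<dots> = real (card (prime_sets L)) * real (card (prime_sets L)) * (8 * real x ^ 2 * ?c / ?M)"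
    by (simp only: sum_constant mult.assoc)
  also have "\<dots> \<le> L * L * (8 * real x ^ 2 * ?c / ?M)"
    using card_prime_sets[OF L] L by (intro mult_right_mono mult_mono divide_nonneg_nonneg mult_nonneg_nonneg) simp_all
  also have "\<dots> = 8 * real x ^ 2 * L ^ 2 * ?c / ?M" by (simp add: power2_eq_square)
  finally show ?thesis unfolding diff .
qed

section \<open>The second moment\<close>

definition sqfree_defect :: "real \<Rightarrow> int \<Rightarrow> real" where
  "sqfree_defect L v = (if squarefree v then 1 else 0) -
     (\<Sum>A\<in>prime_sets L. (- 1) ^ card A * (if int ((\<Prod>A)\<^sup>2) dvd v then 1 else 0))"

text \<open>Zero is not squarefree although every square divides it, so all Moebius terms are
  present and only their number is used.\<close>

lemma sqfree_defect_0:
  assumes "L \<ge> 0"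
  shows "\<bar>sqfree_defect L 0\<bar> \<le> L"
proof -
  have "\<bar>sqfree_defect L 0\<bar> = \<bar>\<Sum>A\<in>prime_sets L. (- 1 :: real) ^ card A\<bar>" by (simp add: sqfree_defect_def)
  also have "\<dots> \<le> (\<Sum>A\<in>prime_sets L. \<bar>(- 1 :: real) ^ card A\<bar>)" by (rule sum_abs)
  also have "\<dots> \<le> L" using card_prime_sets[OF assms] by (simp add: power_abs)
  finally show ?thesis .
qed

text \<open>The full alternating sum over all sets of primes with square dividing \<open>v\<close>
  is the squarefree indicator. What the truncation omits are sets with product \<open>a > L\<close>;
  there are at most \<open>2 ^ card (prime_factors (nat \<bar>v\<bar>))\<close>, and each satisfies
  \<open>a^2 dvd v\<close>.\<close>

lemma sqfree_defect_nonzero: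
  assumes v: "v \<noteq> 0"
  shows "\<bar>sqfree_defect L v\<bar> \<le>
    2 ^ card (prime_factors (nat \<bar>v\<bar>)) * (if \<exists>a. real a > L \<and> int (a\<^sup>2) dvd v then 1 else 0)"
proof -
  define B where "B = {p :: nat. prime p \<and> int (p\<^sup>2) dvd v}"
  have BP: "B \<subseteq> prime_factors (nat \<bar>v\<bar>)"
  proof
    fix p assume p: "p \<in> B"
    have "int p dvd int (p\<^sup>2)" by (simp add: power2_eq_square)
    then have "int p dvd v" using p unfolding B_def by (metis (no_types, lifting) dvd_trans mem_Collect_eq)
    then have "p dvd nat \<bar>v\<bar>" by (simp add: dvd_nat_abs_iff)
    then show "p \<in> prime_factors (nat \<bar>v\<bar>)" using p v by (simp add: B_def in_prime_factors_iff)
  qed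
  then have finB: "finite B" by (rule finite_subset) simp
  have sq: "squarefree v \<longleftrightarrow> B = {}"
  proof -
    have "(\<exists>p. prime p \<and> p\<^sup>2 dvd v) \<longleftrightarrow> (\<exists>p :: nat. prime p \<and> int (p\<^sup>2) dvd v)"
    proof
      assume "\<exists>p. prime p \<and> p\<^sup>2 dvd v"
      then obtain p where p: "prime p" "p\<^sup>2 dvd v" by blast
      define q where "q = nat p"
      have "p = int q" using prime_ge_0_int[OF p(1)] by (simp add: q_def)
      then have "prime q" "int (q\<^sup>2) dvd v" using p by simp_all
      then show "\<exists>p :: nat. prime p \<and> int (p\<^sup>2) dvd v" by blast
    next
      assume "\<exists>p :: nat. prime p \<and> int (p\<^sup>2) dvd v"
      then obtain p :: nat where "prime p" "int (p\<^sup>2) dvd v" by blast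
      then have "prime (int p)" "(int p)\<^sup>2 dvd v" by simp_all
      then show "\<exists>p. prime p \<and> p\<^sup>2 dvd v" by blast
    qed
    then show ?thesis using v by (auto simp: squarefree_int_iff B_def)
  qed
  have dvd: "int ((\<Prod>A)\<^sup>2) dvd v \<longleftrightarrow> A \<subseteq> B" if "finite A" "\<And>p. p \<in> A \<Longrightarrow> prime p" for A
    using prod_primes_square_dvd_iff[OF that, of v] that(2) by (auto simp: B_def)
  have "(\<Sum>A\<in>prime_sets L. (- 1) ^ card A * (if int ((\<Prod>A)\<^sup>2) dvd v then 1 else 0)) =
      (\<Sum>A\<in>prime_sets L. if A \<subseteq> B then (- 1 :: real) ^ card A else 0)"
    using dvd by (intro sum.cong refl) (auto simp: prime_setsD)
  also have "\<dots> = (\<Sum>A | A \<in> prime_sets L \<and> A \<subseteq> B. (- 1 :: real) ^ card A)"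
    by (subst sum.inter_filter[symmetric]) auto
  also have "{A. A \<in> prime_sets L \<and> A \<subseteq> B} = {A \<in> Pow B. real (\<Prod>A) \<le> L}"
    using finB by (auto simp: prime_sets_def B_def intro: finite_subset)
  finally have T: "(\<Sum>A\<in>prime_sets L. (- 1) ^ card A * (if int ((\<Prod>A)\<^sup>2) dvd v then 1 else 0)) =
      (\<Sum>A\<in>{A \<in> Pow B. real (\<Prod>A) \<le> L}. (- 1 :: real) ^ card A)" .
  have "(if squarefree v then 1 else 0) = (\<Sum>A\<in>Pow B. (- 1 :: real) ^ card A)"
    using sum_Pow_minus_one[OF finB] sq by simp
  also have "\<dots> = (\<Sum>A\<in>{A \<in> Pow B. real (\<Prod>A) \<le> L}. (- 1 :: real) ^ card A) + (\<Sum>A\<in>{A \<in> Pow B. \<not> real (\<Prod>A) \<le> L}. (- 1 :: real) ^ card A)"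
    using finB by (subst sum.union_disjoint[symmetric]) (auto intro!: sum.cong)
  finally have R: "sqfree_defect L v = (\<Sum>A\<in>{A \<in> Pow B. \<not> real (\<Prod>A) \<le> L}. (- 1 :: real) ^ card A)"
    unfolding sqfree_defect_def T by simp
  show ?thesis
  proof (cases "\<exists>a. real a > L \<and> int (a\<^sup>2) dvd v")
    case True
    have "\<bar>sqfree_defect L v\<bar> \<le> (\<Sum>A\<in>{A \<in> Pow B. \<not> real (\<Prod>A) \<le> L}. \<bar>(- 1 :: real) ^ card A\<bar>)"
      unfolding R by (rule sum_abs)
    also have "\<dots> \<le> (\<Sum>A\<in>Pow B. 1)"
      using finB unfolding power_abs abs_minus_cancel abs_one power_one by (intro sum_mono2) auto
    also have "\<dots> = 2 ^ card B" using finB by (simp add: card_Pow)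
    also have "\<dots> \<le> 2 ^ card (prime_factors (nat \<bar>v\<bar>))"
      using BP by (intro power_increasing card_mono) auto
    finally show ?thesis using True by simp
  next
    case False
    have emp: "{A \<in> Pow B. \<not> real (\<Prod>A) \<le> L} = {}"
    proof -
      have False if A: "A \<subseteq> B" "\<not> real (\<Prod>A) \<le> L" for A
      proof -
        have "finite A" "\<And>p. p \<in> A \<Longrightarrow> prime p" using A finB finite_subset by (auto simp: B_def)
        then have "int ((\<Prod>A)\<^sup>2) dvd v" using dvd A(1) by blast
        then show False using False A(2) by (meson not_le)
      qed
      then show ?thesis by blast
    qed
    have "sqfree_defect L v = 0" unfolding R emp by simp
    then show ?thesis by simp
  qed
qed

lemma sqfree_error_decomposition:
  "sqfree_error P x = main_error x L P + (\<Sum>n\<in>{1..int x}. sqfree_defect L (poly P n))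
     - real x * (singular_series P - truncated_series L P)"
proof -
  have "(\<Sum>n\<in>{1..int x}. sqfree_defect L (poly P n)) = (\<Sum>n\<in>{1..int x}. if squarefree (poly P n) then 1 else 0) -
     (\<Sum>n\<in>{1..int x}. \<Sum>A\<in>prime_sets L. (- 1) ^ card A * (if int ((\<Prod>A)\<^sup>2) dvd poly P n then 1 else 0))"
    by (simp only: sqfree_defect_def sum_subtractf)
  also have "(\<Sum>n\<in>{1..int x}. \<Sum>A\<in>prime_sets L. (- 1) ^ card A * (if int ((\<Prod>A)\<^sup>2) dvd poly P n then 1 else 0)) =
      (\<Sum>A\<in>prime_sets L. (- 1) ^ card A * real (card {n \<in> {1..int x}. int ((\<Prod>A)\<^sup>2) dvd poly P n}))"
    unfolding card_filter_eq_sum[OF finite_atLeastAtMost_int] sum_distrib_left by (rule sum.swap)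
  also have "(\<Sum>n\<in>{1..int x}. if squarefree (poly P n) then 1 else 0) = real (card {n \<in> {1..int x}. squarefree (poly P n)})"
    by (rule card_filter_eq_sum[symmetric]) simp
  finally show ?thesis unfolding sqfree_error_def main_error_eq by (simp add: algebra_simps)
qed

lemma abs_sqfree_error_le: "\<bar>sqfree_error P x\<bar> \<le> real x"
proof -
  have "card {n \<in> {1..int x}. squarefree (poly P n)} \<le> card {1..int x}" by (rule card_mono) auto
  then have "real (card {n \<in> {1..int x}. squarefree (poly P n)}) \<le> real x" by simp
  moreover have "0 \<le> singular_series P * real x" "singular_series P * real x \<le> real x"
    using singular_series_bounds[of P] by (auto simp: mult_left_le_one_le)
  ultimately show ?thesis unfolding sqfree_error_def by (simp add: abs_le_iff)
qed

text \<open>With \<open>E\<close> the error and \<open>D\<close> its truncation,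
  \<open>E^2 - D^2 = (E - D) * (2 * E - (E - D))\<close> needs nothing about \<open>E\<close> beyond
  the trivial bound \<open>x\<close>. The discarded parts carry enough negative powers of
  \<open>H\<close> to afford this loss; Cauchy-Schwarz moves the square inside the sum over
  \<open>n\<close>.\<close>

lemma square_error_bound:
  "\<bar>(sqfree_error P x)\<^sup>2 - (main_error x L P)\<^sup>2\<bar> \<le>
    2 * real x * (\<Sum>n\<in>{1..int x}. \<bar>sqfree_defect L (poly P n)\<bar> + (sqfree_defect L (poly P n))\<^sup>2) +
    2 * (real x)\<^sup>2 * (\<bar>singular_series P - truncated_series L P\<bar> + (singular_series P - truncated_series L P)\<^sup>2)"
proof -
  define E where "E = sqfree_error P x"
  define D where "D = main_error x L P"
  define R where "R n = sqfree_defect L (poly P n)" for n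
  define s where "s = singular_series P - truncated_series L P"
  define r where "r = (\<Sum>n\<in>{1..int x}. R n)"
  have ED: "E - D = r - real x * s"
    unfolding E_def D_def r_def R_def s_def by (subst sqfree_error_decomposition[of P x L]) simp
  have "E\<^sup>2 - D\<^sup>2 = (E - D) * (2 * E - (E - D))" by (simp add: algebra_simps power2_eq_square)
  also have "\<bar>\<dots>\<bar> \<le> \<bar>E - D\<bar> * (2 * real x + \<bar>E - D\<bar>)"
    unfolding abs_mult using abs_sqfree_error_le[of P x] by (intro mult_left_mono) (auto simp: E_def)
  finally have 1: "\<bar>E\<^sup>2 - D\<^sup>2\<bar> \<le> 2 * real x * \<bar>E - D\<bar> + (E - D)\<^sup>2" by (simp add: algebra_simps power2_eq_square)
  have "\<bar>E - D\<bar> \<le> \<bar>r\<bar> + \<bar>real x * s\<bar>" unfolding ED by linarith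
  also have "\<bar>r\<bar> \<le> (\<Sum>n\<in>{1..int x}. \<bar>R n\<bar>)" unfolding r_def by (rule sum_abs)
  finally have 2: "2 * real x * \<bar>E - D\<bar> \<le> 2 * real x * ((\<Sum>n\<in>{1..int x}. \<bar>R n\<bar>) + real x * \<bar>s\<bar>)"
    by (intro mult_left_mono) (auto simp: abs_mult)
  have "(E - D)\<^sup>2 \<le> 2 * r\<^sup>2 + 2 * (real x * s)\<^sup>2"
    unfolding ED using zero_le_power2[of "r + real x * s"] by (simp add: power2_eq_square algebra_simps)
  also have "r\<^sup>2 \<le> real x * (\<Sum>n\<in>{1..int x}. (R n)\<^sup>2)"
    using sum_squared_le_sum_of_squares[of R "{1..int x}"] unfolding r_def by (simp add: mult.commute)
  finally have "(E - D)\<^sup>2 \<le> 2 * (real x * (\<Sum>n\<in>{1..int x}. (R n)\<^sup>2)) + 2 * (real x * s)\<^sup>2" by simp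
  then have "\<bar>E\<^sup>2 - D\<^sup>2\<bar> \<le> 2 * real x * ((\<Sum>n\<in>{1..int x}. \<bar>R n\<bar>) + real x * \<bar>s\<bar>) +
      (2 * (real x * (\<Sum>n\<in>{1..int x}. (R n)\<^sup>2)) + 2 * (real x * s)\<^sup>2)"
    using 1 2 by linarith
  also have "\<dots> = 2 * real x * (\<Sum>n\<in>{1..int x}. \<bar>R n\<bar> + (R n)\<^sup>2) + 2 * (real x)\<^sup>2 * (\<bar>s\<bar> + s\<^sup>2)"
    by (simp add: sum.distrib algebra_simps power2_eq_square)
  finally show ?thesis by (simp add: E_def D_def R_def s_def)
qed

lemma card_box_Suc_real:
  "d \<ge> 1 \<Longrightarrow> real (card (height_box (Suc d) N)) = real (2 * N + 1) * real (card (height_box d N))"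
  by (simp only: card_box_Suc of_nat_mult)

text \<open>A nonzero defect requires either a square divisor beyond \<open>L\<close>, where the
  number of Moebius terms is at most \<open>W\<close>, or a vanishing value, where the crude bound
  \<open>L\<close> is compensated by the rarity \<open>1 / (2 * N + 1)\<close>.\<close>

lemma sum_box_sqfree_defect:
  fixes W L :: real
  assumes d: "d \<ge> 1" and n: "1 \<le> n" "n \<le> 2 * N + 1" and L: "L \<ge> 1" and W: "W \<ge> 1"
    and WP: "\<And>P. P \<in> height_box (Suc (Suc d)) N \<Longrightarrow> poly P (int n) \<noteq> 0 \<Longrightarrow>
      2 ^ card (prime_factors (nat \<bar>poly P (int n)\<bar>)) \<le> W"
  shows "(\<Sum>P\<in>height_box (Suc (Suc d)) N. \<bar>sqfree_defect L (poly P (int n))\<bar> + (sqfree_defect L (poly P (int n)))\<^sup>2)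
    \<le> real (card (height_box (Suc (Suc d)) N)) *
      (2 * W\<^sup>2 * (8 / L + 2 * sqrt (real (d + 3) * real N * real n ^ (d + 2)) / (real n * real (2 * N + 1))) +
       2 * L\<^sup>2 / real (2 * N + 1))"
proof -
  let ?X = "height_box (Suc (Suc d)) N"
  let ?b = "\<lambda>P. (\<exists>a. real a > L \<and> int (a\<^sup>2) dvd poly P (int n) \<and> poly P (int n) \<noteq> 0)"
  let ?z = "\<lambda>P. poly P (int n) = 0"
  have aux: "r + r\<^sup>2 \<le> 2 * K\<^sup>2" if "0 \<le> r" "r \<le> K" "1 \<le> K" for r K :: real
  proof -
    have "r\<^sup>2 \<le> K\<^sup>2" using that by (intro power_mono) auto
    moreover have "K \<le> K\<^sup>2" using mult_left_mono[of 1 K K] that by (simp add: power2_eq_square)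
    ultimately show ?thesis using that by linarith
  qed
  have "(\<Sum>P\<in>?X. \<bar>sqfree_defect L (poly P (int n))\<bar> + (sqfree_defect L (poly P (int n)))\<^sup>2) \<le>
     (\<Sum>P\<in>?X. 2 * W\<^sup>2 * (if ?b P then 1 else 0) + 2 * L\<^sup>2 * (if ?z P then 1 else 0))"
  proof (rule sum_mono)
    fix P assume P: "P \<in> ?X"
    let ?r = "sqfree_defect L (poly P (int n))"
    show "\<bar>?r\<bar> + ?r\<^sup>2 \<le> 2 * W\<^sup>2 * (if ?b P then 1 else 0) + 2 * L\<^sup>2 * (if ?z P then 1 else 0)"
    proof (cases "?z P")
      case True
      then have "\<bar>?r\<bar> + \<bar>?r\<bar>\<^sup>2 \<le> 2 * L\<^sup>2" using L sqfree_defect_0[of L] by (intro aux) auto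
      then show ?thesis using True by simp
    next
      case False
      show ?thesis
      proof (cases "?b P")
        case True
        have "\<bar>?r\<bar> \<le> W" using sqfree_defect_nonzero[OF False, of L] WP[OF P False] True False by auto
        then have "\<bar>?r\<bar> + \<bar>?r\<bar>\<^sup>2 \<le> 2 * W\<^sup>2" using W by (intro aux) auto
        then show ?thesis using True False by simp
      next
        case nb: False
        have "\<not> (\<exists>a. real a > L \<and> int (a\<^sup>2) dvd poly P (int n))" using nb False by blast
        then have "\<bar>?r\<bar> \<le> 0"
          using sqfree_defect_nonzero[OF False, of L] by (simp only: if_False mult_zero_right)
        then show ?thesis by simp
      qed
    qed
  qed
  also have "\<dots> = 2 * W\<^sup>2 * real (card {P \<in> ?X. ?b P}) + 2 * L\<^sup>2 * real (card {P \<in> ?X. ?z P})"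
    unfolding card_filter_eq_sum[OF finite_box] by (simp only: sum.distrib sum_distrib_left)
  also have "\<dots> \<le> 2 * W\<^sup>2 * (real (card ?X) * (8 / L + 2 * sqrt (real (d + 3) * real N * real n ^ (d + 2)) / (real n * real (2 * N + 1)))) +
      2 * L\<^sup>2 * (real (card ?X) / real (2 * N + 1))"
  proof (intro add_mono mult_left_mono card_box_large_square_divisor d n L)
    have "real (card {P \<in> ?X. ?z P}) \<le> real (card (height_box (Suc d) N))"
      by (rule card_box_zero_value) simp
    also have "\<dots> = real (card ?X) / real (2 * N + 1)"
      unfolding card_box_Suc_real[OF le_SucI[OF d]] by (rule nonzero_mult_div_cancel_left[symmetric]) simp
    finally show "real (card {P \<in> ?X. ?z P}) \<le> real (card ?X) / real (2 * N + 1)" .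
  qed auto
  finally show ?thesis by (simp add: algebra_simps)
qed

text \<open>For separable polynomials the content is at least 1, so its square dominates the linear
  term as well and its mean is bounded. Nonseparable ones have proportion at most
  \<open>d / (2 * N + 1)\<close> and get the trivial bound.\<close>

lemma sum_box_truncation:
  fixes L \<delta> :: real
  assumes d: "d \<ge> 3" and N: "N \<ge> 1" and L: "L \<ge> 1" and \<delta>: "\<delta> \<ge> 0"
    and sep: "\<And>P. P \<in> height_box d N \<Longrightarrow> separable P \<Longrightarrow>
      \<bar>singular_series P - truncated_series L P\<bar> \<le> \<delta> * real_of_int (content P)"
  shows "(\<Sum>P\<in>height_box d N. \<bar>singular_series P - truncated_series L P\<bar> + (singular_series P - truncated_series L P)\<^sup>2)
    \<le> real (card (height_box d N)) *
      ((\<delta> + \<delta>\<^sup>2) * ((3 / 2) ^ d * (\<Sum>b. 1 / (real (Suc b))\<^sup>2)) + 8 * L\<^sup>2 * real d / real (2 * N + 1))"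
proof -
  let ?X = "height_box d N"
  let ?s = "\<lambda>P. singular_series P - truncated_series L P"
  have "(\<Sum>P\<in>?X. \<bar>?s P\<bar> + (?s P)\<^sup>2) \<le>
      (\<Sum>P\<in>?X. (\<delta> + \<delta>\<^sup>2) * (real_of_int (content P))\<^sup>2 + 8 * L\<^sup>2 * (if \<not> separable P then 1 else 0))"
  proof (rule sum_mono)
    fix P assume P: "P \<in> ?X"
    show "\<bar>?s P\<bar> + (?s P)\<^sup>2 \<le> (\<delta> + \<delta>\<^sup>2) * (real_of_int (content P))\<^sup>2 + 8 * L\<^sup>2 * (if \<not> separable P then 1 else 0)"
    proof (cases "separable P")
      case True
      have "P \<noteq> 0" using box_nonzero[OF _ P] d by simp
      then have "content P \<ge> 1" using content_eq_zero_iff[of P] normalize_content[of P] by (simp add: less_le int_one_le_iff_zero_less)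
      then have c: "real_of_int (content P) \<ge> 1" by simp
      have s: "\<bar>?s P\<bar> \<le> \<delta> * real_of_int (content P)" by (rule sep[OF P True])
      also have "\<dots> \<le> \<delta> * (real_of_int (content P))\<^sup>2" using c \<delta> by (intro mult_left_mono) (simp_all add: power2_eq_square)
      finally have "\<bar>?s P\<bar> \<le> \<delta> * (real_of_int (content P))\<^sup>2" .
      moreover have "\<bar>?s P\<bar>\<^sup>2 \<le> (\<delta> * real_of_int (content P))\<^sup>2" using s by (intro power_mono) auto
      ultimately show ?thesis using True by (simp add: algebra_simps power_mult_distrib)
    next
      case False
      have s: "\<bar>?s P\<bar> \<le> 2 * L" using singular_series_truncation_trivial[of L P] L by simp
      then have "\<bar>?s P\<bar>\<^sup>2 \<le> (2 * L)\<^sup>2" by (intro power_mono) auto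
      moreover have "L \<le> L\<^sup>2" using mult_left_mono[of 1 L L] L by (simp add: power2_eq_square)
      moreover have "(\<delta> + \<delta>\<^sup>2) * (real_of_int (content P))\<^sup>2 \<ge> 0" using \<delta> by simp
      ultimately show ?thesis using False s by (simp add: power_mult_distrib)
    qed
  qed
  also have "\<dots> = (\<delta> + \<delta>\<^sup>2) * (\<Sum>P\<in>?X. (real_of_int (content P))\<^sup>2) + 8 * L\<^sup>2 * real (card {P \<in> ?X. \<not> separable P})"
    unfolding card_filter_eq_sum[OF finite_box] by (simp only: sum.distrib sum_distrib_left)
  also have "\<dots> \<le> (\<delta> + \<delta>\<^sup>2) * ((3 / 2) ^ d * (\<Sum>b. 1 / (real (Suc b))\<^sup>2) * real (card ?X)) +
      8 * L\<^sup>2 * (real d * (real (card ?X) / real (2 * N + 1)))"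
  proof (intro add_mono mult_left_mono sum_content_square d N)
    obtain k where k: "d = Suc k" "k \<ge> 1" using d by (cases d) auto
    have "real (card {P \<in> ?X. \<not> separable P}) \<le> real k * real (card (height_box k N))"
      unfolding k(1) by (rule card_box_nonseparable[OF k(2)])
    also have "\<dots> \<le> real d * real (card (height_box k N))" using k by (intro mult_right_mono) auto
    also have "real (card (height_box k N)) = real (card ?X) / real (2 * N + 1)"
      unfolding k(1) card_box_Suc_real[OF k(2)] by (rule nonzero_mult_div_cancel_left[symmetric]) simp
    finally show "real (card {P \<in> ?X. \<not> separable P}) \<le> real d * (real (card ?X) / real (2 * N + 1))" .
  qed (use \<delta> in auto)
  finally show ?thesis by (simp add: algebra_simps)
qed

section \<open>Normalisation and collection of the errors\<close>

lemma one_plus_power_le: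
  fixes u :: real
  assumes "0 \<le> u" "u \<le> 1"
  shows "(1 + u) ^ d \<le> 1 + (2 ^ d - 1) * u"
proof (induction d)
  case (Suc d)
  have "(1 + u) ^ Suc d \<le> (1 + u) * (1 + (2 ^ d - 1) * u)" using Suc assms by (simp add: mult_left_mono)
  also have "\<dots> = 1 + 2 ^ d * u + (2 ^ d - 1) * (u * u)" by (simp add: algebra_simps)
  also have "\<dots> \<le> 1 + 2 ^ d * u + (2 ^ d - 1) * u"
    using assms by (intro add_left_mono mult_left_mono) (simp_all add: mult_left_le)
  also have "\<dots> = 1 + (2 ^ Suc d - 1) * u" by (simp add: algebra_simps)
  finally show ?case .
qed simp

text \<open>The normalising factor of the second moment differs from the size of the box by rounding
  \<open>H\<close> and by the condition on the leading coefficient. The constant dominates both the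
  convexity bound \<open>2 ^ d - 1\<close> from above and Bernoulli's \<open>d + 1\<close> from
  below.\<close>

lemma card_box_ratio:
  assumes d: "d \<ge> 1" and H: "H \<ge> 1"
  shows "\<bar>real (card (height_box d (nat \<lfloor>H\<rfloor>))) / (2 * H) ^ Suc d - 1\<bar> \<le> (2 ^ d + real d + 1) / H"
proof -
  define N where "N = nat \<lfloor>H\<rfloor>"
  define u where "u = 1 / H"
  have u: "0 < u" "u \<le> 1" using H by (auto simp: u_def)
  have N: "real N \<le> H" "H - 1 \<le> real N" unfolding N_def using H by linarith+
  define p where "p = real N / H"
  define q where "q = real (2 * N + 1) / (2 * H)"
  have "1 - u = (H - 1) / H" using H by (simp add: u_def diff_divide_distrib)
  also have "\<dots> \<le> p" unfolding p_def using N H by (intro divide_right_mono) auto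
  finally have p: "1 - u \<le> p" "p \<le> 1" "0 \<le> p" using N H by (auto simp: p_def)
  have "1 - u = (2 * H - 2) / (2 * H)" "1 + u = (2 * H + 2) / (2 * H)" using H by (auto simp: u_def field_simps)
  moreover have "(2 * H - 2) / (2 * H) \<le> q" "q \<le> (2 * H + 2) / (2 * H)"
    unfolding q_def using N H by (intro divide_right_mono; simp)+
  ultimately have q: "1 - u \<le> q" "q \<le> 1 + u" by simp_all
  have eq: "real (card (height_box d N)) / (2 * H) ^ Suc d = p * q ^ d"
    unfolding card_box[OF d] p_def q_def using H by (simp add: power_divide)
  have "p * q ^ d \<le> 1 * (1 + u) ^ d" using p q u by (intro mult_mono power_mono) auto
  also have "\<dots> \<le> 1 + (2 ^ d - 1) * u" using one_plus_power_le[of u d] u by simp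
  also have "\<dots> \<le> 1 + (2 ^ d + real d + 1) * u"
    using u by (intro add_left_mono mult_right_mono) auto
  finally have 1: "p * q ^ d \<le> 1 + (2 ^ d + real d + 1) * u" .
  have "1 - (2 ^ d + real d + 1) * u \<le> 1 + real (Suc d) * (- u)" using u by (simp add: algebra_simps)
  also have "\<dots> \<le> (1 + - u) ^ Suc d" using u by (intro Bernoulli_inequality) auto
  also have "\<dots> = (1 - u) * (1 - u) ^ d" by simp
  also have "\<dots> \<le> p * q ^ d" using p q u by (intro mult_mono power_mono) auto
  finally have 2: "1 - (2 ^ d + real d + 1) * u \<le> p * q ^ d" .
  show ?thesis unfolding N_def[symmetric] eq using 1 2 by (simp add: abs_le_iff u_def)
qed

lemma mean_square_error_bound:
  fixes d :: nat
  assumes d: "d \<ge> 3"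
  obtains C where "C \<ge> 0"
    "\<And>(x :: nat) H. x \<ge> 1 \<Longrightarrow> H \<ge> 1 \<Longrightarrow> real x ^ (d + 3) \<le> H \<Longrightarrow>
      \<bar>(\<Sum>P\<in>height_box d (nat \<lfloor>H\<rfloor>). (sqfree_error P x)\<^sup>2) / real (card (height_box d (nat \<lfloor>H\<rfloor>))) - gamma0 * sqrt x\<bar>
        \<le> C * real x powr (4 / 9)"
proof -
  define k where "k = d - 2"
  have k: "d = Suc (Suc k)" "k \<ge> 1" and d1: "d \<ge> 1" using d by (auto simp: k_def)
  \<comment> \<open>The divisor bound loses \<open>H powr (4 * \<eta>)\<close>, and this must cost
    at most \<open>x powr (4 / 9)\<close>. Against \<open>x^6 <= H\<close> it costs the exponent
    \<open>24 * \<eta> <= 4 / 9\<close>, since \<open>d >= 3\<close>; against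
    \<open>x^(d + 3) <= H\<close> it costs exactly
    \<open>4 * (d + 3) * \<eta> = 4 / 9\<close>.\<close>
  define \<eta> where "\<eta> = 1 / (9 * (real d + 3))"
  have \<eta>: "\<eta> > 0" "(real d + 3) * \<eta> = 1 / 9" "\<eta> \<le> 1 / 54" using d by (auto simp: \<eta>_def field_simps)
  obtain C1 where C1: "C1 \<ge> 1" "\<And>m :: nat. m > 0 \<Longrightarrow> 2 ^ card (prime_factors m) \<le> C1 * real m powr \<eta>"
    using power_card_prime_factors_bound[of 2 \<eta>] \<eta> by auto
  obtain C2 where C2: "C2 \<ge> 0" "\<And>P X L. degree P = d \<Longrightarrow> X \<ge> 1 \<Longrightarrow> (\<And>i. \<bar>real_of_int (coeff P i)\<bar> \<le> X) \<Longrightarrow>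
    separable P \<Longrightarrow> L > 0 \<Longrightarrow>
    \<bar>singular_series P - truncated_series L P\<bar> \<le> C2 * X powr \<eta> * real_of_int (content P) * L powr (- 9 / 10)"
  proof (rule singular_series_truncation[OF d1 \<eta>(1)], goal_cases)
    case (1 C)
    from 1(2) show ?case by (rule 1(1)) (rule 1(3); assumption)
  qed
  obtain C3 where C3: "C3 \<ge> 0" "\<And>n L x. L > 0 \<Longrightarrow> x > 0 \<Longrightarrow>
    \<bar>(\<Sum>A | A \<subseteq> primes_upto n \<and> real (\<Prod>A) \<le> L. \<Sum>B | B \<subseteq> primes_upto n \<and> real (\<Prod>B) \<le> L. pair_kernel A B psi x)
      - prime_op local_op n psi x\<bar> \<le> C3 * x * L powr (- 1 / 2)"
    using pair_kernel_tail by blast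
  obtain C4 where C4: "C4 \<ge> 0" "\<And>x. x > 0 \<Longrightarrow>
    eventually (\<lambda>n. \<bar>prime_op local_op n psi x - gamma0 * sqrt x\<bar> \<le> C4 * x powr (4 / 9)) sequentially"
    using prime_op_psi_gamma0 by blast
  define K where "K = (3 / 2) ^ d * (\<Sum>b. 1 / (real (Suc b))\<^sup>2)"
  have K: "K \<ge> 0" unfolding K_def by (intro mult_nonneg_nonneg suminf_nonneg summable_inverse_squares) auto
  define W0 where "W0 = C1\<^sup>2 * real (d + 1) powr (2 * \<eta>)"
  have W0: "W0 \<ge> 0" by (simp add: W0_def)
  define C where "C = 4 * W0 * (8 + 2 * sqrt (real (k + 3))) + 4 + 2 * (C2 + C2\<^sup>2) * K + 16 * real d + 8 + C3 + C4"
  show ?thesis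
  proof (rule that)
    show "C \<ge> 0" unfolding C_def using W0 C2 C3 C4 K by simp
    fix x :: nat and H :: real
    assume x: "x \<ge> 1" and H: "H \<ge> 1" and xH: "real x ^ (d + 3) \<le> H"
    define y where "y = real x"
    have y: "y \<ge> 1" using x by (simp add: y_def)
    define N where "N = nat \<lfloor>H\<rfloor>"
    define M where "M = real (2 * N + 1)"
    define L where "L = H powr (1 / 3)"
    define X where "X = height_box d N"
    define c where "c = real (card X)"
    define T where "T = y powr (4 / 9)"
    have T: "T \<ge> 1" using y by (simp add: T_def ge_one_powr_ge_zero)
    have N: "N \<ge> 1" "real N \<le> H" unfolding N_def using H by (auto simp: le_nat_iff)
    have M: "H \<le> M" "M > 0" unfolding M_def N_def using H by linarith+
    have L: "L \<ge> 1" "L > 0" using H by (auto simp: L_def ge_one_powr_ge_zero)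
    have "card X > 0" unfolding X_def using card_box[of d N] d N by simp
    then have c: "c > 0" by (simp add: c_def)
    have xd: "y ^ j \<le> H" if "j \<le> d + 3" for j
      using power_increasing[OF that y] xH by (simp add: y_def)
    have xN: "x \<le> N" using xd[of 1] unfolding N_def y_def by (simp add: le_nat_floor)
    have Hpow: "H powr (- \<kappa>) \<le> y powr (- (real j * \<kappa>))" if "j \<le> d + 3" "\<kappa> \<ge> 0" for j \<kappa>
    proof -
      have "y powr (real j * \<kappa>) = (y ^ j) powr \<kappa>" using y by (simp add: powr_powr flip: powr_realpow)
      also have "\<dots> \<le> H powr \<kappa>" using xd[OF that(1)] y that by (intro powr_mono2) auto
      finally show ?thesis using y H by (simp add: powr_minus le_imp_inverse_le)
    qed
    \<comment> \<open>As \<open>H\<close> may be far larger than any power of \<open>x\<close>,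
      error terms can be compared only after all powers of \<open>H\<close> are gathered into a
      negative one; \<open>H\<close> is then replaced by the smaller \<open>y ^ j\<close>.\<close>
    have absorb: "y powr a * H powr (- \<kappa>) \<le> T" if "j \<le> d + 3" "\<kappa> \<ge> 0" "a - real j * \<kappa> \<le> 4 / 9" for a \<kappa> j
    proof -
      have "y powr a * H powr (- \<kappa>) \<le> y powr a * y powr (- (real j * \<kappa>))"
        using Hpow[OF that(1,2)] by (intro mult_left_mono) auto
      also have "\<dots> = y powr (a - real j * \<kappa>)" by (simp add: powr_add[symmetric])
      also have "\<dots> \<le> T" unfolding T_def using y that by (intro powr_mono) auto
      finally show ?thesis .
    qed
    have y2: "y\<^sup>2 = y powr 2" using y by (simp add: powr_numeral)

    \<comment> \<open>A bound for 2 to the number of prime factors of \<open>P(n)\<close>, from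
      \<open>\<bar>P(n)\<bar> <= (d + 1) * N * n^d <= (d + 1) * H^2\<close>.\<close>
    define W where "W = C1 * (real (d + 1) * H\<^sup>2) powr \<eta>"
    have W1: "W \<ge> 1"
    proof -
      have "1 * 1 \<le> real (d + 1) * H\<^sup>2" using H by (intro mult_mono) auto
      then have "(real (d + 1) * H\<^sup>2) powr \<eta> \<ge> 1" using \<eta> by (intro ge_one_powr_ge_zero) auto
      then have "1 * 1 \<le> C1 * (real (d + 1) * H\<^sup>2) powr \<eta>" using C1 by (intro mult_mono) auto
      then show ?thesis by (simp add: W_def)
    qed
    have W2: "W\<^sup>2 = W0 * H powr (4 * \<eta>)"
    proof -
      have "((real (d + 1) * H\<^sup>2) powr \<eta>)\<^sup>2 = (real (d + 1) * H\<^sup>2) powr (2 * \<eta>)"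
        using H by (simp add: powr_power mult.commute)
      also have "\<dots> = real (d + 1) powr (2 * \<eta>) * (H\<^sup>2) powr (2 * \<eta>)" using H by (intro powr_mult)
      also have "(H\<^sup>2) powr (2 * \<eta>) = H powr (4 * \<eta>)" using H by (simp add: powr_powr flip: powr_numeral)
      finally show ?thesis by (simp add: W_def W0_def power_mult_distrib)
    qed
    have defect: "(\<Sum>P\<in>X. \<bar>sqfree_defect L (poly P (int n))\<bar> + (sqfree_defect L (poly P (int n)))\<^sup>2)
        \<le> c * (2 * W\<^sup>2 * (8 / L + 2 * sqrt (real (k + 3)) * (y powr (k / 2) * H powr (- 1 / 2))) + 2 * L\<^sup>2 / M)"
      if n: "n \<in> {1..x}" for n
    proof -
      have n1: "1 \<le> n" "n \<le> 2 * N + 1" "real n \<le> y" using n xN by (auto simp: y_def)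
      have "(\<Sum>P\<in>X. \<bar>sqfree_defect L (poly P (int n))\<bar> + (sqfree_defect L (poly P (int n)))\<^sup>2)
        \<le> c * (2 * W\<^sup>2 * (8 / L + 2 * sqrt (real (k + 3) * real N * real n ^ (k + 2)) / (real n * M)) + 2 * L\<^sup>2 / M)"
        unfolding X_def c_def M_def k(1)
      proof (rule sum_box_sqfree_defect[OF k(2) n1(1,2) L(1) W1])
        fix P assume P: "P \<in> height_box (Suc (Suc k)) N" and nz: "poly P (int n) \<noteq> 0"
        have P': "P \<in> height_box d N" using P k by simp
        let ?m = "nat \<bar>poly P (int n)\<bar>"
        have "real ?m = \<bar>real_of_int (poly P (int n))\<bar>" by simp
        also have "\<dots> \<le> real (Suc d) * real N * real n ^ d" by (rule poly_box_bound[OF P' n1(1)])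
        also have "\<dots> \<le> real (Suc d) * H * H"
        proof (intro mult_mono)
          have "real n ^ d \<le> y ^ d" using n1 by (intro power_mono) auto
          then show "real n ^ d \<le> H" using xd[of d] by simp
        qed (use N H in auto)
        finally have m: "real ?m \<le> real (d + 1) * H\<^sup>2" by (simp add: power2_eq_square)
        have "2 ^ card (prime_factors ?m) \<le> C1 * real ?m powr \<eta>" using nz by (intro C1(2)) simp
        also have "\<dots> \<le> W" unfolding W_def using C1 m \<eta> by (intro mult_left_mono powr_mono2) auto
        finally show "2 ^ card (prime_factors ?m) \<le> W" .
      qed
      also have "sqrt (real (k + 3) * real N * real n ^ (k + 2)) / (real n * M) \<le> sqrt (real (k + 3)) * (y powr (k / 2) * H powr (- 1 / 2))"
      proof -
        have n0: "real n > 0" using n1 by simp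
        \<comment> \<open>The denominator \<open>n\<close> cancels two powers under the root.
          Without this saving the exponent of \<open>y\<close>, apart from the factor
          \<open>W^2\<close>, would end at \<open>2 + d / 2 - (d + 3) / 2 = 1 / 2\<close>, above the
          target; with it the exponent is \<open>- 1 / 2\<close>.\<close>
        have "sqrt (real (k + 3) * real N * real n ^ (k + 2)) = sqrt (real (k + 3)) * sqrt (real N) * (sqrt (real n ^ k) * real n)"
          using n0 by (simp add: real_sqrt_mult power_add)
        then have "sqrt (real (k + 3) * real N * real n ^ (k + 2)) / (real n * M) = sqrt (real (k + 3)) * (sqrt (real n ^ k) * (sqrt (real N) / M))"
          using n0 M by (simp add: field_simps)
        also have "\<dots> \<le> sqrt (real (k + 3)) * (y powr (k / 2) * H powr (- 1 / 2))"
        proof (intro mult_left_mono mult_mono)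
          have "sqrt (real n ^ k) \<le> sqrt (y ^ k)" using n1 by (intro real_sqrt_le_mono power_mono) auto
          also have "\<dots> = y powr (k / 2)" using y by (simp add: powr_half_sqrt[symmetric] powr_powr flip: powr_realpow)
          finally show "sqrt (real n ^ k) \<le> y powr (k / 2)" .
          have "sqrt (real N) / M \<le> sqrt H / H" using N M H by (intro frac_le) auto
          also have "\<dots> = H powr (1 / 2) / H powr 1" using H by (simp add: powr_half_sqrt)
          also have "\<dots> = H powr (- 1 / 2)" by (subst powr_diff[symmetric]) simp
          finally show "sqrt (real N) / M \<le> H powr (- 1 / 2)" .
        qed (use M in auto)
        finally show ?thesis .
      qed
      then have "c * (2 * W\<^sup>2 * (8 / L + 2 * sqrt (real (k + 3) * real N * real n ^ (k + 2)) / (real n * M)) + 2 * L\<^sup>2 / M)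
          \<le> c * (2 * W\<^sup>2 * (8 / L + 2 * sqrt (real (k + 3)) * (y powr (k / 2) * H powr (- 1 / 2))) + 2 * L\<^sup>2 / M)"
        using c by (intro mult_left_mono add_mono order_refl) auto
      finally show ?thesis .
    qed
    \<comment> \<open>The singular series bound with \<open>X = H\<close> and
      \<open>L powr (- 9 / 10) = H powr (- 3 / 10)\<close>.\<close>
    define \<delta> where "\<delta> = C2 * H powr (- (3 / 10 - \<eta>))"
    have \<delta>: "\<delta> \<ge> 0" using C2 by (simp add: \<delta>_def)
    have trunc: "(\<Sum>P\<in>X. \<bar>singular_series P - truncated_series L P\<bar> + (singular_series P - truncated_series L P)\<^sup>2)
        \<le> c * ((\<delta> + \<delta>\<^sup>2) * K + 8 * L\<^sup>2 * real d / M)"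
      unfolding X_def c_def M_def K_def
    proof (rule sum_box_truncation[OF d N(1) L(1) \<delta>])
      fix P assume P: "P \<in> height_box d N" and sep: "separable P"
      have co: "\<bar>real_of_int (coeff P i)\<bar> \<le> H" for i
        using boxD(2)[OF P, of i] N(2) by linarith
      have "L powr (- 9 / 10) = H powr (- 3 / 10)" by (simp add: L_def powr_powr)
      then have eq: "C2 * H powr \<eta> * real_of_int (content P) * L powr (- 9 / 10) = \<delta> * real_of_int (content P)"
        by (simp add: \<delta>_def powr_add[symmetric] mult_ac) (simp add: powr_add mult_ac)?
      show "\<bar>singular_series P - truncated_series L P\<bar> \<le> \<delta> * real_of_int (content P)"
        using C2(2)[OF boxD(1)[OF P] H co sep L(2)] unfolding eq .
    qed

    have err: "\<bar>(\<Sum>P\<in>X. (sqfree_error P x)\<^sup>2) - (\<Sum>P\<in>X. (main_error x L P)\<^sup>2)\<bar> \<le>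
      c * (2 * y\<^sup>2 * (2 * W\<^sup>2 * (8 / L + 2 * sqrt (real (k + 3)) * (y powr (k / 2) * H powr (- 1 / 2))) + 2 * L\<^sup>2 / M)
         + 2 * y\<^sup>2 * ((\<delta> + \<delta>\<^sup>2) * K + 8 * L\<^sup>2 * real d / M))"
    proof -
      define b where "b = 2 * W\<^sup>2 * (8 / L + 2 * sqrt (real (k + 3)) * (y powr (k / 2) * H powr (- 1 / 2))) + 2 * L\<^sup>2 / M"
      let ?r = "\<lambda>P n. \<bar>sqfree_defect L (poly P n)\<bar> + (sqfree_defect L (poly P n))\<^sup>2"
      let ?s = "\<lambda>P. \<bar>singular_series P - truncated_series L P\<bar> + (singular_series P - truncated_series L P)\<^sup>2"
      have "\<bar>(\<Sum>P\<in>X. (sqfree_error P x)\<^sup>2) - (\<Sum>P\<in>X. (main_error x L P)\<^sup>2)\<bar> \<le>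
          (\<Sum>P\<in>X. \<bar>(sqfree_error P x)\<^sup>2 - (main_error x L P)\<^sup>2\<bar>)"
        unfolding sum_subtractf[symmetric] by (rule sum_abs)
      also have "\<dots> \<le> (\<Sum>P\<in>X. 2 * y * (\<Sum>n\<in>{1..int x}. ?r P n) + 2 * y\<^sup>2 * ?s P)"
        unfolding y_def by (intro sum_mono square_error_bound)
      also have "\<dots> = 2 * y * (\<Sum>n\<in>{1..int x}. \<Sum>P\<in>X. ?r P n) + 2 * y\<^sup>2 * (\<Sum>P\<in>X. ?s P)"
        by (simp only: sum.distrib sum_distrib_left[symmetric] sum.swap[of _ _ X])
      also have "(\<Sum>n\<in>{1..int x}. \<Sum>P\<in>X. ?r P n) \<le> (\<Sum>n\<in>{1..int x}. c * b)"
      proof (rule sum_mono)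
        fix n assume "n \<in> {1..int x}"
        then have "n = int (nat n)" "nat n \<in> {1..x}" by auto
        then show "(\<Sum>P\<in>X. ?r P n) \<le> c * b" using defect[of "nat n"] unfolding b_def by metis
      qed
      also have "(\<Sum>n\<in>{1..int x}. c * b) = y * (c * b)" by (simp add: y_def)
      also note trunc
      finally have "\<bar>(\<Sum>P\<in>X. (sqfree_error P x)\<^sup>2) - (\<Sum>P\<in>X. (main_error x L P)\<^sup>2)\<bar> \<le>
          2 * y * (y * (c * b)) + 2 * y\<^sup>2 * (c * ((\<delta> + \<delta>\<^sup>2) * K + 8 * L\<^sup>2 * real d / M))"
        using y by (simp add: mult_left_mono)
      then show ?thesis unfolding b_def[symmetric] by (simp add: algebra_simps power2_eq_square)
    qed
    have LM: "y\<^sup>2 * (L\<^sup>2 / M) \<le> T"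
    proof -
      have "L\<^sup>2 / M \<le> L\<^sup>2 / H" using M H by (intro divide_left_mono) auto
      also have "\<dots> = H powr (2 / 3) / H powr 1" using H by (simp add: L_def powr_power)
      also have "\<dots> = H powr (- (1 / 3))" by (subst powr_diff[symmetric]) simp
      finally have "y\<^sup>2 * (L\<^sup>2 / M) \<le> y powr 2 * H powr (- (1 / 3))" unfolding y2 by (intro mult_left_mono) auto
      also have "\<dots> \<le> T" by (rule absorb[of 6]) (use d in auto)
      finally show ?thesis .
    qed
    have e1: "y\<^sup>2 * (W\<^sup>2 * (1 / L)) \<le> W0 * T"
    proof -
      have "1 / L = H powr (- (1 / 3))" by (simp add: L_def powr_minus_divide)
      then have "y\<^sup>2 * (W\<^sup>2 * (1 / L)) = W0 * (y powr 2 * (H powr (4 * \<eta>) * H powr (- (1 / 3))))"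
        unfolding W2 y2 by simp
      also have "H powr (4 * \<eta>) * H powr (- (1 / 3)) = H powr (- (1 / 3 - 4 * \<eta>))"
        by (simp add: powr_add[symmetric])
      also have "W0 * (y powr 2 * H powr (- (1 / 3 - 4 * \<eta>))) \<le> W0 * T"
        using W0 \<eta> d by (intro mult_left_mono absorb[of 6]) auto
      finally show ?thesis .
    qed
    have e2: "y\<^sup>2 * (W\<^sup>2 * (y powr (k / 2) * H powr (- 1 / 2))) \<le> W0 * T"
    proof -
      have "y\<^sup>2 * (W\<^sup>2 * (y powr (k / 2) * H powr (- 1 / 2))) = W0 * ((y powr 2 * y powr (k / 2)) * (H powr (4 * \<eta>) * H powr (- 1 / 2)))"
        unfolding W2 y2 by simp
      also have "y powr 2 * y powr (k / 2) = y powr (2 + k / 2)" by (rule powr_add[symmetric])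
      also have "H powr (4 * \<eta>) * H powr (- 1 / 2) = H powr (- (1 / 2 - 4 * \<eta>))"
        by (simp add: powr_add[symmetric])
      also have "W0 * (y powr (2 + k / 2) * H powr (- (1 / 2 - 4 * \<eta>))) \<le> W0 * T"
      proof (intro mult_left_mono absorb[of "d + 3"] W0)
        have "real (d + 3) * (1 / 2 - 4 * \<eta>) = (real d + 3) / 2 - 4 * ((real d + 3) * \<eta>)" by (simp add: algebra_simps)
        also have "\<dots> = (real d + 3) / 2 - 4 / 9" unfolding \<eta>(2) by simp
        finally show "2 + k / 2 - real (d + 3) * (1 / 2 - 4 * \<eta>) \<le> 4 / 9" using k(1) by (simp add: field_simps)
      qed (use \<eta> in auto)
      finally show ?thesis .
    qed
    have e3: "y\<^sup>2 * (\<delta> + \<delta>\<^sup>2) \<le> (C2 + C2\<^sup>2) * T"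
    proof -
      define h where "h = H powr (- (3 / 10 - \<eta>))"
      have h: "0 \<le> h" "h \<le> 1" unfolding h_def using H \<eta> powr_mono[of "- (3 / 10 - \<eta>)" 0 H] by auto
      have yh: "y\<^sup>2 * h \<le> T" unfolding y2 h_def by (rule absorb[of 6]) (use \<eta> d in auto)
      have "h\<^sup>2 \<le> h" using h by (simp add: power2_eq_square mult_left_le)
      then have "C2 * h + C2\<^sup>2 * h\<^sup>2 \<le> C2 * h + C2\<^sup>2 * h" by (simp add: mult_left_mono)
      moreover have "\<delta> = C2 * h" by (simp add: \<delta>_def h_def)
      ultimately have "\<delta> + \<delta>\<^sup>2 \<le> (C2 + C2\<^sup>2) * h" by (simp add: power_mult_distrib algebra_simps)
      then have "y\<^sup>2 * (\<delta> + \<delta>\<^sup>2) \<le> y\<^sup>2 * ((C2 + C2\<^sup>2) * h)" by (intro mult_left_mono) auto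
      also have "\<dots> = (C2 + C2\<^sup>2) * (y\<^sup>2 * h)" by simp
      also have "\<dots> \<le> (C2 + C2\<^sup>2) * T" using yh C2 by (intro mult_left_mono) auto
      finally show ?thesis .
    qed
    have main: "\<bar>(\<Sum>P\<in>X. (main_error x L P)\<^sup>2) - c * (\<Sum>A\<in>prime_sets L. \<Sum>B\<in>prime_sets L. pair_kernel A B psi y)\<bar>
        \<le> 8 * y\<^sup>2 * L\<^sup>2 * c / M"
      unfolding X_def c_def M_def y_def k(1) by (rule sum_box_main_error_square[OF k(2)]) (use L in simp)
    have model: "\<bar>(\<Sum>A\<in>prime_sets L. \<Sum>B\<in>prime_sets L. pair_kernel A B psi y) - gamma0 * sqrt y\<bar> \<le> (C3 + C4) * T"
    proof -
      have y0: "y > 0" using y by simp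
      \<comment> \<open>The index \<open>n\<close> is auxiliary: large enough that the primes up to
        \<open>n\<close> include all those in \<open>prime_sets L\<close>, and that the operator
        product is already near its limit. The tail bound holds uniformly in
        \<open>n\<close>.\<close>
      have "eventually (\<lambda>n. \<bar>prime_op local_op n psi y - gamma0 * sqrt y\<bar> \<le> C4 * T \<and> L \<le> real n) sequentially"
        unfolding T_def
      proof (intro eventually_conj C4(2) y0)
        show "eventually (\<lambda>n. L \<le> real n) sequentially"
          using eventually_ge_at_top[of "nat \<lceil>L\<rceil>"] by eventually_elim linarith
      qed
      then obtain n where n: "\<bar>prime_op local_op n psi y - gamma0 * sqrt y\<bar> \<le> C4 * T" "L \<le> real n"
        using eventually_happens'[OF sequentially_bot] by blast
      have "\<bar>(\<Sum>A\<in>prime_sets L. \<Sum>B\<in>prime_sets L. pair_kernel A B psi y) - prime_op local_op n psi y\<bar> \<le> C3 * y * L powr (- 1 / 2)"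
        unfolding prime_sets_eq[OF n(2)] by (rule C3(2)[OF L(2) y0])
      also have "\<dots> = C3 * (y powr 1 * H powr (- (1 / 6)))" using y by (simp add: L_def powr_powr)
      also have "\<dots> \<le> C3 * T" using C3 d by (intro mult_left_mono absorb[of 6]) auto
      finally show ?thesis using n(1) by (simp add: distrib_right)
    qed
    let ?E = "\<Sum>P\<in>X. (sqfree_error P x)\<^sup>2" and ?D = "\<Sum>P\<in>X. (main_error x L P)\<^sup>2"
    let ?Q = "\<Sum>A\<in>prime_sets L. \<Sum>B\<in>prime_sets L. pair_kernel A B psi y"
    have "2 * y\<^sup>2 * (2 * W\<^sup>2 * (8 / L + 2 * sqrt (real (k + 3)) * (y powr (k / 2) * H powr (- 1 / 2))) + 2 * L\<^sup>2 / M)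
         + 2 * y\<^sup>2 * ((\<delta> + \<delta>\<^sup>2) * K + 8 * L\<^sup>2 * real d / M) =
       32 * (y\<^sup>2 * (W\<^sup>2 * (1 / L))) + 8 * sqrt (real (k + 3)) * (y\<^sup>2 * (W\<^sup>2 * (y powr (k / 2) * H powr (- 1 / 2)))) + 4 * (y\<^sup>2 * (L\<^sup>2 / M))
         + 2 * K * (y\<^sup>2 * (\<delta> + \<delta>\<^sup>2)) + 16 * real d * (y\<^sup>2 * (L\<^sup>2 / M))"
      by (simp add: algebra_simps add_divide_distrib)
    also have "\<dots> \<le> 32 * (W0 * T) + 8 * sqrt (real (k + 3)) * (W0 * T) + 4 * T + 2 * K * ((C2 + C2\<^sup>2) * T) + 16 * real d * T"
      using e1 e2 e3 LM K by (intro add_mono mult_left_mono) auto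
    also have "\<dots> = (4 * W0 * (8 + 2 * sqrt (real (k + 3))) + 4 + 2 * (C2 + C2\<^sup>2) * K + 16 * real d) * T"
      by (simp add: algebra_simps)
    finally have "\<bar>?E - ?D\<bar> \<le> c * ((4 * W0 * (8 + 2 * sqrt (real (k + 3))) + 4 + 2 * (C2 + C2\<^sup>2) * K + 16 * real d) * T)"
      using err c by (meson mult_left_mono order_trans less_imp_le)
    moreover have "\<bar>?D - c * ?Q\<bar> \<le> c * (8 * T)"
    proof -
      have "8 * y\<^sup>2 * L\<^sup>2 * c / M = c * (8 * (y\<^sup>2 * (L\<^sup>2 / M)))" by simp
      also have "\<dots> \<le> c * (8 * T)" using LM c by (intro mult_left_mono) auto
      finally show ?thesis using main by linarith
    qed
    moreover have "\<bar>c * ?Q - c * (gamma0 * sqrt y)\<bar> \<le> c * ((C3 + C4) * T)"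
      using model c by (simp add: abs_mult flip: right_diff_distrib)
    ultimately have "\<bar>?E - c * (gamma0 * sqrt y)\<bar> \<le>
        c * ((4 * W0 * (8 + 2 * sqrt (real (k + 3))) + 4 + 2 * (C2 + C2\<^sup>2) * K + 16 * real d) * T) + c * (8 * T) + c * ((C3 + C4) * T)"
      by linarith
    also have "\<dots> = c * (C * T)" by (simp add: C_def algebra_simps)
    finally have "\<bar>?E - c * (gamma0 * sqrt y)\<bar> / c \<le> C * T" using c by (simp add: pos_divide_le_eq mult.commute)
    moreover have "\<bar>?E - c * (gamma0 * sqrt y)\<bar> / c = \<bar>?E / c - gamma0 * sqrt y\<bar>"
    proof -
      have "?E / c - gamma0 * sqrt y = (?E - c * (gamma0 * sqrt y)) / c" using c by (simp add: diff_divide_distrib)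
      then show ?thesis using c by (simp add: abs_divide)
    qed
    ultimately show "\<bar>(\<Sum>P\<in>height_box d (nat \<lfloor>H\<rfloor>). (sqfree_error P x)\<^sup>2) / real (card (height_box d (nat \<lfloor>H\<rfloor>))) - gamma0 * sqrt x\<bar>
        \<le> C * real x powr (4 / 9)"
      by (simp add: X_def c_def T_def y_def N_def)
  qed
qed

lemma second_moment_asymptotic:
  fixes d :: nat
  assumes d: "d \<ge> 3"
  shows "\<exists>C \<ge> 0. \<forall>(x :: nat) H. x \<ge> 1 \<longrightarrow> H \<ge> 1 \<longrightarrow> real x ^ (d + 3) \<le> H \<longrightarrow>
    \<bar>second_moment d x H - gamma0 * real x powr (1 / 2)\<bar> \<le> C * real x powr (4 / 9)"
proof -
  obtain C where C: "C \<ge> 0" "\<And>(x :: nat) H. x \<ge> 1 \<Longrightarrow> H \<ge> 1 \<Longrightarrow> real x ^ (d + 3) \<le> H \<Longrightarrow>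
      \<bar>(\<Sum>P\<in>height_box d (nat \<lfloor>H\<rfloor>). (sqfree_error P x)\<^sup>2) / real (card (height_box d (nat \<lfloor>H\<rfloor>))) - gamma0 * sqrt x\<bar>
        \<le> C * real x powr (4 / 9)"
    using mean_square_error_bound[OF d] by blast
  define K where "K = 2 ^ d + real d + 1"
  have K: "K \<ge> 0" by (simp add: K_def)
  show ?thesis
  proof (intro exI[of _ "(1 + K) * C + K * \<bar>gamma0\<bar>"] conjI allI impI)
    show "(1 + K) * C + K * \<bar>gamma0\<bar> \<ge> 0" using K C by simp
    fix x :: nat and H :: real
    assume x: "x \<ge> 1" and H: "H \<ge> 1" and xH: "real x ^ (d + 3) \<le> H"
    let ?X = "height_box d (nat \<lfloor>H\<rfloor>)"
    define c where "c = real (card ?X)"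
    define m where "m = (\<Sum>P\<in>?X. (sqfree_error P x)\<^sup>2) / c"
    define r where "r = c / (2 * H) ^ Suc d"
    define T where "T = real x powr (4 / 9)"
    have T: "T \<ge> 1" using x by (simp add: T_def ge_one_powr_ge_zero)
    have "nat \<lfloor>H\<rfloor> \<ge> 1" using H by (simp add: le_nat_iff)
    then have "card ?X > 0" using card_box[of d "nat \<lfloor>H\<rfloor>"] d H by simp
    then have "c > 0" unfolding c_def by simp
    moreover have "second_moment d x H = (\<Sum>P\<in>?X. (sqfree_error P x)\<^sup>2) / (2 * H) ^ Suc d"
    proof -
      have "- int d - 1 = - int (Suc d)" by simp
      then have "(2 * H) powi (- int d - 1) = inverse ((2 * H) ^ Suc d)"
        by (simp only: power_int_minus power_int_of_nat)
      moreover have "{P. degree P = d \<and> real_of_int (height P) \<le> H} = ?X"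
        by (rule height_set_eq_box) (use H in auto)
      ultimately show ?thesis unfolding second_moment_def by (simp only: power2_abs divide_inverse mult.commute)
    qed
    ultimately have sm: "second_moment d x H = r * m" by (simp add: r_def m_def)
    have r: "\<bar>r - 1\<bar> \<le> K / H"
      unfolding r_def c_def K_def by (rule card_box_ratio) (use d H in auto)
    also have "K / H \<le> K" using K H by (simp add: divide_le_eq mult_le_cancel_left1)
    finally have "r \<le> 1 + K" "r \<ge> 0" using c_def H by (auto simp: r_def)
    have "\<bar>m - gamma0 * sqrt x\<bar> \<le> C * T"
      unfolding m_def c_def T_def by (rule C(2)[OF x H xH])
    then have 1: "\<bar>r * (m - gamma0 * sqrt x)\<bar> \<le> (1 + K) * (C * T)"
      unfolding abs_mult using \<open>r \<le> 1 + K\<close> \<open>r \<ge> 0\<close> K by (intro mult_mono) auto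
    have "sqrt x \<le> H"
    proof -
      have "sqrt x \<le> sqrt (real x ^ 2)" using x by (intro real_sqrt_le_mono) (simp add: power2_eq_square)
      also have "\<dots> = real x ^ 1" by simp
      also have "\<dots> \<le> real x ^ (d + 3)" using x by (intro power_increasing) auto
      finally show ?thesis using xH by simp
    qed
    have "\<bar>(r - 1) * (gamma0 * sqrt x)\<bar> \<le> (K / H) * (\<bar>gamma0\<bar> * H)"
      unfolding abs_mult using r \<open>sqrt x \<le> H\<close> by (intro mult_mono) auto
    also have "\<dots> = K * \<bar>gamma0\<bar> * 1" using H by simp
    also have "\<dots> \<le> K * \<bar>gamma0\<bar> * T" using K T by (intro mult_left_mono) auto
    finally have 2: "\<bar>(r - 1) * (gamma0 * sqrt x)\<bar> \<le> K * \<bar>gamma0\<bar> * T" .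
    have "second_moment d x H - gamma0 * sqrt x = r * (m - gamma0 * sqrt x) + (r - 1) * (gamma0 * sqrt x)"
      unfolding sm by (simp add: algebra_simps)
    then have "\<bar>second_moment d x H - gamma0 * sqrt x\<bar> \<le> (1 + K) * (C * T) + K * \<bar>gamma0\<bar> * T"
      using 1 2 by linarith
    also have "\<dots> = ((1 + K) * C + K * \<bar>gamma0\<bar>) * T" by (simp add: algebra_simps)
    finally show "\<bar>second_moment d x H - gamma0 * real x powr (1 / 2)\<bar> \<le> ((1 + K) * C + K * \<bar>gamma0\<bar>) * real x powr (4 / 9)"
      by (simp add: T_def powr_half_sqrt)
  qed
qed

text \<open>For \<theta> at most 0 the right-hand side of \<open>x <= H powr \<theta>\<close> would
  be at most 1. So nonpositive exponents make the claim vacuous, and \<open>1 / \<theta>\<close> is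
  available as a bound for \<open>d\<close>.\<close>

lemma power_le_of_le_powr:
  fixes x :: nat and H \<theta> :: real
  assumes x: "x > 1" and H: "H \<ge> 1" and le: "real x \<le> H powr \<theta>" and \<theta>: "\<theta> \<le> 1 / (real d + 3)"
  shows "real x ^ (d + 3) \<le> H" "\<theta> > 0"
proof -
  have "real x ^ (d + 3) \<le> (H powr \<theta>) ^ (d + 3)" using le by (intro power_mono) auto
  also have "\<dots> = H powr (real (d + 3) * \<theta>)" using H by (subst powr_realpow[symmetric]) (simp_all add: powr_powr mult.commute)
  also have "\<dots> \<le> H powr 1" using H \<theta> by (intro powr_mono) (simp_all add: field_simps)
  finally show "real x ^ (d + 3) \<le> H" using H by simp
  show "\<theta> > 0"
  proof (rule ccontr)
    assume "\<not> \<theta> > 0"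
    then have "H powr \<theta> \<le> H powr 0" using H by (intro powr_mono) auto
    then show False using le x H by simp
  qed
qed

theorem theorem1p1:
  shows "(\<exists>C :: real \<Rightarrow> real \<Rightarrow> real. \<forall>(d::nat) > 2. \<forall>\<alpha>::real. \<alpha> < 1 / (real d + 3) \<longrightarrow>
            (\<exists>\<delta> > 0. \<forall>(x::nat) > 2. \<forall>H::real. H \<ge> 1 \<and> real x \<le> H powr \<alpha> \<longrightarrow>
               \<bar>second_moment d x H - gamma0 * real x powr (1 / 2)\<bar>
                 \<le> C \<alpha> \<delta> * real x powr (1 / 2 - \<delta>)))
       \<and> (\<exists>C :: real \<Rightarrow> real \<Rightarrow> real. \<forall>(d::nat) > 2. \<forall>\<epsilon>::real. \<forall>\<beta>::real.
            \<epsilon> > 0 \<and> 0 < \<beta> \<and> \<beta> < 1 / (real d + 28 / 9) \<longrightarrow>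
            (\<forall>(x::nat) > 2. \<forall>H::real. H \<ge> 1 \<and> real x \<le> H powr \<beta> \<longrightarrow>
               \<bar>second_moment d x H - gamma0 * real x powr (1 / 2)\<bar>
                 \<le> C \<epsilon> \<beta> * real x powr (4 / 9 + \<epsilon>)))"
proof -
  \<comment> \<open>For each degree only the existence of a constant is known. Choosing one value
    \<open>C d\<close> per degree makes it possible to combine finitely many of them.\<close>
  define B where "B d C \<longleftrightarrow> C \<ge> 0 \<and> (\<forall>(x :: nat) H. x \<ge> 1 \<longrightarrow> H \<ge> 1 \<longrightarrow> real x ^ (d + 3) \<le> H \<longrightarrow>
    \<bar>second_moment d x H - gamma0 * real x powr (1 / 2)\<bar> \<le> C * real x powr (4 / 9))" for d C
  define C where "C d = (SOME C. B d C)" for d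
  have B: "B d (C d)" if "d \<ge> 3" for d
    unfolding C_def by (rule someI_ex) (use second_moment_asymptotic[OF that] in \<open>simp add: B_def\<close>)
  have C: "\<And>d :: nat. d \<ge> 3 \<Longrightarrow> C d \<ge> 0"
    "\<And>d (x :: nat) H. d \<ge> 3 \<Longrightarrow> x \<ge> 1 \<Longrightarrow> H \<ge> 1 \<Longrightarrow> real x ^ (d + 3) \<le> H \<Longrightarrow>
      \<bar>second_moment d x H - gamma0 * real x powr (1 / 2)\<bar> \<le> C d * real x powr (4 / 9)"
    using B unfolding B_def by auto
  define K where "K \<theta> = (\<Sum>d\<in>{3..nat \<lceil>1 / \<theta>\<rceil>}. C d)" for \<theta> :: real
  \<comment> \<open>The hypotheses force \<open>d < 1 / \<theta>\<close>, so a sum over finitely many \<open>d\<close> is a bound uniform in \<open>d\<close>.\<close>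
  have main: "\<bar>second_moment d x H - gamma0 * real x powr (1 / 2)\<bar> \<le> K \<theta> * real x powr (4 / 9)"
    if d: "d > 2" and \<theta>: "\<theta> < 1 / (real d + 3)" and x: "x > 2" and H: "H \<ge> 1" and le: "real x \<le> H powr \<theta>"
    for d x :: nat and \<theta> H :: real
  proof -
    have p: "real x ^ (d + 3) \<le> H" "\<theta> > 0" using power_le_of_le_powr[of x H \<theta> d] x H le \<theta> by auto
    have "real d < 1 / \<theta>" using \<theta> p(2) by (simp add: field_simps)
    then have "int d \<le> \<lceil>1 / \<theta>\<rceil>" by linarith
    then have "d \<in> {3..nat \<lceil>1 / \<theta>\<rceil>}" using d by (auto simp: le_nat_iff)
    then have "C d \<le> K \<theta>" unfolding K_def using C(1) by (intro member_le_sum) auto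
    then have "C d * real x powr (4 / 9) \<le> K \<theta> * real x powr (4 / 9)" by (intro mult_right_mono) auto
    moreover have "d \<ge> 3" "x \<ge> 1" using d x by auto
    ultimately show ?thesis by (intro order_trans[OF C(2)[OF _ _ H p(1)]])
  qed
  show ?thesis
  proof (rule conjI, goal_cases)
    case 1
    show ?case
    \<comment> \<open>The exponent saving is \<open>1 / 2 - 4 / 9 = 1 / 18\<close>, whatever
      \<alpha> and \<open>d\<close> are.\<close>
    proof (intro exI[of _ "\<lambda>\<theta> _. K \<theta>"] exI[of _ "1 / 18 :: real"] allI impI conjI; (elim conjE)?)
      fix d x :: nat and \<alpha> H :: real
      assume "d > 2" "\<alpha> < 1 / (real d + 3)" "x > 2" "H \<ge> 1" "real x \<le> H powr \<alpha>"
      then show "\<bar>second_moment d x H - gamma0 * real x powr (1 / 2)\<bar> \<le> K \<alpha> * real x powr (1 / 2 - 1 / 18)"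
        using main[of d \<alpha> x H] by simp
    qed simp_all
  next
    case 2
    show ?case
    proof (intro exI[of _ "\<lambda>_ \<theta>. \<bar>K \<theta>\<bar>"] allI impI; elim conjE)
      fix d x :: nat and \<epsilon> \<beta> H :: real
      assume "d > 2" "\<epsilon> > 0" "0 < \<beta>" "\<beta> < 1 / (real d + 28 / 9)" "x > 2" "H \<ge> 1" "real x \<le> H powr \<beta>"
      \<comment> \<open>Since \<open>28 / 9 > 3\<close>, the second range of exponents lies inside
        the first, where the error \<open>x powr (4 / 9)\<close> is already available.\<close>
      have "1 / (real d + 28 / 9) \<le> 1 / (real d + 3)" by (intro divide_left_mono) (auto intro!: mult_pos_pos add_nonneg_pos)
      then have "\<beta> < 1 / (real d + 3)" using \<open>\<beta> < 1 / (real d + 28 / 9)\<close> by linarith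
      then have "\<bar>second_moment d x H - gamma0 * real x powr (1 / 2)\<bar> \<le> K \<beta> * real x powr (4 / 9)"
        using \<open>d > 2\<close> \<open>x > 2\<close> \<open>H \<ge> 1\<close> \<open>real x \<le> H powr \<beta>\<close> by (intro main)
      also have "\<dots> \<le> \<bar>K \<beta>\<bar> * real x powr (4 / 9 + \<epsilon>)"
        using \<open>x > 2\<close> \<open>\<epsilon> > 0\<close> by (intro mult_mono powr_mono) auto
      finally show "\<bar>second_moment d x H - gamma0 * real x powr (1 / 2)\<bar> \<le> \<bar>K \<beta>\<bar> * real x powr (4 / 9 + \<epsilon>)" .
    qed
  qed
qed

end
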